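(* Let $k\ge 0$ be an integer and let $\varphi_\epsilon=\epsilon^{\frac{1}{k-\frac1\alpha+2}}$. Let $G$ be a bounded function satisfying conditions $(A_2)$ and $(A_3)$, and let $\widehat{\theta}_tX_t$ be the associated kernel estimator (see context). Then, for any $0<c\le d<T$, $$\limsup_{\epsilon\to0}\ \sup_{\theta(\cdot)\in\Theta_{k+1}(L)}\ \sup_{c\le t\le d} E_\theta\big(|\widehat{\theta}_tX_t-\theta(t)x_t|\big)\,\epsilon^{-\frac{k+1}{k-\frac1\alpha+2}}<\infty .$$
   Context: **Noise.** A random variable $Z$ has the stable law $S_\alpha(\sigma,\beta,\mu)$ (with $\alpha\neq 1$, $\alpha\in(0,2]$, $\sigma>0$, $\beta\in[-1,1]$, $\mu\in\mathbb{R}$) if $E[e^{iuZ}]=\exp\{-\sigma^\alpha|u|^\alpha(1-i\beta\,\mathrm{sgn}(u)\tan(\alpha\pi/2))+i\mu u\}$. Throughout $1<\alpha<2$ and $\beta\in[-1,1]$ are fixed. On a probability space $(\Omega,\mathcal{F},P)$ with a right-continuous filtration $\{\mathcal{F}_t\}$, $Z=\{Z_t,t\ge0\}$ is a standard $\alpha$-stable Lévy process: adapted (càdlàg), $Z_0=0$ a.s., with independent increments, and $Z_t-Z_s\sim S_\alpha((t-s)^{1/\alpha},\beta,0)$ for $0\le s<t$. **Model.** Fix $T>0$, $x_0\in\mathbb{R}$. For $\epsilon>0$ and a function $\theta$, $X=\{X_t,0\le t\le T\}$ solves $dX_t=\theta(t)X_t\,dt+\epsilon\,dZ_t$, $X_0=x_0$,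 $0\le t\le T$. The function $x_t$ solves $dx_t/dt=\theta(t)x_t$ with initial value $x_0$, i.e. $x_t=x_0\exp(\int_0^t\theta(s)ds)$. $E_\theta$ denotes expectation when $\theta(\cdot)$ is the linear multiplier. **Condition $(A_1)$ and function class.** $(A_1)$: $|\theta(t)|\le L$ for all $t\in[0,T]$. Fix constants $L,L'>0$. For an integer $j\ge0$, $\Theta_j(L)$ is the class of all functions $\theta$ which satisfy $(A_1)$ with this $L$, are $j$ times differentiable, and satisfy $|\theta^{(j)}(x)-\theta^{(j)}(y)|\le L'|x-y|$ for all $x,y\in\mathbb{R}$, where $\theta^{(0)}=\theta$. **Condition $(A_2)$.** $G:\mathbb{R}\to\mathbb{R}$ is bounded (measurable), there are $A<0<B$ with $G(u)=0$ for $u<A$ and $u>B$, and $\int_A^B G(u)\,du=1$. **Condition $(A_3)$.** $\int_{-\infty}^\infty u^jG(u)\,du=0$ for $j=1,2,\dots,k$. **Estimator.** The quantity $\widehat{\theta}_tX_t$ is defined by $$\widehat{\theta}_tX_t=\frac1{\varphi_\epsilon}\int_0^T G\Big(\frac{\tau-t}{\varphi_\epsilon}\Big)\,dX_\tau .$$ *)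

theory Defs
  imports "HOL-Probability.Probability"
begin

definition cadlag_on :: "real set \<Rightarrow> (real \<Rightarrow> real) \<Rightarrow> bool" where
  "cadlag_on S f \<longleftrightarrow>
     (\<forall>t\<in>S. (f \<longlongrightarrow> f t) (at t within (S \<inter> {t<..})) \<and>
            (\<exists>l. (f \<longlongrightarrow> l) (at t within (S \<inter> {..<t}))))"

text \<open>Time runs through \<open>[0, \<infinity>)\<close>; the values of \<open>F\<close> at negative times are irrelevant.\<close>

definition right_continuous_filtration :: "'a measure \<Rightarrow> (real \<Rightarrow> 'a measure) \<Rightarrow> bool" where
  "right_continuous_filtration M F \<longleftrightarrow>
     (\<forall>t\<ge>0. subalgebra M (F t)) \<and>
     (\<forall>s\<ge>0. \<forall>t\<ge>s. sets (F s) \<subseteq> sets (F t)) \<and>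
     (\<forall>t\<ge>0. sets (F t) = (\<Inter>s\<in>{t<..}. sets (F s)))"

definition has_stable_law ::
  "'a measure \<Rightarrow> real \<Rightarrow> real \<Rightarrow> real \<Rightarrow> real \<Rightarrow> ('a \<Rightarrow> real) \<Rightarrow> bool" where
  "has_stable_law M \<alpha> \<sigma> \<beta> \<mu> Y \<longleftrightarrow>
     0 < \<alpha> \<and> \<alpha> \<le> 2 \<and> \<alpha> \<noteq> 1 \<and> 0 < \<sigma> \<and> -1 \<le> \<beta> \<and> \<beta> \<le> 1 \<and>
     Y \<in> borel_measurable M \<and>
     (\<forall>u::real. char (distr M borel Y) u =
        exp (- complex_of_real (\<sigma> powr \<alpha> * \<bar>u\<bar> powr \<alpha>)
               * (1 - \<i> * complex_of_real (\<beta> * sgn u * tan (\<alpha> * pi / 2)))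
             + \<i> * complex_of_real (\<mu> * u)))"

definition independent_increments :: "'a measure \<Rightarrow> (real \<Rightarrow> 'a \<Rightarrow> real) \<Rightarrow> bool" where
  "independent_increments M Z \<longleftrightarrow>
     (\<forall>(n::nat) t. 0 \<le> t 0 \<and> strict_mono_on {..n} t \<longrightarrow>
        prob_space.indep_vars M (\<lambda>_. borel) (\<lambda>i \<omega>. Z (t (Suc i)) \<omega> - Z (t i) \<omega>) {..<n})"

definition stable_Levy_process ::
  "'a measure \<Rightarrow> (real \<Rightarrow> 'a measure) \<Rightarrow> real \<Rightarrow> real \<Rightarrow> (real \<Rightarrow> 'a \<Rightarrow> real) \<Rightarrow> bool" where
  "stable_Levy_process M F \<alpha> \<beta> Z \<longleftrightarrow>
     (\<forall>t\<ge>0. Z t \<in> borel_measurable (F t)) \<and>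
     (AE \<omega> in M. cadlag_on {0..} (\<lambda>t. Z t \<omega>)) \<and>
     (AE \<omega> in M. Z 0 \<omega> = 0) \<and>
     independent_increments M Z \<and>
     (\<forall>s\<ge>0. \<forall>t>s. has_stable_law M \<alpha> ((t - s) powr (1 / \<alpha>)) \<beta> 0 (\<lambda>\<omega>. Z t \<omega> - Z s \<omega>))"

text \<open>The noise is additive, so the equation
  \<open>dX\<^sub>t = \<theta>(t) X\<^sub>t dt + \<epsilon> dZ\<^sub>t\<close>, \<open>X\<^sub>0 = x\<^sub>0\<close>, in integrated form involves only
  a pathwise Lebesgue integral.\<close>

definition solves_linear_SDE ::
  "'a measure \<Rightarrow> (real \<Rightarrow> 'a measure) \<Rightarrow> (real \<Rightarrow> 'a \<Rightarrow> real) \<Rightarrow> real \<Rightarrow> real \<Rightarrow>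
   (real \<Rightarrow> real) \<Rightarrow> real \<Rightarrow> (real \<Rightarrow> 'a \<Rightarrow> real) \<Rightarrow> bool" where
  "solves_linear_SDE M F Z T x0 \<theta> \<epsilon> X \<longleftrightarrow>
     (\<forall>t\<in>{0..T}. X t \<in> borel_measurable (F t)) \<and>
     (AE \<omega> in M. cadlag_on {0..T} (\<lambda>t. X t \<omega>) \<and>
        (\<forall>t\<in>{0..T}. X t \<omega> = x0 + (LINT s:{0..t}|lborel. \<theta> s * X s \<omega>) + \<epsilon> * Z t \<omega>))"

definition unperturbed :: "real \<Rightarrow> (real \<Rightarrow> real) \<Rightarrow> real \<Rightarrow> real" where
  "unperturbed x0 \<theta> t = x0 * exp (LINT s:{0..t}|lborel. \<theta> s)"

text \<open>A triple \<open>n, p, a\<close> encodes the step function with value \<open>a i\<close> on \<open>(p i, p (i + 1)]\<close> for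
  \<open>i < n\<close>, and 0 elsewhere.\<close>

definition step_fun :: "nat \<Rightarrow> (nat \<Rightarrow> real) \<Rightarrow> (nat \<Rightarrow> real) \<Rightarrow> real \<Rightarrow> real" where
  "step_fun n p a \<tau> = (\<Sum>i<n. a i * indicator {p i<..p (Suc i)} \<tau>)"

definition step_integral ::
  "nat \<Rightarrow> (nat \<Rightarrow> real) \<Rightarrow> (nat \<Rightarrow> real) \<Rightarrow> (real \<Rightarrow> 'a \<Rightarrow> real) \<Rightarrow> 'a \<Rightarrow> real" where
  "step_integral n p a Y \<omega> = (\<Sum>i<n. a i * (Y (p (Suc i)) \<omega> - Y (p i) \<omega>))"

text \<open>\<open>I\<close> is a version of \<open>\<integral>\<^sub>0\<^sup>T f(\<tau>) dY\<^sub>\<tau>\<close> for a deterministic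
  integrand \<open>f\<close>: the limit in probability of the integrals of step functions that converge to
  \<open>f\<close> in \<open>L\<^sup>\<alpha>[0,T]\<close>. This is the usual construction of the integral against an
  \<open>\<alpha>\<close>-stable Levy process. For \<open>\<alpha> \<ge> 1\<close> it equally covers integrators \<open>Y\<close> that are
  the sum of such a process and a process whose paths have a bounded density, since convergence
  in \<open>L\<^sup>\<alpha>[0,T]\<close> implies convergence in \<open>L\<^sup>1[0,T]\<close>.\<close>

definition has_stochastic_integral ::
  "'a measure \<Rightarrow> real \<Rightarrow> real \<Rightarrow> (real \<Rightarrow> 'a \<Rightarrow> real) \<Rightarrow> (real \<Rightarrow> real) \<Rightarrow> ('a \<Rightarrow> real) \<Rightarrow> bool" where
  "has_stochastic_integral M \<alpha> T Y f I \<longleftrightarrow>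
     I \<in> borel_measurable M \<and>
     (\<exists>(n :: nat \<Rightarrow> nat) (p :: nat \<Rightarrow> nat \<Rightarrow> real) (a :: nat \<Rightarrow> nat \<Rightarrow> real).
        (\<forall>m. mono_on {..n m} (p m) \<and> p m ` {..n m} \<subseteq> {0..T}) \<and>
        ((\<lambda>m. \<integral>\<^sup>+\<tau>\<in>{0..T}. ennreal (\<bar>step_fun (n m) (p m) (a m) \<tau> - f \<tau>\<bar> powr \<alpha>) \<partial>lborel)
           \<longlonglongrightarrow> 0) \<and>
        (\<forall>\<delta>>0. (\<lambda>m. measure M {\<omega> \<in> space M.
                    \<bar>step_integral (n m) (p m) (a m) Y \<omega> - I \<omega>\<bar> > \<delta>}) \<longlonglongrightarrow> 0))"

text \<open>Only \<open>\<bar>\<theta>\<bar> \<le> L\<close> is restricted to \<open>[0,T]\<close>; differentiability and the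
  Lipschitz condition are required on the whole line.\<close>

definition Theta_class :: "nat \<Rightarrow> real \<Rightarrow> real \<Rightarrow> real \<Rightarrow> (real \<Rightarrow> real) set" where
  "Theta_class j L L' T =
     {\<theta>. (\<forall>t\<in>{0..T}. \<bar>\<theta> t\<bar> \<le> L) \<and>
         (\<forall>i<j. \<forall>x. (deriv ^^ i) \<theta> differentiable (at x)) \<and>
         (\<forall>x y. \<bar>(deriv ^^ j) \<theta> x - (deriv ^^ j) \<theta> y\<bar> \<le> L' * \<bar>x - y\<bar>)}"

definition kernel_A2 :: "(real \<Rightarrow> real) \<Rightarrow> bool" where
  "kernel_A2 G \<longleftrightarrow>
     G \<in> borel_measurable borel \<and> bounded (range G) \<and>
     (\<exists>A B. A < 0 \<and> 0 < B \<and> (\<forall>u. u < A \<or> u > B \<longrightarrow> G u = 0) \<and>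
            (LINT u:{A..B}|lborel. G u) = 1)"

definition kernel_A3 :: "nat \<Rightarrow> (real \<Rightarrow> real) \<Rightarrow> bool" where
  "kernel_A3 k G \<longleftrightarrow> (\<forall>j\<in>{1..k}. (LINT u|lborel. u ^ j * G u) = 0)"

definition bandwidth :: "nat \<Rightarrow> real \<Rightarrow> real \<Rightarrow> real" where
  "bandwidth k \<alpha> \<epsilon> = \<epsilon> powr (1 / (real k - 1 / \<alpha> + 2))"

text \<open>\<open>D\<close> is a version of the quantity called \<open>\<theta>-hat\<^sub>t X\<^sub>t\<close>, that is, of
  \<open>\<phi>\<^sup>-\<^sup>1 \<integral>\<^sub>0\<^sup>T G ((\<tau> - t) / \<phi>) dX\<^sub>\<tau>\<close>.\<close>

definition is_kernel_estimator ::
  "'a measure \<Rightarrow> real \<Rightarrow> real \<Rightarrow> (real \<Rightarrow> real) \<Rightarrow> real \<Rightarrow> (real \<Rightarrow> 'a \<Rightarrow> real) \<Rightarrow> real \<Rightarrow>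
   ('a \<Rightarrow> real) \<Rightarrow> bool" where
  "is_kernel_estimator M \<alpha> T G \<phi> X t D \<longleftrightarrow>
     (\<exists>J. has_stochastic_integral M \<alpha> T X (\<lambda>\<tau>. G ((\<tau> - t) / \<phi>)) J \<and>
          D = (\<lambda>\<omega>. (1 / \<phi>) * J \<omega>))"

end

theory Submission
  imports Defs
begin

text \<open>
  Put \<open>v = X - x\<close>. Since the noise is additive, \<open>v\<close> solves a linear Volterra equation driven by
  \<open>\<epsilon> Z\<close>, and Gronwall's inequality for \<open>\<integral>\<bar>v\<bar>\<close> bounds \<open>\<bar>v\<^sub>t\<bar>\<close> pathwise by
  \<open>\<epsilon> (\<bar>Z\<^sub>t\<bar> + C \<integral>\<bar>Z\<bar>)\<close>; so only first moments of \<open>Z\<close> at fixed times are needed, no maximal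
  inequality. With \<open>G\<^sub>\<phi> = G ((\<cdot> - t) / \<phi>)\<close>, the error of the estimator splits into a drift part of order \<open>\<epsilon>\<close>,
  a noise part \<open>\<epsilon> \<phi>\<^sup>-\<^sup>1 E\<bar>\<integral> G\<^sub>\<phi> dZ\<bar>\<close> and the bias of the kernel smoother applied to \<open>\<theta> x\<close>.
  The noise part is of order \<open>\<epsilon> \<phi>\<^sup>-\<^sup>1 \<parallel>G\<^sub>\<phi>\<parallel>\<^sub>\<alpha>\<close>, because
  \<open>\<bar>y\<bar> \<le> C \<integral>\<^sub>0\<^sup>\<infinity> (1 - cos (u y)) u\<^sup>-\<^sup>2 du\<close> turns a bound on the characteristic function near \<open>0\<close>
  into a bound on the first absolute moment. The bias is of order \<open>\<phi>\<^sup>k\<^sup>+\<^sup>1\<close> by Taylor's theorem and the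
  moment conditions, uniformly over the class, since \<open>\<bar>\<theta>\<bar> \<le> L\<close> and the Lipschitz bound on the top
  derivative bound all intermediate derivatives. The bandwidth makes noise and bias the same order.
\<close>

section \<open>First absolute moments from characteristic functions\<close>

text \<open>The estimator is known only as a limit in probability of step integrals of
  \<open>X\<close>, and such a limit does not by itself control expectations. Every moment bound is
  therefore proved for step integrals and carried to the limit by truncation and Fatou. The error of
  approximating the kernel enters through a free slack \<open>\<eta>\<close>, finally chosen as
  \<open>\<phi> ^ (k + 2)\<close> so that it still has order \<open>\<phi> ^ (k + 1)\<close> after
  division by \<open>\<phi>\<close>. The integral over frequencies is cut at a point
  \<open>R\<close> that also stays free. Its final value
  \<open>\<phi> powr (- (1 / \<alpha>))\<close> is, up to constants, the inverse of the
  \<open>L^\<alpha>\<close> norm of the rescaled kernel. As \<open>\<epsilon>\<close> equals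
  \<open>\<phi> powr (k + 2 - 1 / \<alpha>)\<close>, the noise term
  \<open>\<epsilon> * \<phi> powr (1 / \<alpha> - 1)\<close> then becomes
  \<open>\<phi> ^ (k + 1)\<close>. Uniformity in \<open>t\<close> rests on \<open>0 < c\<close> and
  \<open>d < T\<close>: for small \<open>\<epsilon>\<close> the support of the rescaled kernel stays
  inside \<open>(0,T)\<close>, so no boundary effect spoils the moment conditions. Uniformity in
  \<theta> requires constants that depend on the class alone, which is why the derivative lemmas
  choose their constant before the function.\<close>

lemma one_minus_cos_1_pos: "1 - cos (1::real) > 0"
  using cos_monotone_0_pi[of 0 1] pi_gt3 by simp

text \<open>The window \<open>1 \<le> u * \<bar>y\<bar> \<le> 2\<close> already carries enough mass.
  It has length \<open>1 / \<bar>y\<bar>\<close>, the numerator there is at least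
  \<open>1 - cos 1\<close> because cosine decreases on \<open>[0,\<pi>]\<close>, and
  \<open>1 / u^2\<close> is at least \<open>y^2 / 4\<close>.\<close>

lemma abs_le_nn_integral_cos:
  fixes y :: real
  shows "ennreal \<bar>y\<bar> \<le> ennreal (4 / (1 - cos 1)) *
    (\<integral>\<^sup>+u\<in>{0<..}. ennreal ((1 - cos (u * y)) / u\<^sup>2) \<partial>lborel)"
proof (cases "y = 0")
  case False
  define r where "r = \<bar>y\<bar>"
  have r: "r > 0" using False by (simp add: r_def)
  have "ennreal ((1 - cos 1) / 4 * r) = (\<integral>\<^sup>+u\<in>{1/r..2/r}. ennreal ((1 - cos 1) * r\<^sup>2 / 4) \<partial>lborel)"
    using r one_minus_cos_1_pos by (subst nn_integral_cmult_indicator)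
      (auto simp: divide_simps power2_eq_square ennreal_mult'[symmetric])
  also have "\<dots> \<le> (\<integral>\<^sup>+u\<in>{0<..}. ennreal ((1 - cos (u * y)) / u\<^sup>2) \<partial>lborel)"
  proof (intro nn_integral_mono)
    fix u :: real
    show "ennreal ((1 - cos 1) * r\<^sup>2 / 4) * indicator {1/r..2/r} u
        \<le> ennreal ((1 - cos (u * y)) / u\<^sup>2) * indicator {0<..} u"
    proof (cases "u \<in> {1/r..2/r}")
      case True
      then have u: "u > 0" using r by (auto intro: less_le_trans[of 0 "1/r"])
      have ur: "1 \<le> u * r" "u * r \<le> 2" using True r by (auto simp: field_simps)
      have "cos (u * y) = cos (u * r)"
        unfolding r_def by (cases "y \<ge> 0") auto
      also have "\<dots> \<le> cos 1"
        using ur pi_gt3 by (intro cos_monotone_0_pi_le) auto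
      finally have 1: "1 - cos 1 \<le> 1 - cos (u * y)" by simp
      have "(u * r)\<^sup>2 \<le> 2\<^sup>2" using ur by (intro power_mono) auto
      then have 2: "r\<^sup>2 / 4 \<le> 1 / u\<^sup>2" using u by (simp add: field_simps power_mult_distrib)
      have "(1 - cos 1) * (r\<^sup>2 / 4) \<le> (1 - cos (u * y)) * (1 / u\<^sup>2)"
        using 1 2 one_minus_cos_1_pos by (intro mult_mono) auto
      then show ?thesis using True u by (auto intro!: ennreal_leI)
    qed auto
  qed
  finally have "ennreal (4 / (1 - cos 1)) * ennreal ((1 - cos 1) / 4 * r)
      \<le> ennreal (4 / (1 - cos 1)) * (\<integral>\<^sup>+u\<in>{0<..}. ennreal ((1 - cos (u * y)) / u\<^sup>2) \<partial>lborel)"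
    by (rule mult_left_mono) simp
  then show ?thesis using one_minus_cos_1_pos r
    by (simp add: ennreal_mult'[symmetric] r_def)
qed simp

text \<open>Tonelli moves the expectation inside the frequency integral, where the mean of
  \<open>cos (u * Y)\<close> is the real part of the characteristic function. Nonnegative integrals
  allow this before \<open>Y\<close> is known to be integrable.\<close>

lemma (in prob_space) nn_integral_abs_le_char:
  assumes [measurable]: "Y \<in> borel_measurable M"
  shows "(\<integral>\<^sup>+\<omega>. ennreal \<bar>Y \<omega>\<bar> \<partial>M) \<le> ennreal (4 / (1 - cos 1)) *
    (\<integral>\<^sup>+u\<in>{0<..}. ennreal ((1 - Re (char (distr M borel Y) u)) / u\<^sup>2) \<partial>lborel)"
proof -
  interpret pair_sigma_finite M lborel ..
  have Re_char: "(\<integral>\<^sup>+\<omega>. ennreal ((1 - cos (u * Y \<omega>)) / u\<^sup>2) \<partial>M)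
      = ennreal ((1 - Re (char (distr M borel Y) u)) / u\<^sup>2)" for u
  proof -
    have int: "integrable M (\<lambda>\<omega>. iexp (u * Y \<omega>))"
      by (rule integrable_iexp) auto
    have cosint: "integrable M (\<lambda>\<omega>. cos (u * Y \<omega>))"
      using integrable_Re[OF int] by (simp add: Re_exp)
    have "Re (char (distr M borel Y) u) = Re (CLINT \<omega>|M. iexp (u * Y \<omega>))"
      by (simp add: char_def integral_distr)
    also have "\<dots> = (LINT \<omega>|M. Re (iexp (u * Y \<omega>)))"
      using int by (rule integral_Re[symmetric])
    also have "\<dots> = (LINT \<omega>|M. cos (u * Y \<omega>))"
      by (simp add: Re_exp)
    finally have "(LINT \<omega>|M. (1 - cos (u * Y \<omega>)) / u\<^sup>2) = (1 - Re (char (distr M borel Y) u)) / u\<^sup>2"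
      using cosint by (simp add: prob_space)
    then show ?thesis
      using cosint by (subst nn_integral_eq_integral) auto
  qed
  have "(\<integral>\<^sup>+\<omega>. ennreal \<bar>Y \<omega>\<bar> \<partial>M) \<le> (\<integral>\<^sup>+\<omega>. ennreal (4 / (1 - cos 1)) *
      (\<integral>\<^sup>+u\<in>{0<..}. ennreal ((1 - cos (u * Y \<omega>)) / u\<^sup>2) \<partial>lborel) \<partial>M)"
    by (intro nn_integral_mono abs_le_nn_integral_cos)
  also have "\<dots> = ennreal (4 / (1 - cos 1)) * (\<integral>\<^sup>+\<omega>.
      (\<integral>\<^sup>+u\<in>{0<..}. ennreal ((1 - cos (u * Y \<omega>)) / u\<^sup>2) \<partial>lborel) \<partial>M)"
    by (rule nn_integral_cmult) measurable
  also have "(\<integral>\<^sup>+\<omega>. (\<integral>\<^sup>+u\<in>{0<..}. ennreal ((1 - cos (u * Y \<omega>)) / u\<^sup>2) \<partial>lborel) \<partial>M)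
    = (\<integral>\<^sup>+u. (\<integral>\<^sup>+\<omega>. ennreal ((1 - cos (u * Y \<omega>)) / u\<^sup>2) * indicator {0<..} u \<partial>M) \<partial>lborel)"
    by (subst Fubini'[symmetric]) measurable
  also have "\<dots> = (\<integral>\<^sup>+u. (\<integral>\<^sup>+\<omega>. ennreal ((1 - cos (u * Y \<omega>)) / u\<^sup>2) \<partial>M) * indicator {0<..} u \<partial>lborel)"
    by (intro nn_integral_cong nn_integral_multc) measurable
  also have "\<dots> = (\<integral>\<^sup>+u\<in>{0<..}. ennreal ((1 - Re (char (distr M borel Y) u)) / u\<^sup>2) \<partial>lborel)"
    by (simp only: Re_char)
  finally show ?thesis .
qed

text \<open>Below \<open>R\<close> the hypothesis leaves \<open>s * u powr (\<alpha> - 2)\<close>,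
  integrable at 0 because \<open>1 < \<alpha>\<close>; above \<open>R\<close> the trivial bound 2
  leaves \<open>2 / u^2\<close>. Keeping \<open>R\<close> free allows it to be matched to the size
  of \<open>s\<close> later.\<close>

lemma (in prob_space) nn_integral_abs_le_of_char_le:
  fixes \<alpha> s R :: real
  assumes Y: "Y \<in> borel_measurable M" and \<alpha>: "1 < \<alpha>" and s: "0 \<le> s" and R: "0 < R"
    and char: "\<And>u. 0 < u \<Longrightarrow> 1 - Re (char (distr M borel Y) u) \<le> s * u powr \<alpha>"
  shows "(\<integral>\<^sup>+\<omega>. ennreal \<bar>Y \<omega>\<bar> \<partial>M)
    \<le> ennreal (4 / (1 - cos 1) * (s * R powr (\<alpha> - 1) / (\<alpha> - 1) + 2 / R))"
proof -
  interpret D: real_distribution "distr M borel Y"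
    using Y by (intro real_distribution_distr) auto
  have I1: "(\<integral>\<^sup>+u. ennreal (u powr (\<alpha> - 2)) * indicator {0..R} u \<partial>lborel) = ennreal (R powr (\<alpha> - 1) / (\<alpha> - 1))"
    using has_integral_powr_from_0[of "\<alpha> - 2" R] \<alpha> R
    by (intro nn_integral_has_integral_lebesgue') auto
  have I2: "(\<integral>\<^sup>+u. ennreal (1 / u\<^sup>2) * indicator {R..} u \<partial>lborel) = ennreal (1 / R)"
    using has_integral_inverse_power_to_inf[of 2 R] R
    by (intro nn_integral_has_integral_lebesgue') auto
  have "(\<integral>\<^sup>+u\<in>{0<..}. ennreal ((1 - Re (char (distr M borel Y) u)) / u\<^sup>2) \<partial>lborel)
    \<le> (\<integral>\<^sup>+u. ennreal s * (ennreal (u powr (\<alpha> - 2)) * indicator {0..R} u)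
          + 2 * (ennreal (1 / u\<^sup>2) * indicator {R..} u) \<partial>lborel)"
  proof (intro nn_integral_mono)
    fix u :: real
    have "1 - Re (char (distr M borel Y) u) \<le> 2"
      using D.cmod_char_le_1[of u] abs_Re_le_cmod[of "char (distr M borel Y) u"] by linarith
    then have 2: "ennreal ((1 - Re (char (distr M borel Y) u)) / u\<^sup>2) \<le> 2 * ennreal (1 / u\<^sup>2)"
      by (auto simp: ennreal_mult'[symmetric] divide_simps simp flip: ennreal_numeral intro!: ennreal_leI)
    have 1: "ennreal ((1 - Re (char (distr M borel Y) u)) / u\<^sup>2) \<le> ennreal s * ennreal (u powr (\<alpha> - 2))"
      if "u > 0"
    proof -
      have "(1 - Re (char (distr M borel Y) u)) / u\<^sup>2 \<le> s * u powr \<alpha> / u\<^sup>2"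
        using char[OF that] by (intro divide_right_mono) auto
      also have "\<dots> = s * u powr (\<alpha> - 2)"
        using that by (simp add: powr_diff)
      finally show ?thesis using s by (auto simp: ennreal_mult'[symmetric] intro!: ennreal_leI)
    qed
    show "ennreal ((1 - Re (char (distr M borel Y) u)) / u\<^sup>2) * indicator {0<..} u
        \<le> ennreal s * (ennreal (u powr (\<alpha> - 2)) * indicator {0..R} u)
          + 2 * (ennreal (1 / u\<^sup>2) * indicator {R..} u)"
      using 1 2 R by (auto simp: indicator_def intro: add_increasing2)
  qed
  also have "\<dots> = ennreal s * ennreal (R powr (\<alpha> - 1) / (\<alpha> - 1)) + 2 * ennreal (1 / R)"
    by (subst nn_integral_add) (auto simp: nn_integral_cmult I1 I2)
  also have "\<dots> = ennreal (s * R powr (\<alpha> - 1) / (\<alpha> - 1) + 2 / R)"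
    using s R \<alpha> by (auto simp: ennreal_mult'[symmetric] ennreal_plus[symmetric] simp flip: ennreal_numeral simp del: ennreal_plus)
  finally have *: "(\<integral>\<^sup>+u\<in>{0<..}. ennreal ((1 - Re (char (distr M borel Y) u)) / u\<^sup>2) \<partial>lborel)
    \<le> ennreal (s * R powr (\<alpha> - 1) / (\<alpha> - 1) + 2 / R)" .
  have "(\<integral>\<^sup>+\<omega>. ennreal \<bar>Y \<omega>\<bar> \<partial>M) \<le> ennreal (4 / (1 - cos 1)) *
     ennreal (s * R powr (\<alpha> - 1) / (\<alpha> - 1) + 2 / R)"
    by (rule order_trans[OF nn_integral_abs_le_char[OF Y] mult_left_mono[OF *]]) simp
  then show ?thesis using one_minus_cos_1_pos by (simp add: ennreal_mult'[symmetric])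
qed

text \<open>Independence of increments is only available at strictly increasing times, whereas the knots of a
  step function may coincide.\<close>

lemma step_integral_strict_knots:
  fixes p a :: "nat \<Rightarrow> real"
  assumes "mono_on {..n} p"
  shows "\<exists>n' p' a'. strict_mono_on {..n'} p' \<and> p' 0 = p 0 \<and> p' n' = p n \<and>
    (\<forall>(Y :: real \<Rightarrow> 'a \<Rightarrow> real) \<omega>. step_integral n' p' a' Y \<omega> = step_integral n p a Y \<omega>) \<and>
    (\<Sum>i<n'. \<bar>a' i\<bar> powr \<alpha> * (p' (Suc i) - p' i)) = (\<Sum>i<n. \<bar>a i\<bar> powr \<alpha> * (p (Suc i) - p i))"
  using assms
proof (induction n)
  case 0
  show ?case by (rule exI[of _ 0], rule exI[of _ p], rule exI[of _ a]) (auto simp: strict_mono_on_def)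
next
  case (Suc n)
  have "mono_on {..n} p" using Suc.prems by (rule mono_on_subset) auto
  from Suc.IH[OF this] obtain n' p' a' where IH: "strict_mono_on {..n'} p'" "p' 0 = p 0" "p' n' = p n"
    "\<And>(Y :: real \<Rightarrow> 'a \<Rightarrow> real) \<omega>. step_integral n' p' a' Y \<omega> = step_integral n p a Y \<omega>"
    "(\<Sum>i<n'. \<bar>a' i\<bar> powr \<alpha> * (p' (Suc i) - p' i)) = (\<Sum>i<n. \<bar>a i\<bar> powr \<alpha> * (p (Suc i) - p i))"
    by blast
  have le: "p n \<le> p (Suc n)" using Suc.prems by (auto simp: mono_on_def)
  show ?case
  \<comment> \<open>A repeated knot contributes zero to the integral and to the \<alpha>-sum alike,
    so it is simply dropped; otherwise the new knot is appended.\<close>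
  proof (cases "p (Suc n) = p n")
    case True
    show ?thesis using IH True
      by (intro exI[of _ n'] exI[of _ p'] exI[of _ a']) (auto simp: step_integral_def)
  next
    case False
    define P where "P = p'(Suc n' := p (Suc n))"
    define A where "A = a'(n' := a n)"
    have "strict_mono_on {..Suc n'} P"
    proof (rule strict_mono_onI)
      fix r s assume rs: "r \<in> {..Suc n'}" "s \<in> {..Suc n'}" "r < s"
      show "P r < P s"
      proof (cases "s = Suc n'")
        case True
        have "p' r \<le> p' n'" using IH(1) rs True
          by (intro strict_mono_on_leD[OF IH(1)]) auto
        then show ?thesis using True rs le False IH(3) by (auto simp: P_def)
      next
        case False
        then show ?thesis using rs IH(1) by (auto simp: P_def strict_mono_on_def)
      qed
    qed
    moreover have "P 0 = p 0" "P (Suc n') = p (Suc n)" using IH by (auto simp: P_def)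
    moreover have "step_integral (Suc n') P A Y \<omega> = step_integral (Suc n) p a Y \<omega>" 
      for Y :: "real \<Rightarrow> 'a \<Rightarrow> real" and \<omega>
      using IH(4)[of Y \<omega>] IH(3) by (simp add: step_integral_def P_def A_def)
    moreover have "(\<Sum>i<Suc n'. \<bar>A i\<bar> powr \<alpha> * (P (Suc i) - P i)) = (\<Sum>i<Suc n. \<bar>a i\<bar> powr \<alpha> * (p (Suc i) - p i))"
      using IH(5) IH(3) by (simp add: P_def A_def)
    ultimately show ?thesis by blast
  qed
qed

text \<open>Splits damping from rotation:
  \<open>1 - exp a * cos b = (1 - exp a) + exp a * (1 - cos b)\<close>. A linear bound in the
  imaginary part is the right one here, since in a stable exponent the skewness term has the same
  order \<open>\<bar>u\<bar> powr \<alpha>\<close> as the real part.\<close>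

lemma one_minus_Re_exp_le:
  assumes "Re z \<le> 0"
  shows "1 - Re (exp z) \<le> \<bar>Re z\<bar> + \<bar>Im z\<bar>"
proof -
  have 1: "1 - exp (Re z) \<le> \<bar>Re z\<bar>" using exp_ge_add_one_self[of "Re z"] assms by linarith
  have "1 - cos (Im z) \<le> \<bar>Im z\<bar>"
  proof -
    have "1 - cos (Im z) = 2 * (sin (Im z / 2))\<^sup>2"
      using cos_double_sin[of "Im z / 2"] by simp
    also have "\<dots> = 2 * (\<bar>sin (Im z / 2)\<bar> * \<bar>sin (Im z / 2)\<bar>)" by (simp add: power2_eq_square)
    also have "\<dots> \<le> 2 * (\<bar>Im z / 2\<bar> * 1)"
      by (intro mult_left_mono mult_mono abs_sin_x_le_abs_x) auto
    finally show ?thesis by simp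
  qed
  then have 2: "exp (Re z) * (1 - cos (Im z)) \<le> 1 * \<bar>Im z\<bar>"
    using assms by (intro mult_mono) auto
  have "1 - Re (exp z) = (1 - exp (Re z)) + exp (Re z) * (1 - cos (Im z))"
    by (simp add: Re_exp algebra_simps)
  with 1 2 show ?thesis by linarith
qed

section \<open>First moments of step integrals against the stable process\<close>

lemma (in prob_space) char_distr_mult:
  fixes Y :: "'a \<Rightarrow> real"
  assumes [measurable]: "Y \<in> borel_measurable M"
  shows "char (distr M borel (\<lambda>\<omega>. a * Y \<omega>)) u = char (distr M borel Y) (u * a)"
  by (simp add: char_def integral_distr mult.assoc)

text \<open>By independence the characteristic function is the exponential of a sum of stable
  exponents. Each is linear in the length of its time interval, so the sum is governed by the
  \<alpha>-th power of the \<open>L^\<alpha>\<close> norm of the step function; the factor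
  \<open>1 + \<bar>tan (\<alpha> * pi / 2)\<bar>\<close> collects real part and skewness, using
  \<open>\<bar>\<beta>\<bar> \<le> 1\<close>.\<close>

lemma (in prob_space) nn_integral_abs_stable_step_integral_le:
  fixes p a :: "nat \<Rightarrow> real"
  assumes Z: "stable_Levy_process M F \<alpha> \<beta> Z" and \<alpha>: "1 < \<alpha>"
    and p: "mono_on {..n} p" "0 \<le> p 0" and R: "0 < R"
  shows "(\<integral>\<^sup>+\<omega>. ennreal \<bar>step_integral n p a Z \<omega>\<bar> \<partial>M) \<le> ennreal (4 / (1 - cos 1) *
    ((1 + \<bar>tan (\<alpha> * pi / 2)\<bar>) * (\<Sum>i<n. \<bar>a i\<bar> powr \<alpha> * (p (Suc i) - p i)) * R powr (\<alpha> - 1) / (\<alpha> - 1) + 2 / R))"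
proof -
  obtain N P A where P: "strict_mono_on {..N} P" "P 0 = p 0"
    and step_eq: "\<And>Y \<omega>. step_integral N P A (Y :: real \<Rightarrow> 'a \<Rightarrow> real) \<omega> = step_integral n p a Y \<omega>"
    and norm_eq: "(\<Sum>i<N. \<bar>A i\<bar> powr \<alpha> * (P (Suc i) - P i)) = (\<Sum>i<n. \<bar>a i\<bar> powr \<alpha> * (p (Suc i) - p i))"
    using step_integral_strict_knots[OF p(1), where \<alpha> = \<alpha> and a = a and 'a = 'a] by blast
  define s where "s = (\<Sum>i<N. \<bar>A i\<bar> powr \<alpha> * (P (Suc i) - P i))"
  define C where "C = 1 + \<bar>tan (\<alpha> * pi / 2)\<bar>"
  have lt: "P i < P (Suc i)" if "i < N" for i
    using that by (intro strict_mono_onD[OF P(1)]) auto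
  have P0: "0 \<le> P i" if "i \<le> N" for i
  proof -
    have "P 0 \<le> P i" using that by (intro strict_mono_on_leD[OF P(1)]) auto
    then show ?thesis using P(2) p(2) by simp
  qed
  define \<Delta> where "\<Delta> i \<omega> = Z (P (Suc i)) \<omega> - Z (P i) \<omega>" for i \<omega>
  have law: "has_stable_law M \<alpha> ((P (Suc i) - P i) powr (1 / \<alpha>)) \<beta> 0 (\<Delta> i)" if "i < N" for i
    using Z lt[OF that] P0[of i] that unfolding stable_Levy_process_def \<Delta>_def by auto
  have \<Delta>_meas: "\<Delta> i \<in> borel_measurable M" if "i < N" for i
    using law[OF that] by (simp add: has_stable_law_def)
  have ind: "indep_vars (\<lambda>_. borel) \<Delta> {..<N}"
    using Z P P0[of 0] unfolding stable_Levy_process_def independent_increments_def \<Delta>_def by auto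
  have s: "0 \<le> s" unfolding s_def using lt by (intro sum_nonneg mult_nonneg_nonneg) (auto intro: less_imp_le)
  have step: "step_integral n p a Z = (\<lambda>\<omega>. \<Sum>i<N. A i * \<Delta> i \<omega>)"
    unfolding step_eq[symmetric] by (auto simp: step_integral_def \<Delta>_def)
  have "(\<integral>\<^sup>+\<omega>. ennreal \<bar>step_integral n p a Z \<omega>\<bar> \<partial>M)
    \<le> ennreal (4 / (1 - cos 1) * ((C * s) * R powr (\<alpha> - 1) / (\<alpha> - 1) + 2 / R))"
  proof (rule nn_integral_abs_le_of_char_le)
    show "step_integral n p a Z \<in> borel_measurable M" unfolding step using \<Delta>_meas by measurable
    show "0 \<le> C * s" using s by (simp add: C_def)
    fix u :: real assume u: "0 < u"
    \<comment> \<open>The stable exponent of the increment at frequency \<open>u * A i\<close>;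
      raising the scale to the power \<alpha> turns it back into the interval length.\<close>
    define z where "z i = - complex_of_real ((P (Suc i) - P i) * \<bar>u * A i\<bar> powr \<alpha>)
               * (1 - \<i> * complex_of_real (\<beta> * sgn (u * A i) * tan (\<alpha> * pi / 2)))" for i
    have "char (distr M borel (step_integral n p a Z)) u = (\<Prod>i<N. char (distr M borel (\<lambda>\<omega>. A i * \<Delta> i \<omega>)) u)"
      unfolding step
      by (intro char_distr_sum indep_vars_compose2[OF ind, of "\<lambda>i x. A i * x"]) auto
    also have "\<dots> = (\<Prod>i<N. exp (z i))"
    proof (intro prod.cong refl)
      fix i assume "i \<in> {..<N}"
      then have i: "i < N" by simp
      have "((P (Suc i) - P i) powr (1 / \<alpha>)) powr \<alpha> = P (Suc i) - P i"
        using lt[OF i] \<alpha> by (simp add: powr_powr)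
      then show "char (distr M borel (\<lambda>\<omega>. A i * \<Delta> i \<omega>)) u = exp (z i)"
        using law[OF i] unfolding char_distr_mult[OF \<Delta>_meas[OF i]] has_stable_law_def z_def by simp
    qed
    also have "\<dots> = exp (\<Sum>i<N. z i)" by (simp add: exp_sum)
    finally have ch: "char (distr M borel (step_integral n p a Z)) u = exp (\<Sum>i<N. z i)" .
    have Re_z: "Re (z i) = - ((P (Suc i) - P i) * \<bar>u * A i\<bar> powr \<alpha>)" for i
      by (simp add: z_def)
    have Im_z: "\<bar>Im (z i)\<bar> \<le> (P (Suc i) - P i) * \<bar>u * A i\<bar> powr \<alpha> * \<bar>tan (\<alpha> * pi / 2)\<bar>" if "i < N" for i
    proof -
      have "\<bar>\<beta>\<bar> \<le> 1" using law[OF that] by (auto simp: has_stable_law_def)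
      then have "\<bar>\<beta> * sgn (u * A i)\<bar> \<le> 1"
        unfolding abs_mult by (intro mult_le_one) (auto simp: sgn_if)
      then have "\<bar>\<beta> * sgn (u * A i)\<bar> * \<bar>tan (\<alpha> * pi / 2)\<bar> \<le> 1 * \<bar>tan (\<alpha> * pi / 2)\<bar>"
        by (intro mult_right_mono) auto
      then have "((P (Suc i) - P i) * \<bar>u * A i\<bar> powr \<alpha>) * (\<bar>\<beta> * sgn (u * A i)\<bar> * \<bar>tan (\<alpha> * pi / 2)\<bar>)
        \<le> ((P (Suc i) - P i) * \<bar>u * A i\<bar> powr \<alpha>) * \<bar>tan (\<alpha> * pi / 2)\<bar>"
        using lt[OF that] by (intro mult_left_mono) auto
      then show ?thesis using lt[OF that] by (simp add: z_def abs_mult mult_ac)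
    qed
    have "1 - Re (exp (\<Sum>i<N. z i)) \<le> \<bar>Re (\<Sum>i<N. z i)\<bar> + \<bar>Im (\<Sum>i<N. z i)\<bar>"
    proof (rule one_minus_Re_exp_le)
      show "Re (\<Sum>i<N. z i) \<le> 0"
        unfolding Re_sum Re_z using lt by (intro sum_nonpos) (simp add: less_imp_le)
    qed
    also have "\<dots> \<le> (\<Sum>i<N. \<bar>Re (z i)\<bar>) + (\<Sum>i<N. \<bar>Im (z i)\<bar>)"
      by (auto intro!: add_mono)
    also have "\<dots> \<le> (\<Sum>i<N. (P (Suc i) - P i) * \<bar>u * A i\<bar> powr \<alpha>) +
        (\<Sum>i<N. (P (Suc i) - P i) * \<bar>u * A i\<bar> powr \<alpha> * \<bar>tan (\<alpha> * pi / 2)\<bar>)"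
      using Im_z lt by (intro add_mono sum_mono) (auto simp: Re_z abs_mult less_imp_le)
    also have "\<dots> = (\<Sum>i<N. C * (\<bar>A i\<bar> powr \<alpha> * (P (Suc i) - P i)) * u powr \<alpha>)"
      unfolding sum.distrib[symmetric] using u
      by (intro sum.cong refl) (simp add: C_def abs_mult powr_mult algebra_simps)
    also have "\<dots> = C * s * u powr \<alpha>"
      by (simp add: s_def sum_distrib_left sum_distrib_right)
    finally show "1 - Re (char (distr M borel (step_integral n p a Z)) u) \<le> C * s * u powr \<alpha>"
      by (simp add: ch)
  qed (use \<alpha> R in auto)
  then show ?thesis by (simp add: C_def s_def norm_eq)
qed

section \<open>Cadlag paths\<close>

text \<open>A grid point of \<open>[0,T]\<close> to the right of \<open>s\<close>: sampling a right-continuous process there gives jointly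
  measurable approximations.\<close>

definition right_knot :: "real \<Rightarrow> nat \<Rightarrow> real \<Rightarrow> real" where
  "right_knot T m s = max 0 (min T ((of_int \<lfloor>real (Suc m) * s\<rfloor> + 1) / real (Suc m)))"

lemma right_knot_mem: "0 \<le> T \<Longrightarrow> right_knot T m s \<in> {0..T}"
  by (auto simp: right_knot_def)

text \<open>For \<open>s < T\<close> the knots lie strictly to the right of \<open>s\<close> and
  tend to \<open>s\<close>, so right-continuity applies. At \<open>s = T\<close> nothing lies to the
  right, and the clamp by \<open>min T\<close> makes every knot equal to \<open>T\<close>.\<close>

lemma cadlag_on_right_knot_tendsto:
  assumes f: "cadlag_on {0..T} f" and s: "s \<in> {0..T}"
  shows "(\<lambda>m. f (right_knot T m s)) \<longlonglongrightarrow> f s"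
proof -
  have gt: "s < (of_int \<lfloor>real (Suc m) * s\<rfloor> + 1) / real (Suc m)" for m
  proof -
    have "real (Suc m) * s < of_int \<lfloor>real (Suc m) * s\<rfloor> + 1" by linarith
    then show ?thesis by (simp add: field_simps)
  qed
  have le: "(of_int \<lfloor>real (Suc m) * s\<rfloor> + 1) / real (Suc m) \<le> s + 1 / real (Suc m)" for m
  proof -
    have "of_int \<lfloor>real (Suc m) * s\<rfloor> + 1 \<le> real (Suc m) * s + 1" by linarith
    then have "(of_int \<lfloor>real (Suc m) * s\<rfloor> + 1) / real (Suc m) \<le> (real (Suc m) * s + 1) / real (Suc m)"
      by (intro divide_right_mono) auto
    also have "\<dots> = s + 1 / real (Suc m)" by (simp add: add_divide_distrib del: of_nat_Suc)
    finally show ?thesis .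
  qed
  show ?thesis
  proof (cases "s = T")
    case True
    have "right_knot T m s = s" for m using gt[of m] s True by (simp add: right_knot_def)
    then show ?thesis by simp
  next
    case False
    then have sT: "s < T" using s by simp
    have knot_gt: "s < right_knot T m s" for m using gt[of m] sT by (simp add: right_knot_def)
    have lim: "(\<lambda>m. right_knot T m s) \<longlonglongrightarrow> s"
    proof (rule tendsto_sandwich)
      show "\<forall>\<^sub>F m in sequentially. s \<le> right_knot T m s"
        by (intro always_eventually allI less_imp_le knot_gt)
      show "\<forall>\<^sub>F m in sequentially. right_knot T m s \<le> s + 1 / real (Suc m)"
        using le s by (intro always_eventually allI)
          (auto simp: right_knot_def min_le_iff_disj simp del: of_nat_Suc)
      show "(\<lambda>m. s + 1 / real (Suc m)) \<longlonglongrightarrow> s"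
        using tendsto_add[OF tendsto_const LIMSEQ_inverse_real_of_nat, of s]
        by (simp add: inverse_eq_divide)
    qed simp
    have "filterlim (\<lambda>m. right_knot T m s) (at s within ({0..T} \<inter> {s<..})) sequentially"
      unfolding filterlim_at using lim knot_gt right_knot_mem[of T] s
      by (auto intro!: always_eventually simp: less_imp_neq[symmetric] dest: less_imp_neq)
    moreover have "(f \<longlongrightarrow> f s) (at s within ({0..T} \<inter> {s<..}))"
      using f s by (auto simp: cadlag_on_def)
    ultimately show ?thesis by (rule filterlim_compose[rotated])
  qed
qed

lemma cadlag_on_subset:
  assumes "cadlag_on S f" "R \<subseteq> S"
  shows "cadlag_on R f"
  unfolding cadlag_on_def
proof (intro ballI conjI)
  fix t assume t: "t \<in> R"
  have 1: "(f \<longlongrightarrow> f t) (at t within (S \<inter> {t<..}))" using assms t by (auto simp: cadlag_on_def)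
  show "(f \<longlongrightarrow> f t) (at t within (R \<inter> {t<..}))"
    by (rule tendsto_within_subset[OF 1]) (use assms in auto)
  obtain l where 2: "(f \<longlongrightarrow> l) (at t within (S \<inter> {..<t}))" using assms t by (auto simp: cadlag_on_def)
  have "(f \<longlongrightarrow> l) (at t within (R \<inter> {..<t}))"
    by (rule tendsto_within_subset[OF 2]) (use assms in auto)
  then show "\<exists>l. (f \<longlongrightarrow> l) (at t within (R \<inter> {..<t}))" ..
qed

text \<open>Sampling at right knots gives functions that depend on \<open>s\<close> only through an
  integer, hence measurable ones, and the path is their pointwise limit. The indicator is there
  because nothing is known about \<open>f\<close> off \<open>[0,T]\<close>.\<close>

lemma cadlag_on_measurable:
  assumes f: "cadlag_on {0..T} f"
  shows "(\<lambda>s. indicator {0..T} s * f s) \<in> borel_measurable borel"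
proof (rule borel_measurable_LIMSEQ_real)
  fix s :: real
  show "(\<lambda>m. indicator {0..T} s * f (right_knot T m s)) \<longlonglongrightarrow> indicator {0..T} s * f s"
    using cadlag_on_right_knot_tendsto[OF f, of s] by (cases "s \<in> {0..T}") auto
next
  fix m
  have [measurable]: "(\<lambda>s. f (right_knot T m s)) \<in> borel_measurable borel"
    unfolding right_knot_def
    by (rule measurable_compose_countable[of "\<lambda>i _. f (max 0 (min T ((of_int i + 1) / real (Suc m))))"]) auto
  show "(\<lambda>s. indicator {0..T} s * f (right_knot T m s)) \<in> borel_measurable borel"
    by measurable
qed

text \<open>Around each point the left limit bounds \<open>f\<close> on the left and the value
  bounds it on the right; Bolzano's bisection glues these local bounds. Intersecting with
  \<open>[0,T]\<close> is needed since the local intervals may stick out of it.\<close>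

lemma cadlag_on_bounded:
  assumes f: "cadlag_on {0..T} f"
  shows "\<exists>K. \<forall>s\<in>{0..T}. \<bar>f s\<bar> \<le> K"
proof (cases "0 \<le> T")
  case True
  have "\<exists>K. \<forall>s\<in>{0..T} \<inter> {0..T}. \<bar>f s\<bar> \<le> K"
    using True
  proof (induction rule: Bolzano[where P = "\<lambda>a b. \<exists>K. \<forall>s\<in>{a..b} \<inter> {0..T}. \<bar>f s\<bar> \<le> K"])
    case (trans a b c)
    then obtain K1 K2 where "\<forall>s\<in>{a..b} \<inter> {0..T}. \<bar>f s\<bar> \<le> K1" "\<forall>s\<in>{b..c} \<inter> {0..T}. \<bar>f s\<bar> \<le> K2" by blast
    then have "\<forall>s\<in>{a..c} \<inter> {0..T}. \<bar>f s\<bar> \<le> max K1 K2"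
      by (metis IntE IntI atLeastAtMost_iff le_cases max.coboundedI1 max.coboundedI2)
    then show ?case by blast
  next
    case (local x)
    then have x: "x \<in> {0..T}" by simp
    obtain l where l: "(f \<longlongrightarrow> l) (at x within ({0..T} \<inter> {..<x}))"
      and r: "(f \<longlongrightarrow> f x) (at x within ({0..T} \<inter> {x<..}))"
      using f x unfolding cadlag_on_def by blast
    obtain d1 where d1: "d1 > 0" "\<And>s. s \<in> {0..T} \<inter> {..<x} \<Longrightarrow> s \<noteq> x \<Longrightarrow> dist s x < d1 \<Longrightarrow> dist (f s) l < 1"
      using tendstoD[OF l, of 1] unfolding eventually_at by auto
    obtain d2 where d2: "d2 > 0" "\<And>s. s \<in> {0..T} \<inter> {x<..} \<Longrightarrow> s \<noteq> x \<Longrightarrow> dist s x < d2 \<Longrightarrow> dist (f s) (f x) < 1"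
      using tendstoD[OF r, of 1] unfolding eventually_at by auto
    have "\<bar>f s\<bar> \<le> \<bar>l\<bar> + \<bar>f x\<bar> + 1" if "a \<le> x" "x \<le> b" "b - a < min d1 d2" "s \<in> {a..b} \<inter> {0..T}" for a b s
      using d1(2)[of s] d2(2)[of s] that by (cases s x rule: linorder_cases) (auto simp: dist_real_def)
    then have "\<forall>a b. a \<le> x \<and> x \<le> b \<and> b - a < min d1 d2 \<longrightarrow> (\<exists>K. \<forall>s\<in>{a..b} \<inter> {0..T}. \<bar>f s\<bar> \<le> K)"
      by blast
    moreover have "min d1 d2 > 0" using d1 d2 by simp
    ultimately show ?case by blast
  qed
  then show ?thesis by simp
qed auto

text \<open>Adaptedness gives measurability only at fixed times, while Tonelli needs a jointly
  measurable integrand. The lower limit along right knots is one, it agrees with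
  \<open>\<bar>Y\<bar>\<close> on almost every path, and by Fatou it inherits the moment bound, even
  for \<open>s\<close> outside \<open>[0,T]\<close> because the knots are clamped.\<close>

lemma (in prob_space) jointly_measurable_cadlag_abs:
  fixes Y :: "real \<Rightarrow> 'a \<Rightarrow> real"
  assumes T: "0 \<le> T" and Y: "\<And>t. t \<in> {0..T} \<Longrightarrow> Y t \<in> borel_measurable M"
    and cadlag: "AE \<omega> in M. cadlag_on {0..T} (\<lambda>t. Y t \<omega>)"
    and K: "\<And>t. t \<in> {0..T} \<Longrightarrow> (\<integral>\<^sup>+\<omega>. ennreal \<bar>Y t \<omega>\<bar> \<partial>M) \<le> K"
  obtains V :: "real \<times> 'a \<Rightarrow> ennreal" where
    "V \<in> borel_measurable (borel \<Otimes>\<^sub>M M)"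
    "AE \<omega> in M. \<forall>s\<in>{0..T}. V (s, \<omega>) = ennreal \<bar>Y s \<omega>\<bar>"
    "\<And>s. (\<integral>\<^sup>+\<omega>. V (s, \<omega>) \<partial>M) \<le> K"
proof
  let ?V = "\<lambda>x. liminf (\<lambda>m. ennreal \<bar>Y (right_knot T m (fst x)) (snd x)\<bar>)"
  \<comment> \<open>For a fixed value of the floor the sampling time is constant, so measurability
    of \<open>Y\<close> at fixed times suffices; countably many such pieces are glued.\<close>
  have [measurable]: "(\<lambda>x. Y (right_knot T m (fst x)) (snd x)) \<in> borel_measurable (borel \<Otimes>\<^sub>M M)" for m
    unfolding right_knot_def
  proof (rule measurable_compose_countable[of "\<lambda>i x. Y (max 0 (min T ((of_int i + 1) / real (Suc m)))) (snd x)"])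
    fix i :: int
    have [measurable]: "Y (max 0 (min T ((of_int i + 1) / real (Suc m)))) \<in> borel_measurable M"
      using T by (intro Y) auto
    show "(\<lambda>x. Y (max 0 (min T ((of_int i + 1) / real (Suc m)))) (snd x)) \<in> borel_measurable (borel \<Otimes>\<^sub>M M)"
      by measurable
  qed measurable
  show "?V \<in> borel_measurable (borel \<Otimes>\<^sub>M M)" by measurable
  show "AE \<omega> in M. \<forall>s\<in>{0..T}. ?V (s, \<omega>) = ennreal \<bar>Y s \<omega>\<bar>"
    using cadlag
  proof eventually_elim
    case (elim \<omega>)
    show ?case
    proof
      fix s assume "s \<in> {0..T}"
      from cadlag_on_right_knot_tendsto[OF elim this]
      have "(\<lambda>m. ennreal \<bar>Y (right_knot T m s) \<omega>\<bar>) \<longlonglongrightarrow> ennreal \<bar>Y s \<omega>\<bar>"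
        by (intro tendsto_intros)
      then show "?V (s, \<omega>) = ennreal \<bar>Y s \<omega>\<bar>"
        by (simp add: lim_imp_Liminf)
    qed
  qed
  fix s
  have "(\<integral>\<^sup>+\<omega>. ?V (s, \<omega>) \<partial>M) \<le> liminf (\<lambda>m. \<integral>\<^sup>+\<omega>. ennreal \<bar>Y (right_knot T m s) \<omega>\<bar> \<partial>M)"
    using Y[OF right_knot_mem[OF T]] by (simp, intro nn_integral_liminf) measurable
  also have "\<dots> \<le> limsup (\<lambda>m. \<integral>\<^sup>+\<omega>. ennreal \<bar>Y (right_knot T m s) \<omega>\<bar> \<partial>M)"
    by (rule Liminf_le_Limsup) simp
  also have "\<dots> \<le> K"
    using K[OF right_knot_mem[OF T]] by (intro Limsup_bounded always_eventually) auto
  finally show "(\<integral>\<^sup>+\<omega>. ?V (s, \<omega>) \<partial>M) \<le> K" .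
qed

text \<open>After truncation at \<open>N\<close>, the event where \<open>S m\<close> and
  \<open>J\<close> differ by more than \<delta> costs at most \<open>N\<close> times its vanishing
  probability, and off it the triangle inequality costs \<delta>. Letting \<open>m\<close>, then
  \<delta>, then \<open>N\<close> go to their limits gives the claim, the last step by
  Fatou.\<close>

lemma (in prob_space) nn_integral_abs_le_of_tendsto_in_prob:
  fixes S :: "nat \<Rightarrow> 'a \<Rightarrow> real" and J :: "'a \<Rightarrow> real"
  assumes [measurable]: "\<And>m. S m \<in> borel_measurable M" "J \<in> borel_measurable M"
    and lim: "\<And>\<delta>. \<delta> > 0 \<Longrightarrow> (\<lambda>m. prob {\<omega> \<in> space M. \<bar>S m \<omega> - J \<omega>\<bar> > \<delta>}) \<longlonglongrightarrow> 0"
    and K: "\<forall>\<^sub>F m in sequentially. (\<integral>\<^sup>+\<omega>. ennreal \<bar>S m \<omega> - c\<bar> \<partial>M) \<le> ennreal K"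
  shows "(\<integral>\<^sup>+\<omega>. ennreal \<bar>J \<omega> - c\<bar> \<partial>M) \<le> ennreal K"
proof -
  have trunc: "(\<integral>\<^sup>+\<omega>. ennreal (min \<bar>J \<omega> - c\<bar> (real N)) \<partial>M) \<le> ennreal K" for N :: nat
  proof (rule ennreal_le_epsilon)
    fix \<delta> :: real assume "0 < \<delta>"
    let ?bad = "\<lambda>m. {\<omega> \<in> space M. \<bar>S m \<omega> - J \<omega>\<bar> > \<delta>}"
    have "\<forall>\<^sub>F m in sequentially. (\<integral>\<^sup>+\<omega>. ennreal (min \<bar>J \<omega> - c\<bar> (real N)) \<partial>M)
        \<le> ennreal K + ennreal \<delta> + ennreal (real N * prob (?bad m))"
      using K
    proof eventually_elim
      case (elim m)
      have "(\<integral>\<^sup>+\<omega>. ennreal (min \<bar>J \<omega> - c\<bar> (real N)) \<partial>M)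
          \<le> (\<integral>\<^sup>+\<omega>. ennreal \<bar>S m \<omega> - c\<bar> + ennreal \<delta> + ennreal (real N) * indicator (?bad m) \<omega> \<partial>M)"
      proof (intro nn_integral_mono)
        fix \<omega> assume "\<omega> \<in> space M"
        then have "min \<bar>J \<omega> - c\<bar> (real N) \<le> \<bar>S m \<omega> - c\<bar> + \<delta> + real N * indicator (?bad m) \<omega>"
          using \<open>0 < \<delta>\<close> by (auto simp: indicator_def)
        then have "ennreal (min \<bar>J \<omega> - c\<bar> (real N)) \<le> ennreal (\<bar>S m \<omega> - c\<bar> + \<delta> + real N * indicator (?bad m) \<omega>)"
          by (rule ennreal_leI)
        then show "ennreal (min \<bar>J \<omega> - c\<bar> (real N))
            \<le> ennreal \<bar>S m \<omega> - c\<bar> + ennreal \<delta> + ennreal (real N) * indicator (?bad m) \<omega>"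
          using \<open>0 < \<delta>\<close> by (simp add: ennreal_plus ennreal_mult ennreal_indicator)
      qed
      also have "\<dots> = (\<integral>\<^sup>+\<omega>. ennreal \<bar>S m \<omega> - c\<bar> \<partial>M) + ennreal \<delta> + ennreal (real N) * emeasure M (?bad m)"
        by (subst nn_integral_add, measurable)+ (simp add: nn_integral_cmult emeasure_space_1)
      also have "\<dots> \<le> ennreal K + ennreal \<delta> + ennreal (real N * prob (?bad m))"
        using elim by (intro add_mono) (auto simp: ennreal_mult emeasure_eq_measure)
      finally show ?case .
    qed
    moreover have "(\<lambda>m. ennreal K + ennreal \<delta> + ennreal (real N * prob (?bad m)))
        \<longlonglongrightarrow> ennreal K + ennreal \<delta> + ennreal (real N * 0)"
      using \<open>0 < \<delta>\<close> by (intro tendsto_intros lim)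
    ultimately show "(\<integral>\<^sup>+\<omega>. ennreal (min \<bar>J \<omega> - c\<bar> (real N)) \<partial>M) \<le> ennreal K + ennreal \<delta>"
      by (intro tendsto_lowerbound[where F = sequentially]) auto
  qed
  have "(\<integral>\<^sup>+\<omega>. ennreal \<bar>J \<omega> - c\<bar> \<partial>M) = (\<integral>\<^sup>+\<omega>. liminf (\<lambda>N. ennreal (min \<bar>J \<omega> - c\<bar> (real N))) \<partial>M)"
  proof (intro nn_integral_cong)
    fix \<omega>
    obtain N :: nat where "\<bar>J \<omega> - c\<bar> \<le> real N" using real_arch_simple by blast
    then have "\<forall>\<^sub>F m in sequentially. ennreal (min \<bar>J \<omega> - c\<bar> (real m)) = ennreal \<bar>J \<omega> - c\<bar>"
      by (intro eventually_sequentiallyI[of N]) (auto simp: min_def)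
    then show "ennreal \<bar>J \<omega> - c\<bar> = liminf (\<lambda>N. ennreal (min \<bar>J \<omega> - c\<bar> (real N)))"
      by (intro lim_imp_Liminf[symmetric] tendsto_eventually) auto
  qed
  also have "\<dots> \<le> liminf (\<lambda>N. \<integral>\<^sup>+\<omega>. ennreal (min \<bar>J \<omega> - c\<bar> (real N)) \<partial>M)"
    by (rule nn_integral_liminf) measurable
  also have "\<dots> \<le> limsup (\<lambda>N. \<integral>\<^sup>+\<omega>. ennreal (min \<bar>J \<omega> - c\<bar> (real N)) \<partial>M)"
    by (rule Liminf_le_Limsup) simp
  also have "\<dots> \<le> ennreal K"
    using trunc by (intro Limsup_bounded always_eventually) auto
  finally show ?thesis .
qed

section \<open>The linear equation along a path\<close>

lemma set_integrable_bounded_Icc: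
  fixes f :: "real \<Rightarrow> real"
  assumes "(\<lambda>s. indicator {a..b} s * f s) \<in> borel_measurable borel"
    and "\<And>s. s \<in> {a..b} \<Longrightarrow> \<bar>f s\<bar> \<le> K"
  shows "set_integrable lborel {a..b} f"
  unfolding set_integrable_def
proof (rule Bochner_Integration.integrable_bound[where f = "\<lambda>s. indicator {a..b} s *\<^sub>R K"])
  show "integrable lborel (\<lambda>s. indicator {a..b} s *\<^sub>R K)"
    by (intro integrable_scaleR_left integrable_real_indicator) (auto simp: emeasure_lborel_Icc_eq)
  show "AE s in lborel. norm (indicator {a..b} s *\<^sub>R f s) \<le> norm (indicator {a..b} s *\<^sub>R K)"
    using assms(2) by (intro always_eventually) (fastforce simp: indicator_def)
qed (use assms(1) in simp)

text \<open>The function \<open>H\<close> has derivative \<open>exp (- L * t)\<close> times the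
  defect of the hypothesis, hence decreases. It involves \<open>m\<close> only through its integral,
  so continuity of \<open>m\<close> is enough.\<close>

lemma gronwall:
  fixes m :: "real \<Rightarrow> real"
  assumes L: "0 < L" and T: "0 \<le> T" and m: "continuous_on {0..T} m"
    and le: "\<And>t. t \<in> {0..T} \<Longrightarrow> m t \<le> \<zeta> + L * integral {0..t} m"
  shows "m T \<le> \<zeta> * exp (L * T)"
proof -
  define H where "H t = exp (- L * t) * (integral {0..t} m + \<zeta> / L)" for t
  have "H T \<le> H 0"
  proof (rule DERIV_nonpos_imp_decreasing_open[OF T])
    fix t assume t: "0 < t" "t < T"
    have "((\<lambda>t. integral {0..t} m) has_real_derivative m t) (at t within {0..T})"
      using m t by (intro integral_has_real_derivative) auto
    then have d: "((\<lambda>t. integral {0..t} m) has_real_derivative m t) (at t)"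
      using t by (simp add: at_within_interior[of t "{0..T}"])
    have "(H has_real_derivative exp (- L * t) * m t + (- L * exp (- L * t)) * (integral {0..t} m + \<zeta> / L)) (at t)"
      unfolding H_def by (auto intro!: derivative_eq_intros d)
    moreover have "exp (- L * t) * m t + (- L * exp (- L * t)) * (integral {0..t} m + \<zeta> / L)
        = exp (- L * t) * (m t - (\<zeta> + L * integral {0..t} m))"
      using L by (simp add: field_simps)
    moreover have "\<dots> \<le> 0" using le[of t] t by (intro mult_nonneg_nonpos) auto
    ultimately show "\<exists>y. (H has_real_derivative y) (at t) \<and> y \<le> 0" by auto
  next
    show "continuous_on {0..T} H" unfolding H_def
      using m by (intro continuous_intros indefinite_integral_continuous_1 integrable_continuous_real)
  qed
  then have "exp (- L * T) * (integral {0..T} m + \<zeta> / L) \<le> \<zeta> / L" by (simp add: H_def)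
  then have "exp (L * T) * (exp (- L * T) * (integral {0..T} m + \<zeta> / L)) \<le> exp (L * T) * (\<zeta> / L)"
    by (intro mult_left_mono) auto
  then have "integral {0..T} m + \<zeta> / L \<le> exp (L * T) * (\<zeta> / L)"
    by (simp add: mult.assoc[symmetric] exp_add[symmetric])
  then have "L * (integral {0..T} m + \<zeta> / L) \<le> L * (exp (L * T) * (\<zeta> / L))"
    using L by (intro mult_left_mono) auto
  moreover have "L * (integral {0..T} m + \<zeta> / L) = \<zeta> + L * integral {0..T} m"
    "L * (exp (L * T) * (\<zeta> / L)) = \<zeta> * exp (L * T)"
    using L by (simp_all add: field_simps)
  ultimately have "\<zeta> + L * integral {0..T} m \<le> \<zeta> * exp (L * T)" by simp
  with le[of T] T show ?thesis by simp
qed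

text \<open>\<open>v\<close> jumps together with \<open>z\<close>, and a Gronwall bound on
  \<open>v\<close> itself would bring in the supremum of \<open>\<bar>z\<bar>\<close>. The running
  integral \<open>m\<close> of \<open>\<bar>v\<bar>\<close> is continuous, and integrating
  \<open>\<bar>v\<bar> \<le> L * m + \<epsilon> * \<bar>z\<bar>\<close> once more leaves only the
  integral of \<open>\<bar>z\<bar>\<close> in the bound for \<open>m\<close>.\<close>

lemma abs_le_of_linear_Volterra:
  fixes v z \<theta> :: "real \<Rightarrow> real"
  assumes L: "0 < L" and \<epsilon>: "0 \<le> \<epsilon>" and t: "t \<in> {0..T}"
    and \<theta>: "\<And>s. s \<in> {0..T} \<Longrightarrow> \<bar>\<theta> s\<bar> \<le> L"
    and v_int: "set_integrable lborel {0..T} v" and z_int: "set_integrable lborel {0..T} z"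
    and \<theta>v_int: "set_integrable lborel {0..T} (\<lambda>s. \<theta> s * v s)"
    and eq: "\<And>t. t \<in> {0..T} \<Longrightarrow> v t = (LINT s:{0..t}|lborel. \<theta> s * v s) + \<epsilon> * z t"
  shows "\<bar>v t\<bar> \<le> \<epsilon> * \<bar>z t\<bar> + L * exp (L * T) * \<epsilon> * (LINT s:{0..T}|lborel. \<bar>z s\<bar>)"
proof -
  define m where "m t = (LINT s:{0..t}|lborel. \<bar>v s\<bar>)" for t
  define \<zeta> where "\<zeta> = \<epsilon> * (LINT s:{0..T}|lborel. \<bar>z s\<bar>)"
  have T: "0 \<le> T" using t by simp
  have sub: "set_integrable lborel {0..t} f" if "set_integrable lborel {0..T} f" "t \<in> {0..T}"
    for f :: "real \<Rightarrow> real" and t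
    using that by (intro set_integrable_subset[OF that(1)]) auto
  have mono: "(LINT s:{0..t}|lborel. f s) \<le> (LINT s:{0..T}|lborel. f s)"
    if "set_integrable lborel {0..T} f" "t \<in> {0..T}" "\<And>s. 0 \<le> f s" for f :: "real \<Rightarrow> real" and t
    using sub[OF that(1,2)] that unfolding set_lebesgue_integral_def set_integrable_def
    by (intro integral_mono) (auto simp: indicator_def)
  note v_abs = set_integrable_abs[OF v_int] and z_abs = set_integrable_abs[OF z_int]
  note v_sub = sub[OF v_abs] and z_sub = sub[OF z_abs]
  have m_HK: "m t = integral {0..t} (\<lambda>s. \<bar>v s\<bar>)" if "t \<in> {0..T}" for t
    unfolding m_def by (intro set_borel_integral_eq_integral v_sub that)
  have cont: "continuous_on {0..T} m"
  proof -
    have "continuous_on {0..T} (\<lambda>t. integral {0..t} (\<lambda>s. \<bar>v s\<bar>))"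
      by (intro indefinite_integral_continuous_1 set_borel_integral_eq_integral v_abs)
    then show ?thesis by (subst continuous_on_cong[OF refl m_HK])
  qed
  have v_le: "\<bar>v t\<bar> \<le> L * m t + \<epsilon> * \<bar>z t\<bar>" if t: "t \<in> {0..T}" for t
  proof -
    have "\<bar>LINT s:{0..t}|lborel. \<theta> s * v s\<bar> \<le> (LINT s:{0..t}|lborel. \<bar>\<theta> s * v s\<bar>)"
      using set_integral_norm_bound[OF sub[OF \<theta>v_int t]] by simp
    also have "\<dots> \<le> (LINT s:{0..t}|lborel. L * \<bar>v s\<bar>)"
      using t \<theta> by (intro set_integral_mono sub[OF set_integrable_abs[OF \<theta>v_int]]
          set_integrable_mult_right v_sub) (auto simp: abs_mult intro!: mult_right_mono)
    also have "\<dots> = L * m t" by (simp add: m_def)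
    finally show ?thesis 
      using eq[OF t] \<epsilon> abs_triangle_ineq[of "LINT s:{0..t}|lborel. \<theta> s * v s" "\<epsilon> * z t"] by (simp add: abs_mult)
  qed
  have m_int: "set_integrable lborel {0..t} m" if "t \<in> {0..T}" for t
    using cont that by (intro borel_integrable_atLeastAtMost' continuous_on_subset[OF cont]) auto
  have "m T \<le> \<zeta> * exp (L * T)"
  proof (rule gronwall[OF L T cont])
    fix t assume t: "t \<in> {0..T}"
    have "m t \<le> (LINT s:{0..t}|lborel. L * m s + \<epsilon> * \<bar>z s\<bar>)"
      unfolding m_def[of t] using t v_le
      by (intro set_integral_mono v_sub set_integral_add(1) set_integrable_mult_right z_sub m_int) auto
    also have "\<dots> = L * (LINT s:{0..t}|lborel. m s) + \<epsilon> * (LINT s:{0..t}|lborel. \<bar>z s\<bar>)"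
      using t by (subst set_integral_add(2)) (auto intro!: set_integrable_mult_right z_sub m_int)
    also have "\<dots> \<le> L * (LINT s:{0..t}|lborel. m s) + \<zeta>"
      unfolding \<zeta>_def using \<epsilon> t by (intro add_left_mono mult_left_mono mono[OF z_abs]) auto
    also have "(LINT s:{0..t}|lborel. m s) = integral {0..t} m"
      by (intro set_borel_integral_eq_integral m_int t)
    finally show "m t \<le> \<zeta> + L * integral {0..t} m" by simp
  qed
  moreover have "m t \<le> m T" unfolding m_def by (intro mono[OF v_abs] t) auto
  ultimately have "L * m t \<le> L * (\<zeta> * exp (L * T))" using L by (intro mult_left_mono) auto
  with v_le[OF t] show ?thesis by (simp add: \<zeta>_def mult_ac)
qed

text \<open>Increments of \<open>X\<close> between knots are integrals of \<open>h\<close> over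
  half-open intervals plus increments of \<epsilon> times \<open>Z\<close>. The half-open convention
  of \<open>step_fun\<close> matches them exactly, so the step integral of the drift becomes an
  ordinary integral.\<close>

lemma step_integral_of_integral_eq:
  fixes X Z :: "real \<Rightarrow> 'a \<Rightarrow> real"
  assumes p: "mono_on {..n} p" "p ` {..n} \<subseteq> {0..T}"
    and h: "set_integrable lborel {0..T} h"
    and eq: "\<And>t. t \<in> {0..T} \<Longrightarrow> X t \<omega> = y + (LINT s:{0..t}|lborel. h s) + \<epsilon> * Z t \<omega>"
  shows "set_integrable lborel {0..T} (\<lambda>\<tau>. step_fun n p a \<tau> * h \<tau>)"
    and "step_integral n p a X \<omega> = (LINT \<tau>:{0..T}|lborel. step_fun n p a \<tau> * h \<tau>) + \<epsilon> * step_integral n p a Z \<omega>"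
proof -
  have incr: "X (p (Suc i)) \<omega> - X (p i) \<omega> = (LINT s:{p i<..p (Suc i)}|lborel. h s) + \<epsilon> * (Z (p (Suc i)) \<omega> - Z (p i) \<omega>)"
    and int: "set_integrable lborel {p i<..p (Suc i)} h" and Ioc: "{p i<..p (Suc i)} \<subseteq> {0..T}" if "i < n" for i
  proof -
    have mem: "p i \<in> {0..T}" "p (Suc i) \<in> {0..T}" using p(2) that by (auto simp: image_subset_iff)
    have le: "p i \<le> p (Suc i)" using p(1) that by (auto simp: mono_on_def)
    show Ioc: "{p i<..p (Suc i)} \<subseteq> {0..T}" using mem by auto
    show int: "set_integrable lborel {p i<..p (Suc i)} h"
      using Ioc by (intro set_integrable_subset[OF h]) auto
    have "{0..p (Suc i)} = {0..p i} \<union> {p i<..p (Suc i)}" using mem le by auto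
    then have "(LINT s:{0..p (Suc i)}|lborel. h s) = (LINT s:{0..p i}|lborel. h s) + (LINT s:{p i<..p (Suc i)}|lborel. h s)"
      using mem int by (simp, intro set_integral_Un) (auto intro!: set_integrable_subset[OF h])
    then show "X (p (Suc i)) \<omega> - X (p i) \<omega> = (LINT s:{p i<..p (Suc i)}|lborel. h s) + \<epsilon> * (Z (p (Suc i)) \<omega> - Z (p i) \<omega>)"
      using eq[OF mem(1)] eq[OF mem(2)] by (simp add: algebra_simps)
  qed
  have ind: "indicator {0..T} \<tau> *\<^sub>R (step_fun n p a \<tau> * h \<tau>) = (\<Sum>i<n. a i * (indicator {p i<..p (Suc i)} \<tau> *\<^sub>R h \<tau>))" for \<tau>
  proof -
    have "indicator {0..T} \<tau> * (a i * indicator {p i<..p (Suc i)} \<tau> * h \<tau>) = a i * (indicator {p i<..p (Suc i)} \<tau> * h \<tau>)"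
      if "i < n" for i using Ioc[OF that] by (auto simp: indicator_def)
    then show ?thesis
      unfolding step_fun_def real_scaleR_def sum_distrib_left sum_distrib_right
      by (intro sum.cong refl) simp
  qed
  show 1: "set_integrable lborel {0..T} (\<lambda>\<tau>. step_fun n p a \<tau> * h \<tau>)"
    unfolding set_integrable_def ind
    by (intro Bochner_Integration.integrable_sum integrable_mult_right)
      (use int in \<open>auto simp: set_integrable_def\<close>)
  have "(LINT \<tau>:{0..T}|lborel. step_fun n p a \<tau> * h \<tau>) = (\<Sum>i<n. a i * (LINT s:{p i<..p (Suc i)}|lborel. h s))"
    unfolding set_lebesgue_integral_def ind
    by (subst Bochner_Integration.integral_sum) (use int in \<open>auto simp: set_integrable_def intro!: integrable_mult_right\<close>)
  moreover have "step_integral n p a X \<omega> = (\<Sum>i<n. a i * (LINT s:{p i<..p (Suc i)}|lborel. h s)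
      + \<epsilon> * (a i * (Z (p (Suc i)) \<omega> - Z (p i) \<omega>)))"
    unfolding step_integral_def by (intro sum.cong refl, subst incr) (simp_all add: algebra_simps)
  ultimately show "step_integral n p a X \<omega> = (LINT \<tau>:{0..T}|lborel. step_fun n p a \<tau> * h \<tau>) + \<epsilon> * step_integral n p a Z \<omega>"
    by (simp only: step_integral_def sum.distrib sum_distrib_left)
qed

section \<open>The unperturbed solution on \<open>[0,T]\<close>\<close>

lemma unperturbed_has_derivative:
  assumes \<theta>: "continuous_on {0..T} \<theta>" and t: "t \<in> {0..T}"
  shows "(unperturbed x0 \<theta> has_real_derivative \<theta> t * unperturbed x0 \<theta> t) (at t within {0..T})"
proof -
  have eq: "unperturbed x0 \<theta> s = x0 * exp (integral {0..s} \<theta>)" if "s \<in> {0..T}" for s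
  proof -
    have "set_integrable lborel {0..s} \<theta>"
      using that by (intro borel_integrable_atLeastAtMost' continuous_on_subset[OF \<theta>]) auto
    then show ?thesis by (simp add: unperturbed_def set_borel_integral_eq_integral)
  qed
  have "((\<lambda>s. x0 * exp (integral {0..s} \<theta>)) has_real_derivative \<theta> t * unperturbed x0 \<theta> t) (at t within {0..T})"
    using t by (auto intro!: derivative_eq_intros integral_has_real_derivative[OF \<theta> t] simp: eq)
  then show ?thesis
    by (rule has_field_derivative_transform_within[where d = 1]) (use t eq in auto)
qed

lemma unperturbed_continuous_on:
  assumes "continuous_on {0..T} \<theta>"
  shows "continuous_on {0..T} (unperturbed x0 \<theta>)"
  using unperturbed_has_derivative[OF assms] by (intro DERIV_continuous_on) auto

lemma unperturbed_eq_integral: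
  assumes \<theta>: "continuous_on {0..T} \<theta>" and t: "t \<in> {0..T}"
  shows "unperturbed x0 \<theta> t = x0 + (LINT s:{0..t}|lborel. \<theta> s * unperturbed x0 \<theta> s)"
proof -
  have "((\<lambda>s. \<theta> s * unperturbed x0 \<theta> s) has_integral (unperturbed x0 \<theta> t - unperturbed x0 \<theta> 0)) {0..t}"
  proof (rule fundamental_theorem_of_calculus)
    fix s assume s: "s \<in> {0..t}"
    have "(unperturbed x0 \<theta> has_real_derivative \<theta> s * unperturbed x0 \<theta> s) (at s within {0..T})"
      using s t by (intro unperturbed_has_derivative[OF \<theta>]) auto
    then show "(unperturbed x0 \<theta> has_vector_derivative \<theta> s * unperturbed x0 \<theta> s) (at s within {0..t})"
      unfolding has_real_derivative_iff_has_vector_derivative[symmetric]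
      by (rule DERIV_subset) (use t in auto)
  qed (use t in auto)
  moreover have "unperturbed x0 \<theta> 0 = x0"
  proof -
    have "(LINT s:{0..0}|lborel. \<theta> s) = integral {0..0} \<theta>"
      using t by (intro set_borel_integral_eq_integral borel_integrable_atLeastAtMost' continuous_on_subset[OF \<theta>]) auto
    then show ?thesis by (simp add: unperturbed_def)
  qed
  moreover have "set_integrable lborel {0..t} (\<lambda>s. \<theta> s * unperturbed x0 \<theta> s)"
    using t by (intro borel_integrable_atLeastAtMost' continuous_intros
        continuous_on_subset[OF \<theta>] continuous_on_subset[OF unperturbed_continuous_on[OF \<theta>]]) auto
  ultimately show ?thesis
    by (simp add: set_borel_integral_eq_integral integral_unique)
qed

lemma abs_unperturbed_le:
  assumes \<theta>: "continuous_on {0..T} \<theta>" and L: "\<And>s. s \<in> {0..T} \<Longrightarrow> \<bar>\<theta> s\<bar> \<le> L" and t: "t \<in> {0..T}"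
  shows "\<bar>unperturbed x0 \<theta> t\<bar> \<le> \<bar>x0\<bar> * exp (L * T)"
proof -
  have L0: "0 \<le> L" using L[OF t] by linarith
  have int: "set_integrable lborel {0..t} \<theta>"
    using t by (intro borel_integrable_atLeastAtMost' continuous_on_subset[OF \<theta>]) auto
  have "\<theta> s \<le> L" if "s \<in> {0..t}" for s
    using L[of s] that t by auto
  then have "(LINT s:{0..t}|lborel. \<theta> s) \<le> (LINT s:{0..t}|lborel. L)"
    by (intro set_integral_mono int) (auto simp: set_integrable_def emeasure_lborel_Icc_eq intro!: integrable_real_indicator)
  also have "\<dots> = L * t" using t by (simp add: set_lebesgue_integral_def)
  also have "\<dots> \<le> L * T" using t L0 by (intro mult_left_mono) auto
  finally show ?thesis by (auto simp: unperturbed_def abs_mult intro!: mult_left_mono)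
qed

section \<open>Step functions and stochastic integrals\<close>

lemma Ioc_knots_unique:
  fixes p :: "nat \<Rightarrow> real"
  assumes p: "mono_on {..n} p" and i: "i < n" "\<tau> \<in> {p i<..p (Suc i)}"
    and j: "j < n" "\<tau> \<in> {p j<..p (Suc j)}"
  shows "j = i"
proof (rule ccontr)
  assume "j \<noteq> i"
  then consider "Suc j \<le> i" | "Suc i \<le> j" by linarith
  then show False
  proof cases
    case 1
    then have "p (Suc j) \<le> p i" using i j by (intro mono_onD[OF p]) auto
    then show False using i j by simp
  next
    case 2
    then have "p (Suc i) \<le> p j" using i j by (intro mono_onD[OF p]) auto
    then show False using i j by simp
  qed
qed

lemma sum_indicator_Ioc_knots:
  fixes p :: "nat \<Rightarrow> real" and b :: "nat \<Rightarrow> 'b :: semiring_1"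
  assumes p: "mono_on {..n} p" and i: "i < n" "\<tau> \<in> {p i<..p (Suc i)}"
  shows "(\<Sum>j<n. b j * indicator {p j<..p (Suc j)} \<tau>) = b i"
proof -
  have "(\<Sum>j<n. b j * indicator {p j<..p (Suc j)} \<tau>) = (\<Sum>j\<in>{i}. b j * indicator {p j<..p (Suc j)} \<tau>)"
  proof (rule sum.mono_neutral_right)
    show "\<forall>j\<in>{..<n} - {i}. b j * indicator {p j<..p (Suc j)} \<tau> = 0"
    proof
      fix j assume "j \<in> {..<n} - {i}"
      then have "\<tau> \<notin> {p j<..p (Suc j)}" using Ioc_knots_unique[OF p i, of j] by blast
      then show "b j * indicator {p j<..p (Suc j)} \<tau> = 0" by simp
    qed
  qed (use i in auto)
  also have "\<dots> = b i * indicator {p i<..p (Suc i)} \<tau>"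
    by (rule trans[OF sum.insert]) simp_all
  finally show ?thesis using i(2) by simp
qed

text \<open>At most one knot interval contains a given point, so the power \<alpha> passes through
  the sum. This connects the \<alpha>-sum from the characteristic function with the
  \<open>L^\<alpha>\<close> convergence in the definition of the integral.\<close>

lemma sum_powr_le_nn_integral_step_fun:
  assumes p: "mono_on {..n} p" "p ` {..n} \<subseteq> {0..T}"
  shows "ennreal (\<Sum>i<n. \<bar>a i\<bar> powr \<alpha> * (p (Suc i) - p i))
    \<le> (\<integral>\<^sup>+\<tau>\<in>{0..T}. ennreal (\<bar>step_fun n p a \<tau>\<bar> powr \<alpha>) \<partial>lborel)"
proof -
  have le: "p i \<le> p (Suc i)" if "i < n" for i using p(1) that by (auto simp: mono_on_def)
  have "ennreal (\<Sum>i<n. \<bar>a i\<bar> powr \<alpha> * (p (Suc i) - p i)) = (\<Sum>i<n. ennreal (\<bar>a i\<bar> powr \<alpha> * (p (Suc i) - p i)))"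
    using le by (intro sum_ennreal[symmetric]) simp
  also have "\<dots> = (\<Sum>i<n. \<integral>\<^sup>+\<tau>. ennreal (\<bar>a i\<bar> powr \<alpha>) * indicator {p i<..p (Suc i)} \<tau> \<partial>lborel)"
    using le by (intro sum.cong refl) (simp add: nn_integral_cmult_indicator ennreal_mult)
  also have "\<dots> = (\<integral>\<^sup>+\<tau>. (\<Sum>i<n. ennreal (\<bar>a i\<bar> powr \<alpha>) * indicator {p i<..p (Suc i)} \<tau>) \<partial>lborel)"
    by (intro nn_integral_sum[symmetric]) simp
  also have "\<dots> \<le> (\<integral>\<^sup>+\<tau>\<in>{0..T}. ennreal (\<bar>step_fun n p a \<tau>\<bar> powr \<alpha>) \<partial>lborel)"
  proof (intro nn_integral_mono)
    fix \<tau> :: real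
    show "(\<Sum>i<n. ennreal (\<bar>a i\<bar> powr \<alpha>) * indicator {p i<..p (Suc i)} \<tau>)
        \<le> ennreal (\<bar>step_fun n p a \<tau>\<bar> powr \<alpha>) * indicator {0..T} \<tau>"
    proof (cases "\<exists>i<n. \<tau> \<in> {p i<..p (Suc i)}")
      case True
      then obtain i where i: "i < n" "\<tau> \<in> {p i<..p (Suc i)}" by blast
      have "p i \<in> {0..T}" "p (Suc i) \<in> {0..T}" using p(2) i(1) by (auto simp: image_subset_iff)
      then have "\<tau> \<in> {0..T}" using i(2) by simp
      then show ?thesis
        unfolding step_fun_def sum_indicator_Ioc_knots[OF p(1) i] by simp
    next
      case False
      have "(\<Sum>i<n. ennreal (\<bar>a i\<bar> powr \<alpha>) * indicator {p i<..p (Suc i)} \<tau>) = 0"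
      proof (intro sum.neutral ballI)
        fix i assume "i \<in> {..<n}"
        then have "\<tau> \<notin> {p i<..p (Suc i)}" using False by blast
        then show "ennreal (\<bar>a i\<bar> powr \<alpha>) * indicator {p i<..p (Suc i)} \<tau> = 0"
          by simp
      qed
      then show ?thesis by simp
    qed
  qed
  finally show ?thesis .
qed

lemma ennreal_abs_set_integral_le:
  fixes g :: "real \<Rightarrow> real"
  assumes "set_integrable lborel A g"
  shows "ennreal \<bar>LINT x:A|lborel. g x\<bar> \<le> (\<integral>\<^sup>+x\<in>A. ennreal \<bar>g x\<bar> \<partial>lborel)"
proof -
  have "ennreal (norm (LINT x:A|lborel. g x)) \<le> (\<integral>\<^sup>+x. ennreal (norm (indicator A x *\<^sub>R g x)) \<partial>lborel)"
    using assms unfolding set_integrable_def set_lebesgue_integral_def by (rule integral_norm_bound_ennreal)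
  also have "\<dots> = (\<integral>\<^sup>+x\<in>A. ennreal \<bar>g x\<bar> \<partial>lborel)"
    by (intro nn_integral_cong) (auto simp: indicator_def)
  finally show ?thesis by simp
qed

lemma ennreal_set_integral_abs:
  fixes g :: "real \<Rightarrow> real"
  assumes "set_integrable lborel A g"
  shows "ennreal (LINT x:A|lborel. \<bar>g x\<bar>) = (\<integral>\<^sup>+x\<in>A. ennreal \<bar>g x\<bar> \<partial>lborel)"
proof -
  have "(\<integral>\<^sup>+x\<in>A. ennreal \<bar>g x\<bar> \<partial>lborel) = (\<integral>\<^sup>+x. ennreal (indicator A x *\<^sub>R \<bar>g x\<bar>) \<partial>lborel)"
    by (intro nn_integral_cong) (auto simp: indicator_def)
  also have "\<dots> = ennreal (LINT x:A|lborel. \<bar>g x\<bar>)"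
    using set_integrable_abs[OF assms] unfolding set_integrable_def set_lebesgue_integral_def
    by (intro nn_integral_eq_integral) auto
  finally show ?thesis ..
qed

lemma step_fun_measurable [measurable]: "step_fun n p a \<in> borel_measurable borel"
  unfolding step_fun_def[abs_def] by measurable

lemma abs_step_fun_le: "\<bar>step_fun n p a \<tau>\<bar> \<le> (\<Sum>i<n. \<bar>a i\<bar>)"
  unfolding step_fun_def
  by (rule order_trans[OF sum_abs], intro sum_mono) (auto simp: indicator_def)

text \<open>With \<sigma> the step function and \<open>v = X - x\<close>, the error is the sum of
  \<open>\<integral> \<sigma> \<theta> v\<close>,
  \<open>\<integral> (\<sigma> - f) \<theta> x\<close> and \<epsilon> times the step integral of
  \<open>Z\<close>. The pathwise bound on \<open>v\<close> splits the first into the first two terms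
  on the right. The bound is in \<open>ennreal\<close> so that expectations can be taken term by
  term.\<close>

lemma step_integral_error_le:
  fixes X Z :: "real \<Rightarrow> 'a \<Rightarrow> real" and f :: "real \<Rightarrow> real"
  assumes L: "0 < L" and T: "0 \<le> T" and \<epsilon>: "0 \<le> \<epsilon>"
    and \<theta>: "continuous_on {0..T} \<theta>" and \<theta>_le: "\<And>s. s \<in> {0..T} \<Longrightarrow> \<bar>\<theta> s\<bar> \<le> L"
    and X: "cadlag_on {0..T} (\<lambda>t. X t \<omega>)" and Z: "cadlag_on {0..T} (\<lambda>t. Z t \<omega>)"
    and eq: "\<And>t. t \<in> {0..T} \<Longrightarrow> X t \<omega> = x0 + (LINT s:{0..t}|lborel. \<theta> s * X s \<omega>) + \<epsilon> * Z t \<omega>"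
    and p: "mono_on {..n} p" "p ` {..n} \<subseteq> {0..T}"
    and f: "f \<in> borel_measurable borel" "\<And>s. \<bar>f s\<bar> \<le> B"
  shows "ennreal \<bar>step_integral n p a X \<omega> - (LINT \<tau>:{0..T}|lborel. f \<tau> * (\<theta> \<tau> * unperturbed x0 \<theta> \<tau>))\<bar>
    \<le> ennreal (L * \<epsilon>) * (\<integral>\<^sup>+\<tau>\<in>{0..T}. ennreal \<bar>step_fun n p a \<tau>\<bar> * ennreal \<bar>Z \<tau> \<omega>\<bar> \<partial>lborel)
      + ennreal (L * (L * exp (L * T) * \<epsilon>)) * (\<integral>\<^sup>+\<tau>\<in>{0..T}. ennreal \<bar>step_fun n p a \<tau>\<bar> \<partial>lborel)
          * (\<integral>\<^sup>+\<tau>\<in>{0..T}. ennreal \<bar>Z \<tau> \<omega>\<bar> \<partial>lborel)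
      + ennreal (L * (\<bar>x0\<bar> * exp (L * T))) * (\<integral>\<^sup>+\<tau>\<in>{0..T}. ennreal \<bar>step_fun n p a \<tau> - f \<tau>\<bar> \<partial>lborel)
      + ennreal \<epsilon> * ennreal \<bar>step_integral n p a Z \<omega>\<bar>"
proof -
  let ?x = "unperturbed x0 \<theta>" and ?\<sigma> = "step_fun n p a" and ?I = "{0..T}"
  define v where "v t = X t \<omega> - ?x t" for t
  define \<zeta> where "\<zeta> = (LINT s:?I|lborel. \<bar>Z s \<omega>\<bar>)"
  note [measurable] = f(1)
  have [measurable]: "(\<lambda>s. indicator ?I s * \<theta> s) \<in> borel_measurable borel"
    using borel_measurable_continuous_on_indicator[OF _ \<theta>] by simp
  have [measurable]: "(\<lambda>s. indicator ?I s * ?x s) \<in> borel_measurable borel"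
    using borel_measurable_continuous_on_indicator[OF _ unperturbed_continuous_on[OF \<theta>]] by simp
  note [measurable] = cadlag_on_measurable[OF X] cadlag_on_measurable[OF Z]
  obtain KX where KX: "\<And>s. s \<in> ?I \<Longrightarrow> \<bar>X s \<omega>\<bar> \<le> KX" using cadlag_on_bounded[OF X] by blast
  obtain KZ where KZ: "\<And>s. s \<in> ?I \<Longrightarrow> \<bar>Z s \<omega>\<bar> \<le> KZ" using cadlag_on_bounded[OF Z] by blast
  have x_le: "\<bar>?x s\<bar> \<le> \<bar>x0\<bar> * exp (L * T)" if "s \<in> ?I" for s
    using abs_unperturbed_le[OF \<theta> \<theta>_le that] by simp
  have Z_int: "set_integrable lborel ?I (\<lambda>s. Z s \<omega>)"
    by (rule set_integrable_bounded_Icc[OF cadlag_on_measurable[OF Z] KZ])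
  have \<theta>X_int: "set_integrable lborel ?I (\<lambda>s. \<theta> s * X s \<omega>)"
  proof (rule set_integrable_bounded_Icc)
    \<comment> \<open>Squaring the indicator gives each factor its own copy, since \<theta> and the
      path are known to be measurable only after restriction to \<open>[0,T]\<close>.\<close>
    have "(\<lambda>s. indicator ?I s * (\<theta> s * X s \<omega>)) = (\<lambda>s. (indicator ?I s * \<theta> s) * (indicator ?I s * X s \<omega>))"
      by (auto simp: indicator_def fun_eq_iff)
    also have "\<dots> \<in> borel_measurable borel" by measurable
    finally show "(\<lambda>s. indicator ?I s * (\<theta> s * X s \<omega>)) \<in> borel_measurable borel" .
    show "\<bar>\<theta> s * X s \<omega>\<bar> \<le> L * KX" if "s \<in> ?I" for s
      unfolding abs_mult using L by (intro mult_mono \<theta>_le KX that) auto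
  qed
  have \<theta>x_int: "set_integrable lborel ?I (\<lambda>s. \<theta> s * ?x s)"
    by (intro borel_integrable_atLeastAtMost' continuous_intros \<theta> unperturbed_continuous_on)
  have \<theta>v_int: "set_integrable lborel ?I (\<lambda>s. \<theta> s * v s)"
    using set_integral_diff(1)[OF \<theta>X_int \<theta>x_int] by (simp add: v_def algebra_simps)
  have v_int: "set_integrable lborel ?I v"
  proof (rule set_integrable_bounded_Icc)
    have "(\<lambda>s. indicator ?I s * v s) = (\<lambda>s. indicator ?I s * X s \<omega> - indicator ?I s * ?x s)"
      by (auto simp: v_def algebra_simps)
    also have "\<dots> \<in> borel_measurable borel" by measurable
    finally show "(\<lambda>s. indicator ?I s * v s) \<in> borel_measurable borel" .
    show "\<bar>v s\<bar> \<le> KX + \<bar>x0\<bar> * exp (L * T)" if "s \<in> ?I" for s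
      using KX[OF that] x_le[OF that] unfolding v_def by linarith
  qed
  \<comment> \<open>Subtracting the integral equations of \<open>X\<close> and of the unperturbed
    solution cancels \<open>x0\<close> and leaves a linear equation forced by the noise
    alone.\<close>
  have v_eq: "v t = (LINT s:{0..t}|lborel. \<theta> s * v s) + \<epsilon> * Z t \<omega>" if t: "t \<in> ?I" for t
  proof -
    have "(LINT s:{0..t}|lborel. \<theta> s * v s) = (LINT s:{0..t}|lborel. \<theta> s * X s \<omega> - \<theta> s * ?x s)"
      by (simp add: v_def algebra_simps)
    also have "\<dots> = (LINT s:{0..t}|lborel. \<theta> s * X s \<omega>) - (LINT s:{0..t}|lborel. \<theta> s * ?x s)"
      using t by (intro set_integral_diff set_integrable_subset[OF \<theta>X_int] set_integrable_subset[OF \<theta>x_int]) auto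
    finally show ?thesis using eq[OF t] unperturbed_eq_integral[OF \<theta> t, of x0] by (simp add: v_def)
  qed
  have v_le: "\<bar>v t\<bar> \<le> \<epsilon> * \<bar>Z t \<omega>\<bar> + L * exp (L * T) * \<epsilon> * \<zeta>" if "t \<in> ?I" for t
    unfolding \<zeta>_def
    by (rule abs_le_of_linear_Volterra[OF L \<epsilon> that \<theta>_le v_int Z_int \<theta>v_int v_eq])
  have \<sigma>_meas: "(\<lambda>s. indicator ?I s * (?\<sigma> s * (\<theta> s * ?x s))) \<in> borel_measurable borel"
    "(\<lambda>s. indicator ?I s * (f s * (\<theta> s * ?x s))) \<in> borel_measurable borel"
  proof -
    have "(\<lambda>s. indicator ?I s * (g s * (\<theta> s * ?x s))) = (\<lambda>s. g s * ((indicator ?I s * \<theta> s) * (indicator ?I s * ?x s)))"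
      for g :: "real \<Rightarrow> real" by (auto simp: indicator_def fun_eq_iff)
    then show "(\<lambda>s. indicator ?I s * (?\<sigma> s * (\<theta> s * ?x s))) \<in> borel_measurable borel"
      "(\<lambda>s. indicator ?I s * (f s * (\<theta> s * ?x s))) \<in> borel_measurable borel" by simp_all
  qed
  have \<theta>x_le: "\<bar>\<theta> s * ?x s\<bar> \<le> L * (\<bar>x0\<bar> * exp (L * T))" if "s \<in> ?I" for s
    unfolding abs_mult using L by (intro mult_mono \<theta>_le x_le that) auto
  have \<sigma>\<theta>x_int: "set_integrable lborel ?I (\<lambda>s. ?\<sigma> s * (\<theta> s * ?x s))"
  proof (rule set_integrable_bounded_Icc[OF \<sigma>_meas(1)])
    show "\<bar>?\<sigma> s * (\<theta> s * ?x s)\<bar> \<le> (\<Sum>i<n. \<bar>a i\<bar>) * (L * (\<bar>x0\<bar> * exp (L * T)))" if "s \<in> ?I" for s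
      unfolding abs_mult[of "?\<sigma> s"] by (intro mult_mono abs_step_fun_le \<theta>x_le that) (auto intro: sum_nonneg)
  qed
  have f\<theta>x_int: "set_integrable lborel ?I (\<lambda>s. f s * (\<theta> s * ?x s))"
  proof (rule set_integrable_bounded_Icc[OF \<sigma>_meas(2)])
    have "0 \<le> B" using f(2)[of 0] by linarith
    then show "\<bar>f s * (\<theta> s * ?x s)\<bar> \<le> B * (L * (\<bar>x0\<bar> * exp (L * T)))" if "s \<in> ?I" for s
      unfolding abs_mult[of "f s"] by (intro mult_mono f \<theta>x_le that) auto
  qed
  have step: "set_integrable lborel ?I (\<lambda>\<tau>. ?\<sigma> \<tau> * (\<theta> \<tau> * X \<tau> \<omega>))"
    "step_integral n p a X \<omega> = (LINT \<tau>:?I|lborel. ?\<sigma> \<tau> * (\<theta> \<tau> * X \<tau> \<omega>)) + \<epsilon> * step_integral n p a Z \<omega>"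
    by (rule step_integral_of_integral_eq[where X = X and Z = Z and \<omega> = \<omega> and y = x0
        and \<epsilon> = \<epsilon> and h = "\<lambda>s. \<theta> s * X s \<omega>", OF p \<theta>X_int eq]; assumption)+
  have \<sigma>\<theta>v_int: "set_integrable lborel ?I (\<lambda>\<tau>. ?\<sigma> \<tau> * (\<theta> \<tau> * v \<tau>))"
    using set_integral_diff(1)[OF step(1) \<sigma>\<theta>x_int] by (simp add: v_def algebra_simps)
  have \<sigma>f_int: "set_integrable lborel ?I (\<lambda>\<tau>. (?\<sigma> \<tau> - f \<tau>) * (\<theta> \<tau> * ?x \<tau>))"
    using set_integral_diff(1)[OF \<sigma>\<theta>x_int f\<theta>x_int] by (simp add: left_diff_distrib)
  have "(LINT \<tau>:?I|lborel. ?\<sigma> \<tau> * (\<theta> \<tau> * X \<tau> \<omega>)) - (LINT \<tau>:?I|lborel. f \<tau> * (\<theta> \<tau> * ?x \<tau>))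
      = (LINT \<tau>:?I|lborel. ?\<sigma> \<tau> * (\<theta> \<tau> * X \<tau> \<omega>) - f \<tau> * (\<theta> \<tau> * ?x \<tau>))"
    by (intro set_integral_diff(2)[symmetric] step(1) f\<theta>x_int)
  also have "\<dots> = (LINT \<tau>:?I|lborel. ?\<sigma> \<tau> * (\<theta> \<tau> * v \<tau>) + (?\<sigma> \<tau> - f \<tau>) * (\<theta> \<tau> * ?x \<tau>))"
    by (simp add: v_def algebra_simps)
  also have "\<dots> = (LINT \<tau>:?I|lborel. ?\<sigma> \<tau> * (\<theta> \<tau> * v \<tau>)) + (LINT \<tau>:?I|lborel. (?\<sigma> \<tau> - f \<tau>) * (\<theta> \<tau> * ?x \<tau>))"
    by (intro set_integral_add(2) \<sigma>\<theta>v_int \<sigma>f_int)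
  finally have decomp: "step_integral n p a X \<omega> - (LINT \<tau>:?I|lborel. f \<tau> * (\<theta> \<tau> * ?x \<tau>))
      = (LINT \<tau>:?I|lborel. ?\<sigma> \<tau> * (\<theta> \<tau> * v \<tau>)) + (LINT \<tau>:?I|lborel. (?\<sigma> \<tau> - f \<tau>) * (\<theta> \<tau> * ?x \<tau>))
        + \<epsilon> * step_integral n p a Z \<omega>"
    using step(2) by simp
  have \<zeta>0: "0 \<le> \<zeta>" unfolding \<zeta>_def set_lebesgue_integral_def by (intro integral_nonneg_AE) auto
  have Z_meas: "(\<lambda>\<tau>. ennreal \<bar>Z \<tau> \<omega>\<bar> * indicator ?I \<tau>) \<in> borel_measurable borel"
  proof -
    have "(\<lambda>\<tau>. ennreal \<bar>Z \<tau> \<omega>\<bar> * indicator ?I \<tau>) = (\<lambda>\<tau>. ennreal \<bar>indicator ?I \<tau> * Z \<tau> \<omega>\<bar>)"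
      by (auto simp: indicator_def fun_eq_iff)
    then show ?thesis by simp
  qed
  have "ennreal \<bar>LINT \<tau>:?I|lborel. ?\<sigma> \<tau> * (\<theta> \<tau> * v \<tau>)\<bar> \<le> (\<integral>\<^sup>+\<tau>\<in>?I. ennreal \<bar>?\<sigma> \<tau> * (\<theta> \<tau> * v \<tau>)\<bar> \<partial>lborel)"
    by (rule ennreal_abs_set_integral_le[OF \<sigma>\<theta>v_int])
  also have "\<dots> \<le> (\<integral>\<^sup>+\<tau>. ennreal (L * \<epsilon>) * (ennreal \<bar>?\<sigma> \<tau>\<bar> * (ennreal \<bar>Z \<tau> \<omega>\<bar> * indicator ?I \<tau>))
      + ennreal (L * (L * exp (L * T) * \<epsilon>)) * ennreal \<zeta> * (ennreal \<bar>?\<sigma> \<tau>\<bar> * indicator ?I \<tau>) \<partial>lborel)"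
  proof (intro nn_integral_mono)
    fix \<tau> :: real
    show "ennreal \<bar>?\<sigma> \<tau> * (\<theta> \<tau> * v \<tau>)\<bar> * indicator ?I \<tau> \<le> ennreal (L * \<epsilon>) * (ennreal \<bar>?\<sigma> \<tau>\<bar> * (ennreal \<bar>Z \<tau> \<omega>\<bar> * indicator ?I \<tau>))
      + ennreal (L * (L * exp (L * T) * \<epsilon>)) * ennreal \<zeta> * (ennreal \<bar>?\<sigma> \<tau>\<bar> * indicator ?I \<tau>)"
    proof (cases "\<tau> \<in> ?I")
      case True
      have "\<bar>?\<sigma> \<tau> * (\<theta> \<tau> * v \<tau>)\<bar> \<le> \<bar>?\<sigma> \<tau>\<bar> * (L * (\<epsilon> * \<bar>Z \<tau> \<omega>\<bar> + L * exp (L * T) * \<epsilon> * \<zeta>))"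
        unfolding abs_mult using L by (intro mult_left_mono mult_mono \<theta>_le v_le True) auto
      also have "\<dots> = L * \<epsilon> * (\<bar>?\<sigma> \<tau>\<bar> * \<bar>Z \<tau> \<omega>\<bar>) + L * (L * exp (L * T) * \<epsilon>) * \<zeta> * \<bar>?\<sigma> \<tau>\<bar>"
        by (simp add: algebra_simps)
      finally have "ennreal \<bar>?\<sigma> \<tau> * (\<theta> \<tau> * v \<tau>)\<bar> \<le> ennreal \<dots>" by (rule ennreal_leI)
      also have "\<dots> = ennreal (L * \<epsilon>) * (ennreal \<bar>?\<sigma> \<tau>\<bar> * ennreal \<bar>Z \<tau> \<omega>\<bar>)
          + ennreal (L * (L * exp (L * T) * \<epsilon>)) * ennreal \<zeta> * ennreal \<bar>?\<sigma> \<tau>\<bar>"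
        using L \<epsilon> \<zeta>0 by (simp add: ennreal_mult[symmetric] ennreal_plus[symmetric] del: ennreal_plus)
      finally show ?thesis using True by simp
    qed simp
  qed
  also have "\<dots> = ennreal (L * \<epsilon>) * (\<integral>\<^sup>+\<tau>. ennreal \<bar>?\<sigma> \<tau>\<bar> * (ennreal \<bar>Z \<tau> \<omega>\<bar> * indicator ?I \<tau>) \<partial>lborel)
      + ennreal (L * (L * exp (L * T) * \<epsilon>)) * ennreal \<zeta> * (\<integral>\<^sup>+\<tau>\<in>?I. ennreal \<bar>?\<sigma> \<tau>\<bar> \<partial>lborel)"
    using Z_meas by (subst nn_integral_add) (auto simp: nn_integral_cmult)
  finally have 1: "ennreal \<bar>LINT \<tau>:?I|lborel. ?\<sigma> \<tau> * (\<theta> \<tau> * v \<tau>)\<bar> \<le> \<dots>" .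
  have "ennreal \<bar>LINT \<tau>:?I|lborel. (?\<sigma> \<tau> - f \<tau>) * (\<theta> \<tau> * ?x \<tau>)\<bar> \<le> (\<integral>\<^sup>+\<tau>\<in>?I. ennreal \<bar>(?\<sigma> \<tau> - f \<tau>) * (\<theta> \<tau> * ?x \<tau>)\<bar> \<partial>lborel)"
    by (rule ennreal_abs_set_integral_le[OF \<sigma>f_int])
  also have "\<dots> \<le> (\<integral>\<^sup>+\<tau>. ennreal (L * (\<bar>x0\<bar> * exp (L * T))) * (ennreal \<bar>?\<sigma> \<tau> - f \<tau>\<bar> * indicator ?I \<tau>) \<partial>lborel)"
  proof (intro nn_integral_mono)
    fix \<tau> :: real
    show "ennreal \<bar>(?\<sigma> \<tau> - f \<tau>) * (\<theta> \<tau> * ?x \<tau>)\<bar> * indicator ?I \<tau>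
        \<le> ennreal (L * (\<bar>x0\<bar> * exp (L * T))) * (ennreal \<bar>?\<sigma> \<tau> - f \<tau>\<bar> * indicator ?I \<tau>)"
    proof (cases "\<tau> \<in> ?I")
      case True
      have "\<bar>(?\<sigma> \<tau> - f \<tau>) * (\<theta> \<tau> * ?x \<tau>)\<bar> \<le> \<bar>?\<sigma> \<tau> - f \<tau>\<bar> * (L * (\<bar>x0\<bar> * exp (L * T)))"
        unfolding abs_mult[of "?\<sigma> \<tau> - f \<tau>"] by (intro mult_left_mono \<theta>x_le True) auto
      then show ?thesis using True L
        by (simp add: ennreal_mult[symmetric] mult.commute ennreal_leI)
    qed simp
  qed
  also have "\<dots> = ennreal (L * (\<bar>x0\<bar> * exp (L * T))) * (\<integral>\<^sup>+\<tau>\<in>?I. ennreal \<bar>?\<sigma> \<tau> - f \<tau>\<bar> \<partial>lborel)"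
    by (intro nn_integral_cmult) measurable
  finally have 2: "ennreal \<bar>LINT \<tau>:?I|lborel. (?\<sigma> \<tau> - f \<tau>) * (\<theta> \<tau> * ?x \<tau>)\<bar> \<le> \<dots>" .
  have 3: "ennreal \<bar>\<epsilon> * step_integral n p a Z \<omega>\<bar> = ennreal \<epsilon> * ennreal \<bar>step_integral n p a Z \<omega>\<bar>"
    using \<epsilon> by (simp add: abs_mult ennreal_mult)
  have \<zeta>_eq: "ennreal \<zeta> = (\<integral>\<^sup>+\<tau>\<in>?I. ennreal \<bar>Z \<tau> \<omega>\<bar> \<partial>lborel)"
    unfolding \<zeta>_def by (rule ennreal_set_integral_abs[OF Z_int])
  have "ennreal \<bar>step_integral n p a X \<omega> - (LINT \<tau>:?I|lborel. f \<tau> * (\<theta> \<tau> * ?x \<tau>))\<bar>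
      \<le> ennreal (\<bar>LINT \<tau>:?I|lborel. ?\<sigma> \<tau> * (\<theta> \<tau> * v \<tau>)\<bar> + \<bar>LINT \<tau>:?I|lborel. (?\<sigma> \<tau> - f \<tau>) * (\<theta> \<tau> * ?x \<tau>)\<bar>
        + \<bar>\<epsilon> * step_integral n p a Z \<omega>\<bar>)"
    unfolding decomp by (intro ennreal_leI) linarith
  also have "\<dots> = ennreal \<bar>LINT \<tau>:?I|lborel. ?\<sigma> \<tau> * (\<theta> \<tau> * v \<tau>)\<bar> + ennreal \<bar>LINT \<tau>:?I|lborel. (?\<sigma> \<tau> - f \<tau>) * (\<theta> \<tau> * ?x \<tau>)\<bar>
        + ennreal \<bar>\<epsilon> * step_integral n p a Z \<omega>\<bar>" by simp
  also have "\<dots> \<le> ennreal (L * \<epsilon>) * (\<integral>\<^sup>+\<tau>. ennreal \<bar>?\<sigma> \<tau>\<bar> * (ennreal \<bar>Z \<tau> \<omega>\<bar> * indicator ?I \<tau>) \<partial>lborel)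
      + ennreal (L * (L * exp (L * T) * \<epsilon>)) * ennreal \<zeta> * (\<integral>\<^sup>+\<tau>\<in>?I. ennreal \<bar>?\<sigma> \<tau>\<bar> \<partial>lborel)
      + ennreal (L * (\<bar>x0\<bar> * exp (L * T))) * (\<integral>\<^sup>+\<tau>\<in>?I. ennreal \<bar>?\<sigma> \<tau> - f \<tau>\<bar> \<partial>lborel)
      + ennreal \<epsilon> * ennreal \<bar>step_integral n p a Z \<omega>\<bar>"
    unfolding 3 by (intro add_mono 1 2 order_refl)
  finally show ?thesis unfolding \<zeta>_eq by (simp only: mult_ac)
qed

section \<open>Expected errors of step integrals and of their limits\<close>

lemma (in prob_space) stable_Levy_first_moment_bound:
  assumes Z: "stable_Levy_process M F \<alpha> \<beta> Z" and \<alpha>: "1 < \<alpha>"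
  shows "\<exists>K\<ge>0. \<forall>t\<in>{0..T}. (\<integral>\<^sup>+\<omega>. ennreal \<bar>Z t \<omega>\<bar> \<partial>M) \<le> ennreal K"
proof -
  define K where "K = 4 / (1 - cos 1) * ((1 + \<bar>tan (\<alpha> * pi / 2)\<bar>) * \<bar>T\<bar> / (\<alpha> - 1) + 2)"
  have "(\<integral>\<^sup>+\<omega>. ennreal \<bar>Z t \<omega>\<bar> \<partial>M) \<le> ennreal K" if t: "t \<in> {0..T}" for t
  proof -
    \<comment> \<open>\<open>Z t\<close> is almost surely the step integral of the constant 1 with
      knots 0 and \<open>t\<close>. For \<open>t = 0\<close> the knots coincide, which the moment
      bound permits. The cut point is 1.\<close>
    define p where "p i = (if i = 0 then 0 else t)" for i :: nat
    have "AE \<omega> in M. Z 0 \<omega> = 0" using Z by (simp add: stable_Levy_process_def)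
    then have "AE \<omega> in M. ennreal \<bar>Z t \<omega>\<bar> = ennreal \<bar>step_integral 1 p (\<lambda>_. 1) Z \<omega>\<bar>"
      by eventually_elim (simp add: step_integral_def p_def)
    then have "(\<integral>\<^sup>+\<omega>. ennreal \<bar>Z t \<omega>\<bar> \<partial>M) = (\<integral>\<^sup>+\<omega>. ennreal \<bar>step_integral 1 p (\<lambda>_. 1) Z \<omega>\<bar> \<partial>M)"
      by (rule nn_integral_cong_AE)
    also have "\<dots> \<le> ennreal (4 / (1 - cos 1) * ((1 + \<bar>tan (\<alpha> * pi / 2)\<bar>) *
        (\<Sum>i<1. \<bar>1\<bar> powr \<alpha> * (p (Suc i) - p i)) * 1 powr (\<alpha> - 1) / (\<alpha> - 1) + 2 / 1))"
      using t by (intro nn_integral_abs_stable_step_integral_le[OF Z \<alpha>]) (auto simp: p_def mono_on_def)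
    also have "\<dots> \<le> ennreal K"
    proof -
      have "(1 + \<bar>tan (\<alpha> * pi / 2)\<bar>) * t / (\<alpha> - 1) \<le> (1 + \<bar>tan (\<alpha> * pi / 2)\<bar>) * \<bar>T\<bar> / (\<alpha> - 1)"
        using t \<alpha> by (intro divide_right_mono mult_left_mono) auto
      then show ?thesis
        using one_minus_cos_1_pos unfolding K_def by (intro ennreal_leI mult_left_mono) (auto simp: p_def)
    qed
    finally show ?thesis .
  qed
  moreover have "0 \<le> K" using \<alpha> one_minus_cos_1_pos by (simp add: K_def)
  ultimately show ?thesis by blast
qed

text \<open>The expectation of the pathwise bound. Tonelli, with \<open>V\<close> in place of
  \<open>\<bar>Z\<bar>\<close>, needs the first moment of \<open>Z\<close> only at fixed times; both
  noise integrals then reduce to multiples of \<open>K\<close> times the \<open>L^1\<close> norm of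
  the step function.\<close>

lemma (in prob_space) nn_integral_step_integral_error_le:
  fixes X Z :: "real \<Rightarrow> 'a \<Rightarrow> real" and f :: "real \<Rightarrow> real"
  assumes L: "0 < L" and T: "0 \<le> T" and \<epsilon>: "0 \<le> \<epsilon>"
    and \<theta>: "continuous_on {0..T} \<theta>" and \<theta>_le: "\<And>s. s \<in> {0..T} \<Longrightarrow> \<bar>\<theta> s\<bar> \<le> L"
    and Z_meas: "\<And>t. 0 \<le> t \<Longrightarrow> Z t \<in> borel_measurable M"
    and cadlag_Z: "AE \<omega> in M. cadlag_on {0..T} (\<lambda>t. Z t \<omega>)"
    and X: "AE \<omega> in M. cadlag_on {0..T} (\<lambda>t. X t \<omega>) \<and>
        (\<forall>t\<in>{0..T}. X t \<omega> = x0 + (LINT s:{0..t}|lborel. \<theta> s * X s \<omega>) + \<epsilon> * Z t \<omega>)"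
    and p: "mono_on {..n} p" "p ` {..n} \<subseteq> {0..T}"
    and f: "f \<in> borel_measurable borel" "\<And>s. \<bar>f s\<bar> \<le> B"
    and K: "0 \<le> K" "\<And>t. t \<in> {0..T} \<Longrightarrow> (\<integral>\<^sup>+\<omega>. ennreal \<bar>Z t \<omega>\<bar> \<partial>M) \<le> ennreal K"
  shows "(\<integral>\<^sup>+\<omega>. ennreal \<bar>step_integral n p a X \<omega> - (LINT \<tau>:{0..T}|lborel. f \<tau> * (\<theta> \<tau> * unperturbed x0 \<theta> \<tau>))\<bar> \<partial>M)
    \<le> ennreal (\<epsilon> * (L * K * (1 + L * exp (L * T) * T))) * (\<integral>\<^sup>+\<tau>\<in>{0..T}. ennreal \<bar>step_fun n p a \<tau>\<bar> \<partial>lborel)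
      + ennreal (L * (\<bar>x0\<bar> * exp (L * T))) * (\<integral>\<^sup>+\<tau>\<in>{0..T}. ennreal \<bar>step_fun n p a \<tau> - f \<tau>\<bar> \<partial>lborel)
      + ennreal \<epsilon> * (\<integral>\<^sup>+\<omega>. ennreal \<bar>step_integral n p a Z \<omega>\<bar> \<partial>M)"
proof -
  interpret pair_sigma_finite lborel M ..
  let ?\<sigma> = "step_fun n p a" and ?I = "{0..T}"
  let ?c = "LINT \<tau>:{0..T}|lborel. f \<tau> * (\<theta> \<tau> * unperturbed x0 \<theta> \<tau>)"
  let ?C1 = "ennreal (L * \<epsilon>)" and ?C2 = "ennreal (L * (L * exp (L * T) * \<epsilon>))" and ?C3 = "ennreal (L * (\<bar>x0\<bar> * exp (L * T)))"
  let ?A = "\<integral>\<^sup>+\<tau>\<in>?I. ennreal \<bar>?\<sigma> \<tau>\<bar> \<partial>lborel" and ?B = "\<integral>\<^sup>+\<tau>\<in>?I. ennreal \<bar>?\<sigma> \<tau> - f \<tau>\<bar> \<partial>lborel"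
  obtain V :: "real \<times> 'a \<Rightarrow> ennreal" where V_meas: "V \<in> borel_measurable (borel \<Otimes>\<^sub>M M)"
    and V_eq: "AE \<omega> in M. \<forall>s\<in>{0..T}. V (s, \<omega>) = ennreal \<bar>Z s \<omega>\<bar>"
    and V_le: "\<And>s. (\<integral>\<^sup>+\<omega>. V (s, \<omega>) \<partial>M) \<le> ennreal K"
    using jointly_measurable_cadlag_abs[of T Z "ennreal K", OF T Z_meas cadlag_Z K(2)] by auto
  have [measurable]: "V \<in> borel_measurable (lborel \<Otimes>\<^sub>M M)"
    using V_meas by (simp cong: measurable_cong_sets sets_pair_measure_cong)
  have stepZ[measurable]: "step_integral n p a Z \<in> borel_measurable M"
    unfolding step_integral_def using p(2)
    by (intro borel_measurable_sum borel_measurable_times borel_measurable_diff Z_meas borel_measurable_const)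
      (auto simp: image_subset_iff)
  have "(\<integral>\<^sup>+\<omega>. (\<integral>\<^sup>+\<tau>\<in>?I. ennreal \<bar>?\<sigma> \<tau>\<bar> * V (\<tau>, \<omega>) \<partial>lborel) \<partial>M)
      = (\<integral>\<^sup>+\<tau>. (\<integral>\<^sup>+\<omega>. ennreal \<bar>?\<sigma> \<tau>\<bar> * V (\<tau>, \<omega>) * indicator ?I \<tau> \<partial>M) \<partial>lborel)"
    by (rule Fubini') measurable
  also have "\<dots> = (\<integral>\<^sup>+\<tau>. ennreal \<bar>?\<sigma> \<tau>\<bar> * indicator ?I \<tau> * (\<integral>\<^sup>+\<omega>. V (\<tau>, \<omega>) \<partial>M) \<partial>lborel)"
    by (intro nn_integral_cong, subst nn_integral_cmult[symmetric]) (auto simp: mult_ac)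
  also have "\<dots> \<le> (\<integral>\<^sup>+\<tau>. ennreal \<bar>?\<sigma> \<tau>\<bar> * indicator ?I \<tau> * ennreal K \<partial>lborel)"
    by (intro nn_integral_mono mult_left_mono V_le) auto
  also have "\<dots> = ?A * ennreal K"
    by (intro nn_integral_multc) measurable
  finally have E1: "(\<integral>\<^sup>+\<omega>. (\<integral>\<^sup>+\<tau>\<in>?I. ennreal \<bar>?\<sigma> \<tau>\<bar> * V (\<tau>, \<omega>) \<partial>lborel) \<partial>M) \<le> ?A * ennreal K" .
  have "(\<integral>\<^sup>+\<omega>. (\<integral>\<^sup>+\<tau>\<in>?I. V (\<tau>, \<omega>) \<partial>lborel) \<partial>M)
      = (\<integral>\<^sup>+\<tau>. (\<integral>\<^sup>+\<omega>. V (\<tau>, \<omega>) * indicator ?I \<tau> \<partial>M) \<partial>lborel)"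
    by (rule Fubini') measurable
  also have "\<dots> = (\<integral>\<^sup>+\<tau>. indicator ?I \<tau> * (\<integral>\<^sup>+\<omega>. V (\<tau>, \<omega>) \<partial>M) \<partial>lborel)"
    by (intro nn_integral_cong, subst nn_integral_cmult[symmetric]) (auto simp: mult_ac)
  also have "\<dots> \<le> (\<integral>\<^sup>+\<tau>. indicator ?I \<tau> * ennreal K \<partial>lborel)"
    by (intro nn_integral_mono mult_left_mono V_le) auto
  also have "\<dots> = ennreal (T * K)"
    using T K by (simp add: nn_integral_multc ennreal_mult)
  finally have E2: "(\<integral>\<^sup>+\<omega>. (\<integral>\<^sup>+\<tau>\<in>?I. V (\<tau>, \<omega>) \<partial>lborel) \<partial>M) \<le> ennreal (T * K)" .
  have "AE \<omega> in M. ennreal \<bar>step_integral n p a X \<omega> - ?c\<bar>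
      \<le> ?C1 * (\<integral>\<^sup>+\<tau>\<in>?I. ennreal \<bar>?\<sigma> \<tau>\<bar> * V (\<tau>, \<omega>) \<partial>lborel)
        + ?C2 * ?A * (\<integral>\<^sup>+\<tau>\<in>?I. V (\<tau>, \<omega>) \<partial>lborel) + ?C3 * ?B + ennreal \<epsilon> * ennreal \<bar>step_integral n p a Z \<omega>\<bar>"
    using X cadlag_Z V_eq
  proof eventually_elim
    case (elim \<omega>)
    have "(\<integral>\<^sup>+\<tau>\<in>?I. ennreal \<bar>?\<sigma> \<tau>\<bar> * V (\<tau>, \<omega>) \<partial>lborel) = (\<integral>\<^sup>+\<tau>\<in>?I. ennreal \<bar>?\<sigma> \<tau>\<bar> * ennreal \<bar>Z \<tau> \<omega>\<bar> \<partial>lborel)"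
      "(\<integral>\<^sup>+\<tau>\<in>?I. V (\<tau>, \<omega>) \<partial>lborel) = (\<integral>\<^sup>+\<tau>\<in>?I. ennreal \<bar>Z \<tau> \<omega>\<bar> \<partial>lborel)"
      using elim by (auto intro!: nn_integral_cong simp: indicator_def)
    then show ?case
      using step_integral_error_le[OF L T \<epsilon> \<theta> \<theta>_le, of X \<omega> Z x0 n p f B a] elim p f by auto
  qed
  then have "(\<integral>\<^sup>+\<omega>. ennreal \<bar>step_integral n p a X \<omega> - ?c\<bar> \<partial>M)
    \<le> (\<integral>\<^sup>+\<omega>. ?C1 * (\<integral>\<^sup>+\<tau>\<in>?I. ennreal \<bar>?\<sigma> \<tau>\<bar> * V (\<tau>, \<omega>) \<partial>lborel)
        + ?C2 * ?A * (\<integral>\<^sup>+\<tau>\<in>?I. V (\<tau>, \<omega>) \<partial>lborel) + ?C3 * ?B + ennreal \<epsilon> * ennreal \<bar>step_integral n p a Z \<omega>\<bar> \<partial>M)"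
    by (rule nn_integral_mono_AE)
  also have "\<dots> = ?C1 * (\<integral>\<^sup>+\<omega>. (\<integral>\<^sup>+\<tau>\<in>?I. ennreal \<bar>?\<sigma> \<tau>\<bar> * V (\<tau>, \<omega>) \<partial>lborel) \<partial>M)
        + ?C2 * ?A * (\<integral>\<^sup>+\<omega>. (\<integral>\<^sup>+\<tau>\<in>?I. V (\<tau>, \<omega>) \<partial>lborel) \<partial>M) + ?C3 * ?B
        + ennreal \<epsilon> * (\<integral>\<^sup>+\<omega>. ennreal \<bar>step_integral n p a Z \<omega>\<bar> \<partial>M)"
    by (subst nn_integral_add, measurable)+ (simp add: nn_integral_cmult emeasure_space_1)
  also have "\<dots> \<le> ?C1 * (?A * ennreal K) + ?C2 * ?A * ennreal (T * K) + ?C3 * ?B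
        + ennreal \<epsilon> * (\<integral>\<^sup>+\<omega>. ennreal \<bar>step_integral n p a Z \<omega>\<bar> \<partial>M)"
    by (intro add_mono mult_left_mono E1 E2 order_refl) auto
  also have "?C1 * (?A * ennreal K) + ?C2 * ?A * ennreal (T * K) = ennreal (\<epsilon> * (L * K * (1 + L * exp (L * T) * T))) * ?A"
  proof -
    have "ennreal (\<epsilon> * (L * K * (1 + L * exp (L * T) * T))) = ennreal (L * \<epsilon> * K + L * (L * exp (L * T) * \<epsilon>) * (T * K))"
      by (simp add: algebra_simps)
    also have "\<dots> = ?C1 * ennreal K + ?C2 * ennreal (T * K)"
      using L \<epsilon> K T by (simp add: ennreal_mult[symmetric] ennreal_plus[symmetric] del: ennreal_plus)
    finally have "ennreal (\<epsilon> * (L * K * (1 + L * exp (L * T) * T))) = ?C1 * ennreal K + ?C2 * ennreal (T * K)" .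
    from arg_cong[OF this, of "\<lambda>x. x * ?A"] show ?thesis
      unfolding distrib_right[of "?C1 * ennreal K"] by (simp only: mult_ac)
  qed
  finally show ?thesis .
qed

text \<open>Above \<eta> the factor \<open>\<bar>y\<bar> powr (1 - \<alpha>)\<close> is at most
  \<open>\<eta> powr (1 - \<alpha>)\<close>. Integrated over \<open>[0,T]\<close>, this makes a
  small \<open>L^\<alpha>\<close> distance a small \<open>L^1\<close> distance, in the role of
  Hoelder's inequality.\<close>

lemma abs_le_add_powr:
  fixes y \<eta> \<alpha> :: real
  assumes "0 < \<eta>" "1 \<le> \<alpha>"
  shows "\<bar>y\<bar> \<le> \<eta> + \<eta> powr (1 - \<alpha>) * \<bar>y\<bar> powr \<alpha>"
proof (cases "\<bar>y\<bar> \<le> \<eta>")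
  case False
  then have y: "\<eta> \<le> \<bar>y\<bar>" "0 < \<bar>y\<bar>" using assms by linarith+
  have "\<bar>y\<bar> = \<bar>y\<bar> powr (1 - \<alpha>) * \<bar>y\<bar> powr \<alpha>"
    using y(2) by (simp add: powr_add[symmetric])
  also have "\<dots> \<le> \<eta> powr (1 - \<alpha>) * \<bar>y\<bar> powr \<alpha>"
    using assms y by (intro mult_right_mono powr_mono2') auto
  finally show ?thesis using assms by linarith
qed (simp add: add_increasing2)

lemma abs_powr_add_le:
  fixes x y \<alpha> :: real
  assumes "0 \<le> \<alpha>"
  shows "\<bar>x + y\<bar> powr \<alpha> \<le> 2 powr \<alpha> * (\<bar>x\<bar> powr \<alpha> + \<bar>y\<bar> powr \<alpha>)"
proof -
  have "\<bar>x + y\<bar> powr \<alpha> \<le> (2 * max \<bar>x\<bar> \<bar>y\<bar>) powr \<alpha>"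
    using assms by (intro powr_mono2) auto
  also have "\<dots> = 2 powr \<alpha> * max \<bar>x\<bar> \<bar>y\<bar> powr \<alpha>" by (simp add: powr_mult)
  also have "\<dots> \<le> 2 powr \<alpha> * (\<bar>x\<bar> powr \<alpha> + \<bar>y\<bar> powr \<alpha>)"
    by (intro mult_left_mono) (auto simp: max_def)
  finally show ?thesis .
qed

text \<open>Far along the approximating sequence the norms of the step functions are those of
  \<open>f\<close> up to \<eta> and constants, so the bound no longer mentions the sequence and
  survives the limit in probability.\<close>

lemma (in prob_space) nn_integral_stochastic_integral_error_le:
  fixes X Z :: "real \<Rightarrow> 'a \<Rightarrow> real" and f :: "real \<Rightarrow> real"
  assumes filt: "right_continuous_filtration M F"
    and \<alpha>: "1 < \<alpha>" and Z: "stable_Levy_process M F \<alpha> \<beta> Z"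
    and L: "0 < L" and T: "0 < T" and \<epsilon>: "0 \<le> \<epsilon>"
    and \<theta>: "continuous_on {0..T} \<theta>" and \<theta>_le: "\<And>s. s \<in> {0..T} \<Longrightarrow> \<bar>\<theta> s\<bar> \<le> L"
    and X: "solves_linear_SDE M F Z T x0 \<theta> \<epsilon> X"
    and f: "f \<in> borel_measurable borel" "\<And>s. \<bar>f s\<bar> \<le> B"
    and K: "0 \<le> K" "\<And>t. t \<in> {0..T} \<Longrightarrow> (\<integral>\<^sup>+\<omega>. ennreal \<bar>Z t \<omega>\<bar> \<partial>M) \<le> ennreal K"
    and J: "has_stochastic_integral M \<alpha> T X f J"
    and F1: "(\<integral>\<^sup>+\<tau>\<in>{0..T}. ennreal \<bar>f \<tau>\<bar> \<partial>lborel) \<le> ennreal F1" "0 \<le> F1"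
    and F\<alpha>: "(\<integral>\<^sup>+\<tau>\<in>{0..T}. ennreal (\<bar>f \<tau>\<bar> powr \<alpha>) \<partial>lborel) \<le> ennreal F\<alpha>" "0 \<le> F\<alpha>"
    and \<eta>: "0 < \<eta>" and R: "0 < R"
  shows "(\<integral>\<^sup>+\<omega>. ennreal \<bar>J \<omega> - (LINT \<tau>:{0..T}|lborel. f \<tau> * (\<theta> \<tau> * unperturbed x0 \<theta> \<tau>))\<bar> \<partial>M)
    \<le> ennreal (\<epsilon> * (L * K * (1 + L * exp (L * T) * T)) * (F1 + \<eta>) + L * (\<bar>x0\<bar> * exp (L * T)) * \<eta>
      + \<epsilon> * (4 / (1 - cos 1) * ((1 + \<bar>tan (\<alpha> * pi / 2)\<bar>) * (2 powr \<alpha> * (F\<alpha> + \<eta>)) * R powr (\<alpha> - 1) / (\<alpha> - 1) + 2 / R)))"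
proof -
  note [measurable] = f(1)
  have sub: "subalgebra M (F t)" if "0 \<le> t" for t
    using filt that by (simp add: right_continuous_filtration_def)
  have Z_meas: "Z t \<in> borel_measurable M" if "0 \<le> t" for t
    using Z that measurable_from_subalg[OF sub[OF that]] by (auto simp: stable_Levy_process_def)
  have X_meas: "X t \<in> borel_measurable M" if "t \<in> {0..T}" for t
  proof -
    have "X t \<in> borel_measurable (F t)" using X that by (auto simp: solves_linear_SDE_def)
    then show ?thesis using that by (intro measurable_from_subalg[OF sub]) auto
  qed
  have cadlag_Z: "AE \<omega> in M. cadlag_on {0..T} (\<lambda>t. Z t \<omega>)"
  proof -
    have "AE \<omega> in M. cadlag_on {0..} (\<lambda>t. Z t \<omega>)" using Z by (simp add: stable_Levy_process_def)
    then show ?thesis by eventually_elim (erule cadlag_on_subset, auto)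
  qed
  have X_eq: "AE \<omega> in M. cadlag_on {0..T} (\<lambda>t. X t \<omega>) \<and>
        (\<forall>t\<in>{0..T}. X t \<omega> = x0 + (LINT s:{0..t}|lborel. \<theta> s * X s \<omega>) + \<epsilon> * Z t \<omega>)"
    using X by (simp add: solves_linear_SDE_def)
  obtain n :: "nat \<Rightarrow> nat" and p a :: "nat \<Rightarrow> nat \<Rightarrow> real"
    where J_meas: "J \<in> borel_measurable M"
    and p: "\<And>m. mono_on {..n m} (p m)" "\<And>m. p m ` {..n m} \<subseteq> {0..T}"
    and L\<alpha>: "(\<lambda>m. \<integral>\<^sup>+\<tau>\<in>{0..T}. ennreal (\<bar>step_fun (n m) (p m) (a m) \<tau> - f \<tau>\<bar> powr \<alpha>) \<partial>lborel) \<longlonglongrightarrow> 0"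
    and lim: "\<And>\<delta>. \<delta> > 0 \<Longrightarrow> (\<lambda>m. prob {\<omega> \<in> space M. \<bar>step_integral (n m) (p m) (a m) X \<omega> - J \<omega>\<bar> > \<delta>}) \<longlonglongrightarrow> 0"
    using J unfolding has_stochastic_integral_def by blast
  let ?\<sigma> = "\<lambda>m. step_fun (n m) (p m) (a m)"
  \<comment> \<open>Used as threshold in \<open>abs_le_add_powr\<close>: the constant part
    integrates to \<open>\<eta> / 2\<close> over \<open>[0,T]\<close>. The number \<open>e\<close>
    keeps the power part below \<open>\<eta> / 2\<close> and the \<alpha>-th power distance itself
    below \<eta>.\<close>
  define h where "h = \<eta> / (2 * T)"
  define e where "e = min \<eta> (\<eta> / (2 * h powr (1 - \<alpha>)))"
  have h: "0 < h" using \<eta> T by (simp add: h_def)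
  have e: "0 < e" using \<eta> h by (simp add: e_def)
  show ?thesis
  proof (rule nn_integral_abs_le_of_tendsto_in_prob[OF _ J_meas lim])
    show "step_integral (n m) (p m) (a m) X \<in> borel_measurable M" for m
      unfolding step_integral_def using p(2)[of m]
      by (intro borel_measurable_sum borel_measurable_times borel_measurable_diff X_meas borel_measurable_const)
        (auto simp: image_subset_iff)
    have "\<forall>\<^sub>F m in sequentially. (\<integral>\<^sup>+\<tau>\<in>{0..T}. ennreal (\<bar>?\<sigma> m \<tau> - f \<tau>\<bar> powr \<alpha>) \<partial>lborel) < ennreal e"
      using order_tendstoD(2)[OF L\<alpha>] e by simp
    then show "\<forall>\<^sub>F m in sequentially. (\<integral>\<^sup>+\<omega>. ennreal \<bar>step_integral (n m) (p m) (a m) X \<omega>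
        - (LINT \<tau>:{0..T}|lborel. f \<tau> * (\<theta> \<tau> * unperturbed x0 \<theta> \<tau>))\<bar> \<partial>M)
      \<le> ennreal (\<epsilon> * (L * K * (1 + L * exp (L * T) * T)) * (F1 + \<eta>) + L * (\<bar>x0\<bar> * exp (L * T)) * \<eta>
        + \<epsilon> * (4 / (1 - cos 1) * ((1 + \<bar>tan (\<alpha> * pi / 2)\<bar>) * (2 powr \<alpha> * (F\<alpha> + \<eta>)) * R powr (\<alpha> - 1) / (\<alpha> - 1) + 2 / R)))"
    proof eventually_elim
      case (elim m)
      let ?s = "\<Sum>i<n m. \<bar>a m i\<bar> powr \<alpha> * (p m (Suc i) - p m i)"
      have "(\<integral>\<^sup>+\<tau>\<in>{0..T}. ennreal \<bar>?\<sigma> m \<tau> - f \<tau>\<bar> \<partial>lborel)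
          \<le> (\<integral>\<^sup>+\<tau>. ennreal h * indicator {0..T} \<tau> + ennreal (h powr (1 - \<alpha>)) * (ennreal (\<bar>?\<sigma> m \<tau> - f \<tau>\<bar> powr \<alpha>) * indicator {0..T} \<tau>) \<partial>lborel)"
      proof (intro nn_integral_mono)
        fix \<tau> :: real
        have "ennreal \<bar>?\<sigma> m \<tau> - f \<tau>\<bar> \<le> ennreal (h + h powr (1 - \<alpha>) * \<bar>?\<sigma> m \<tau> - f \<tau>\<bar> powr \<alpha>)"
          using h \<alpha> by (intro ennreal_leI abs_le_add_powr) auto
        also have "\<dots> = ennreal h + ennreal (h powr (1 - \<alpha>)) * ennreal (\<bar>?\<sigma> m \<tau> - f \<tau>\<bar> powr \<alpha>)"
          using h by (simp add: ennreal_mult)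
        finally show "ennreal \<bar>?\<sigma> m \<tau> - f \<tau>\<bar> * indicator {0..T} \<tau>
          \<le> ennreal h * indicator {0..T} \<tau> + ennreal (h powr (1 - \<alpha>)) * (ennreal (\<bar>?\<sigma> m \<tau> - f \<tau>\<bar> powr \<alpha>) * indicator {0..T} \<tau>)"
          by (auto simp: indicator_def)
      qed
      also have "\<dots> = ennreal h * ennreal T + ennreal (h powr (1 - \<alpha>)) *
          (\<integral>\<^sup>+\<tau>\<in>{0..T}. ennreal (\<bar>?\<sigma> m \<tau> - f \<tau>\<bar> powr \<alpha>) \<partial>lborel)"
        using T by (subst nn_integral_add) (auto simp: nn_integral_cmult nn_integral_cmult_indicator)
      also have "\<dots> \<le> ennreal h * ennreal T + ennreal (h powr (1 - \<alpha>)) * ennreal e"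
        using elim by (intro add_left_mono mult_left_mono) auto
      also have "\<dots> = ennreal (h * T + h powr (1 - \<alpha>) * e)"
        using h T e by (simp add: ennreal_mult)
      also have "\<dots> \<le> ennreal \<eta>"
      proof (rule ennreal_leI)
        have "h powr (1 - \<alpha>) * e \<le> h powr (1 - \<alpha>) * (\<eta> / (2 * h powr (1 - \<alpha>)))"
          by (intro mult_left_mono) (auto simp: e_def)
        also have "\<dots> = \<eta> / 2" using h by simp
        finally have "h powr (1 - \<alpha>) * e \<le> \<eta> / 2" .
        moreover have "h * T = \<eta> / 2" using T by (simp add: h_def)
        ultimately show "h * T + h powr (1 - \<alpha>) * e \<le> \<eta>" by linarith
      qed
      finally have B_le: "(\<integral>\<^sup>+\<tau>\<in>{0..T}. ennreal \<bar>?\<sigma> m \<tau> - f \<tau>\<bar> \<partial>lborel) \<le> ennreal \<eta>" .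
      have "(\<integral>\<^sup>+\<tau>\<in>{0..T}. ennreal \<bar>?\<sigma> m \<tau>\<bar> \<partial>lborel)
          \<le> (\<integral>\<^sup>+\<tau>. ennreal \<bar>f \<tau>\<bar> * indicator {0..T} \<tau> + ennreal \<bar>?\<sigma> m \<tau> - f \<tau>\<bar> * indicator {0..T} \<tau> \<partial>lborel)"
        by (intro nn_integral_mono) (auto simp: indicator_def ennreal_plus[symmetric] simp del: ennreal_plus intro!: ennreal_leI)
      also have "\<dots> = (\<integral>\<^sup>+\<tau>\<in>{0..T}. ennreal \<bar>f \<tau>\<bar> \<partial>lborel) + (\<integral>\<^sup>+\<tau>\<in>{0..T}. ennreal \<bar>?\<sigma> m \<tau> - f \<tau>\<bar> \<partial>lborel)"
        by (rule nn_integral_add) measurable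
      also have "\<dots> \<le> ennreal (F1 + \<eta>)"
        using add_mono[OF F1(1) B_le] F1(2) \<eta> by simp
      finally have A_le: "(\<integral>\<^sup>+\<tau>\<in>{0..T}. ennreal \<bar>?\<sigma> m \<tau>\<bar> \<partial>lborel) \<le> ennreal (F1 + \<eta>)" .
      \<comment> \<open>From the coefficients of the approximants to the integrand: the factor
        \<open>2 powr \<alpha>\<close> is the price of a pointwise inequality in place of the
        triangle inequality in \<open>L^\<alpha>\<close>.\<close>
      have "ennreal ?s \<le> (\<integral>\<^sup>+\<tau>\<in>{0..T}. ennreal (\<bar>?\<sigma> m \<tau>\<bar> powr \<alpha>) \<partial>lborel)"
        by (rule sum_powr_le_nn_integral_step_fun[OF p])
      also have "\<dots> \<le> (\<integral>\<^sup>+\<tau>. ennreal (2 powr \<alpha>) * (ennreal (\<bar>f \<tau>\<bar> powr \<alpha>) * indicator {0..T} \<tau>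
          + ennreal (\<bar>?\<sigma> m \<tau> - f \<tau>\<bar> powr \<alpha>) * indicator {0..T} \<tau>) \<partial>lborel)"
      proof (intro nn_integral_mono)
        fix \<tau> :: real
        have "ennreal (\<bar>?\<sigma> m \<tau>\<bar> powr \<alpha>) \<le> ennreal (2 powr \<alpha> * (\<bar>f \<tau>\<bar> powr \<alpha> + \<bar>?\<sigma> m \<tau> - f \<tau>\<bar> powr \<alpha>))"
          using abs_powr_add_le[of \<alpha> "f \<tau>" "?\<sigma> m \<tau> - f \<tau>"] \<alpha> by (intro ennreal_leI) simp
        also have "\<dots> = ennreal (2 powr \<alpha>) * (ennreal (\<bar>f \<tau>\<bar> powr \<alpha>) + ennreal (\<bar>?\<sigma> m \<tau> - f \<tau>\<bar> powr \<alpha>))"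
          by (simp add: ennreal_mult)
        finally show "ennreal (\<bar>?\<sigma> m \<tau>\<bar> powr \<alpha>) * indicator {0..T} \<tau> \<le> ennreal (2 powr \<alpha>) * (ennreal (\<bar>f \<tau>\<bar> powr \<alpha>) * indicator {0..T} \<tau>
          + ennreal (\<bar>?\<sigma> m \<tau> - f \<tau>\<bar> powr \<alpha>) * indicator {0..T} \<tau>)"
          by (auto simp: indicator_def)
      qed
      also have "\<dots> = ennreal (2 powr \<alpha>) * ((\<integral>\<^sup>+\<tau>\<in>{0..T}. ennreal (\<bar>f \<tau>\<bar> powr \<alpha>) \<partial>lborel)
          + (\<integral>\<^sup>+\<tau>\<in>{0..T}. ennreal (\<bar>?\<sigma> m \<tau> - f \<tau>\<bar> powr \<alpha>) \<partial>lborel))"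
        by (subst nn_integral_cmult, measurable, subst nn_integral_add, measurable)
      also have "\<dots> \<le> ennreal (2 powr \<alpha>) * (ennreal F\<alpha> + ennreal \<eta>)"
      proof (intro mult_left_mono add_mono F\<alpha>(1))
        have "ennreal e \<le> ennreal \<eta>" by (intro ennreal_leI) (simp add: e_def)
        then show "(\<integral>\<^sup>+\<tau>\<in>{0..T}. ennreal (\<bar>?\<sigma> m \<tau> - f \<tau>\<bar> powr \<alpha>) \<partial>lborel) \<le> ennreal \<eta>"
          using elim by (meson less_imp_le order_trans)
      qed simp
      also have "\<dots> = ennreal (2 powr \<alpha> * (F\<alpha> + \<eta>))"
        using F\<alpha>(2) \<eta> by (simp add: ennreal_mult)
      finally have s_le: "?s \<le> 2 powr \<alpha> * (F\<alpha> + \<eta>)"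
        using F\<alpha>(2) \<eta> by (subst (asm) ennreal_le_iff) auto
      have p0: "0 \<le> p m 0" using p(2)[of m] by (auto simp: image_subset_iff)
      have "(\<integral>\<^sup>+\<omega>. ennreal \<bar>step_integral (n m) (p m) (a m) Z \<omega>\<bar> \<partial>M) \<le> ennreal (4 / (1 - cos 1) *
          ((1 + \<bar>tan (\<alpha> * pi / 2)\<bar>) * ?s * R powr (\<alpha> - 1) / (\<alpha> - 1) + 2 / R))"
        by (rule nn_integral_abs_stable_step_integral_le[OF Z \<alpha> p(1) p0 R])
      also have "\<dots> \<le> ennreal (4 / (1 - cos 1) *
          ((1 + \<bar>tan (\<alpha> * pi / 2)\<bar>) * (2 powr \<alpha> * (F\<alpha> + \<eta>)) * R powr (\<alpha> - 1) / (\<alpha> - 1) + 2 / R))"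
        using \<alpha> one_minus_cos_1_pos s_le by (intro ennreal_leI mult_left_mono mult_right_mono add_right_mono divide_right_mono) auto
      finally have I_le: "(\<integral>\<^sup>+\<omega>. ennreal \<bar>step_integral (n m) (p m) (a m) Z \<omega>\<bar> \<partial>M) \<le> \<dots>" .
      have "(\<integral>\<^sup>+\<omega>. ennreal \<bar>step_integral (n m) (p m) (a m) X \<omega>
          - (LINT \<tau>:{0..T}|lborel. f \<tau> * (\<theta> \<tau> * unperturbed x0 \<theta> \<tau>))\<bar> \<partial>M)
        \<le> ennreal (\<epsilon> * (L * K * (1 + L * exp (L * T) * T))) * (\<integral>\<^sup>+\<tau>\<in>{0..T}. ennreal \<bar>?\<sigma> m \<tau>\<bar> \<partial>lborel)
          + ennreal (L * (\<bar>x0\<bar> * exp (L * T))) * (\<integral>\<^sup>+\<tau>\<in>{0..T}. ennreal \<bar>?\<sigma> m \<tau> - f \<tau>\<bar> \<partial>lborel)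
          + ennreal \<epsilon> * (\<integral>\<^sup>+\<omega>. ennreal \<bar>step_integral (n m) (p m) (a m) Z \<omega>\<bar> \<partial>M)"
        using T by (intro nn_integral_step_integral_error_le[OF L _ \<epsilon> \<theta> \<theta>_le Z_meas cadlag_Z X_eq p f K]) auto
      also have "\<dots> \<le> ennreal (\<epsilon> * (L * K * (1 + L * exp (L * T) * T))) * ennreal (F1 + \<eta>)
          + ennreal (L * (\<bar>x0\<bar> * exp (L * T))) * ennreal \<eta>
          + ennreal \<epsilon> * ennreal (4 / (1 - cos 1) * ((1 + \<bar>tan (\<alpha> * pi / 2)\<bar>) * (2 powr \<alpha> * (F\<alpha> + \<eta>)) * R powr (\<alpha> - 1) / (\<alpha> - 1) + 2 / R))"
        by (intro add_mono mult_left_mono A_le B_le I_le) auto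
      also have "\<dots> = ennreal (\<epsilon> * (L * K * (1 + L * exp (L * T) * T)) * (F1 + \<eta>) + L * (\<bar>x0\<bar> * exp (L * T)) * \<eta>
        + \<epsilon> * (4 / (1 - cos 1) * ((1 + \<bar>tan (\<alpha> * pi / 2)\<bar>) * (2 powr \<alpha> * (F\<alpha> + \<eta>)) * R powr (\<alpha> - 1) / (\<alpha> - 1) + 2 / R)))"
      proof -
        have 1: "0 \<le> \<epsilon> * (L * K * (1 + L * exp (L * T) * T))" using \<epsilon> L K T by simp
        have 2: "0 \<le> L * (\<bar>x0\<bar> * exp (L * T))" using L by simp
        have 3: "0 \<le> 4 / (1 - cos 1) * ((1 + \<bar>tan (\<alpha> * pi / 2)\<bar>) * (2 powr \<alpha> * (F\<alpha> + \<eta>)) * R powr (\<alpha> - 1) / (\<alpha> - 1) + 2 / R)"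
          using one_minus_cos_1_pos \<alpha> F\<alpha>(2) \<eta> R by (intro mult_nonneg_nonneg add_nonneg_nonneg divide_nonneg_nonneg) auto
        have 4: "0 \<le> F1 + \<eta>" using F1 \<eta> by simp
        show ?thesis
          using 1 2 3 4 \<epsilon> \<eta> by (simp only: ennreal_mult[symmetric] ennreal_plus[symmetric] mult_nonneg_nonneg add_nonneg_nonneg less_imp_le)
      qed
      finally show ?case .
    qed
  qed
qed

section \<open>Derivative bounds and kernel bias\<close>

text \<open>A chain of \<open>n\<close> successive derivatives on \<open>S\<close>, all bounded by
  the same \<open>K\<close>; the last one need not be continuous. Existential derivatives make sums,
  products and solutions of \<open>x' = \<theta> x\<close> accessible by induction, without
  computing iterated \<open>deriv\<close>.\<close>

primrec bounded_derivs :: "real set \<Rightarrow> nat \<Rightarrow> real \<Rightarrow> (real \<Rightarrow> real) \<Rightarrow> bool" where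
  "bounded_derivs S 0 K f \<longleftrightarrow> (\<forall>t\<in>S. \<bar>f t\<bar> \<le> K)"
| "bounded_derivs S (Suc n) K f \<longleftrightarrow> (\<forall>t\<in>S. \<bar>f t\<bar> \<le> K) \<and>
    (\<exists>f'. (\<forall>t\<in>S. (f has_real_derivative f' t) (at t)) \<and> bounded_derivs S n K f')"

lemma bounded_derivs_bound: "bounded_derivs S n K f \<Longrightarrow> t \<in> S \<Longrightarrow> \<bar>f t\<bar> \<le> K"
  by (cases n) auto

lemma bounded_derivs_SucE:
  assumes "bounded_derivs S (Suc n) K f"
  obtains f' where "\<And>t. t \<in> S \<Longrightarrow> (f has_real_derivative f' t) (at t)" "bounded_derivs S n K f'"
  using assms unfolding bounded_derivs.simps(2) by blast

lemma bounded_derivs_SucI: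
  assumes "\<And>t. t \<in> S \<Longrightarrow> \<bar>f t\<bar> \<le> K" "\<And>t. t \<in> S \<Longrightarrow> (f has_real_derivative f' t) (at t)"
    "bounded_derivs S n K f'"
  shows "bounded_derivs S (Suc n) K f"
  using assms unfolding bounded_derivs.simps(2) by blast

lemma bounded_derivs_mono:
  assumes "K \<le> K'"
  shows "bounded_derivs S n K f \<Longrightarrow> bounded_derivs S n K' f"
proof (induction n arbitrary: f)
  case 0
  then show ?case using assms by (meson bounded_derivs.simps(1) order_trans)
next
  case (Suc n)
  from Suc.prems obtain f' where f': "\<And>t. t \<in> S \<Longrightarrow> (f has_real_derivative f' t) (at t)" "bounded_derivs S n K f'"
    by (rule bounded_derivs_SucE) blast
  show ?case
  proof (rule bounded_derivs_SucI[OF _ f'(1) Suc.IH[OF f'(2)]])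
    show "\<bar>f t\<bar> \<le> K'" if "t \<in> S" for t
      using bounded_derivs_bound[OF Suc.prems that] assms by linarith
  qed
qed

lemma bounded_derivs_SucD: "bounded_derivs S (Suc n) K f \<Longrightarrow> bounded_derivs S n K f"
proof (induction n arbitrary: f)
  case 0
  then show ?case using bounded_derivs_bound[OF 0] by simp
next
  case (Suc n)
  from Suc.prems obtain f' where f': "\<And>t. t \<in> S \<Longrightarrow> (f has_real_derivative f' t) (at t)" "bounded_derivs S (Suc n) K f'"
    by (rule bounded_derivs_SucE) blast
  show ?case
    by (rule bounded_derivs_SucI[OF bounded_derivs_bound[OF Suc.prems] f'(1) Suc.IH[OF f'(2)]])
qed

lemma bounded_derivs_add:
  "bounded_derivs S n K f \<Longrightarrow> bounded_derivs S n K' g \<Longrightarrow>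
    bounded_derivs S n (K + K') (\<lambda>t. f t + g t)"
proof (induction n arbitrary: f g)
  case 0
  have "\<bar>f t + g t\<bar> \<le> K + K'" if "t \<in> S" for t
    using bounded_derivs_bound[OF 0(1) that] bounded_derivs_bound[OF 0(2) that] by linarith
  then show ?case by simp
next
  case (Suc n)
  from Suc.prems(1) obtain f' where f': "\<And>t. t \<in> S \<Longrightarrow> (f has_real_derivative f' t) (at t)" "bounded_derivs S n K f'"
    by (rule bounded_derivs_SucE) blast
  from Suc.prems(2) obtain g' where g': "\<And>t. t \<in> S \<Longrightarrow> (g has_real_derivative g' t) (at t)" "bounded_derivs S n K' g'"
    by (rule bounded_derivs_SucE) blast
  show ?case
  proof (rule bounded_derivs_SucI[OF _ DERIV_add[OF f'(1) g'(1)] Suc.IH[OF f'(2) g'(2)]])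
    show "\<bar>f t + g t\<bar> \<le> K + K'" if "t \<in> S" for t
      using bounded_derivs_bound[OF Suc.prems(1) that] bounded_derivs_bound[OF Suc.prems(2) that] by linarith
  qed
qed

text \<open>By the product rule each differentiation replaces one product by two of the same kind,
  which accounts for \<open>2 ^ n\<close>.\<close>

lemma bounded_derivs_mult:
  assumes K: "0 \<le> K" "0 \<le> K'"
  shows "bounded_derivs S n K f \<Longrightarrow> bounded_derivs S n K' g \<Longrightarrow>
    bounded_derivs S n (2 ^ n * (K * K')) (\<lambda>t. f t * g t)"
proof (induction n arbitrary: f g)
  case 0
  have "\<bar>f t * g t\<bar> \<le> K * K'" if "t \<in> S" for t
    unfolding abs_mult using bounded_derivs_bound[OF 0(1) that] bounded_derivs_bound[OF 0(2) that] K
    by (intro mult_mono) auto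
  then show ?case by simp
next
  case (Suc n)
  from Suc.prems(1) obtain f' where f': "\<And>t. t \<in> S \<Longrightarrow> (f has_real_derivative f' t) (at t)" "bounded_derivs S n K f'"
    by (rule bounded_derivs_SucE) blast
  from Suc.prems(2) obtain g' where g': "\<And>t. t \<in> S \<Longrightarrow> (g has_real_derivative g' t) (at t)" "bounded_derivs S n K' g'"
    by (rule bounded_derivs_SucE) blast
  show ?case
  proof (rule bounded_derivs_SucI)
    fix t assume t: "t \<in> S"
    have "\<bar>f t * g t\<bar> \<le> K * K'"
      unfolding abs_mult using K bounded_derivs_bound[OF Suc.prems(1) t] bounded_derivs_bound[OF Suc.prems(2) t]
      by (intro mult_mono) auto
    also have "\<dots> = 1 * (K * K')" by simp
    also have "\<dots> \<le> 2 ^ Suc n * (K * K')"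
      using K by (intro mult_right_mono one_le_power) auto
    finally show "\<bar>f t * g t\<bar> \<le> 2 ^ Suc n * (K * K')" .
    show "((\<lambda>t. f t * g t) has_real_derivative f' t * g t + g' t * f t) (at t)"
      by (rule DERIV_mult[OF f'(1)[OF t] g'(1)[OF t]])
  next
    have "2 ^ Suc n * (K * K') = 2 ^ n * (K * K') + 2 ^ n * (K' * K)" by simp
    then show "bounded_derivs S n (2 ^ Suc n * (K * K')) (\<lambda>t. f' t * g t + g' t * f t)"
      using bounded_derivs_add[OF Suc.IH[OF f'(2) bounded_derivs_SucD[OF Suc.prems(2)]]
          Suc.IH[OF bounded_derivs_SucD[OF Suc.prems(1)] g'(2)]] by (simp only: mult_ac)
  qed
qed

text \<open>The polynomial for \<open>f\<close> is the antiderivative of the one for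
  \<open>f'\<close> with value \<open>f t\<close> at \<open>t\<close>; the remainder vanishes at
  \<open>t\<close> and its derivative is bounded by the induction hypothesis. Only the coefficient
  \<open>c 0\<close> is identified, because the kernel moments annihilate the others.\<close>

lemma bounded_derivs_Taylor:
  assumes S: "convex S" and t: "t \<in> S"
  shows "bounded_derivs S n K f \<Longrightarrow>
    \<exists>c. (0 < n \<longrightarrow> c 0 = f t) \<and> (\<forall>y\<in>S. \<bar>f y - (\<Sum>i<n. c i * (y - t) ^ i)\<bar> \<le> K * \<bar>y - t\<bar> ^ n)"
proof (induction n arbitrary: f)
  case (Suc n)
  from Suc.prems obtain f' where f': "\<And>t. t \<in> S \<Longrightarrow> (f has_real_derivative f' t) (at t)" "bounded_derivs S n K f'"
    by (rule bounded_derivs_SucE) blast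
  obtain c' where c': "\<And>y. y \<in> S \<Longrightarrow> \<bar>f' y - (\<Sum>i<n. c' i * (y - t) ^ i)\<bar> \<le> K * \<bar>y - t\<bar> ^ n"
    using Suc.IH[OF f'(2)] by auto
  have K: "0 \<le> K" using bounded_derivs_bound[OF Suc.prems t] by linarith
  define c where "c i = (case i of 0 \<Rightarrow> f t | Suc j \<Rightarrow> c' j / real (Suc j))" for i
  define h where "h y = f y - (\<Sum>i<Suc n. c i * (y - t) ^ i)" for y
  have h_eq: "h y = f y - f t - (\<Sum>i<n. c' i / real (Suc i) * (y - t) ^ Suc i)" for y
    unfolding h_def sum.lessThan_Suc_shift by (simp add: c_def)
  have dh: "(h has_real_derivative f' y - (\<Sum>i<n. c' i * (y - t) ^ i)) (at y)" if "y \<in> S" for y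
  proof -
    have "((\<lambda>y. c' i / real (Suc i) * (y - t) ^ Suc i) has_real_derivative c' i * (y - t) ^ i) (at y)" for i
      by (auto intro!: derivative_eq_intros simp del: power_Suc of_nat_Suc)
    then show ?thesis
      unfolding h_eq[abs_def] using f'(1) that
      by (auto intro!: derivative_eq_intros simp: mult.commute simp del: power_Suc of_nat_Suc)
  qed
  have "\<bar>h y\<bar> \<le> K * \<bar>y - t\<bar> ^ Suc n" if y: "y \<in> S" for y
  proof -
    have seg: "closed_segment t y \<subseteq> S" using S t y by (rule closed_segment_subset[rotated 2])
    have "norm (h y - h t) \<le> K * \<bar>y - t\<bar> ^ n * norm (y - t)"
    proof (rule field_differentiable_bound[of "closed_segment t y"])
      fix z assume z: "z \<in> closed_segment t y"
      then have "z \<in> S" using seg by blast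
      from dh[OF this] show "(h has_field_derivative f' z - (\<Sum>i<n. c' i * (z - t) ^ i)) (at z within closed_segment t y)"
        by (rule has_field_derivative_at_within)
      have "\<bar>z - t\<bar> \<le> \<bar>y - t\<bar>" using z by (auto simp: closed_segment_eq_real_ivl split: if_splits)
      then have "K * \<bar>z - t\<bar> ^ n \<le> K * \<bar>y - t\<bar> ^ n" using K by (intro mult_left_mono power_mono) auto
      with c'[OF \<open>z \<in> S\<close>] show "norm (f' z - (\<Sum>i<n. c' i * (z - t) ^ i)) \<le> K * \<bar>y - t\<bar> ^ n" by simp
    qed auto
    moreover have "h t = 0" by (simp add: h_eq)
    ultimately show ?thesis by (simp add: mult_ac)
  qed
  moreover have "c 0 = f t" by (simp add: c_def)
  ultimately show ?case unfolding h_def by blast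
qed auto

text \<open>The induction step applies the hypothesis to the two outer thirds of the interval and then the
  mean value theorem between the two points obtained.\<close>

lemma deriv_small_somewhere:
  "0 < \<delta> \<Longrightarrow> \<exists>C\<ge>0. \<forall>f a. (\<forall>t\<in>{a..a + \<delta>}. \<bar>f t\<bar> \<le> K) \<longrightarrow> (\<forall>i<j. \<forall>x. (deriv ^^ i) f differentiable (at x)) \<longrightarrow>
    (\<exists>\<xi>\<in>{a..a + \<delta>}. \<bar>(deriv ^^ j) f \<xi>\<bar> \<le> (C :: real))"
proof (induction j arbitrary: \<delta>)
  case 0
  show ?case
  proof (intro exI[of _ "\<bar>K\<bar>"] conjI allI impI abs_ge_zero)
    fix f :: "real \<Rightarrow> real" and a
    assume f: "\<forall>t\<in>{a..a + \<delta>}. \<bar>f t\<bar> \<le> K"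
    have a: "a \<in> {a..a + \<delta>}" using 0 by simp
    then have "\<bar>f a\<bar> \<le> \<bar>K\<bar>" using f by (meson abs_ge_self order_trans)
    then show "\<exists>\<xi>\<in>{a..a + \<delta>}. \<bar>(deriv ^^ 0) f \<xi>\<bar> \<le> \<bar>K\<bar>"
      using a unfolding funpow_0 by blast
  qed
next
  case (Suc j)
  then obtain C where C: "0 \<le> C" "\<And>f a. (\<forall>t\<in>{a..a + \<delta> / 3}. \<bar>f t\<bar> \<le> K) \<Longrightarrow> (\<forall>i<j. \<forall>x. (deriv ^^ i) f differentiable (at x)) \<Longrightarrow>
    (\<exists>\<xi>\<in>{a..a + \<delta> / 3}. \<bar>(deriv ^^ j) f \<xi>\<bar> \<le> C)"
    using Suc.IH[of "\<delta> / 3"] divide_pos_pos[OF Suc.prems zero_less_numeral] by blast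
  \<comment> \<open>The two points are at least \<open>\<delta> / 3\<close> apart and the values
    there differ by at most \<open>2 * C\<close>, so the difference quotient is at most
    \<open>6 * C / \<delta>\<close>.\<close>
  have "\<exists>\<xi>\<in>{a..a + \<delta>}. \<bar>(deriv ^^ Suc j) f \<xi>\<bar> \<le> 6 * C / \<delta>"
    if f: "\<forall>t\<in>{a..a + \<delta>}. \<bar>f t\<bar> \<le> K" and diff: "\<forall>i<Suc j. \<forall>x. (deriv ^^ i) f differentiable (at x)" for f a
  proof -
    let ?g = "(deriv ^^ j) f"
    have diff': "\<forall>i<j. \<forall>x. (deriv ^^ i) f differentiable (at x)" using diff by (meson less_SucI)
    have "{a..a + \<delta> / 3} \<subseteq> {a..a + \<delta>}" "{a + 2 * \<delta> / 3..a + 2 * \<delta> / 3 + \<delta> / 3} \<subseteq> {a..a + \<delta>}"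
      using \<open>0 < \<delta>\<close> by auto
    then have sub: "\<forall>t\<in>{a..a + \<delta> / 3}. \<bar>f t\<bar> \<le> K" "\<forall>t\<in>{a + 2 * \<delta> / 3..a + 2 * \<delta> / 3 + \<delta> / 3}. \<bar>f t\<bar> \<le> K"
      using f by blast+
    obtain u where u: "u \<in> {a..a + \<delta> / 3}" "\<bar>?g u\<bar> \<le> C"
      using C(2)[OF sub(1) diff'] by blast
    obtain v where v: "v \<in> {a + 2 * \<delta> / 3..a + 2 * \<delta> / 3 + \<delta> / 3}" "\<bar>?g v\<bar> \<le> C"
      using C(2)[OF sub(2) diff'] by blast
    have uv: "\<delta> / 3 \<le> v - u" "u < v" using u v \<open>0 < \<delta>\<close> by auto
    have "(?g has_real_derivative deriv ?g x) (at x)" for x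
      using diff by (intro DERIV_deriv_iff_real_differentiable[THEN iffD2]) blast
    then obtain z where z: "u < z" "z < v" "?g v - ?g u = (v - u) * deriv ?g z"
      using MVT2[OF uv(2), of ?g "deriv ?g"] by blast
    have "\<delta> / 3 * \<bar>deriv ?g z\<bar> \<le> (v - u) * \<bar>deriv ?g z\<bar>" using uv by (intro mult_right_mono) auto
    also have "\<dots> = \<bar>?g v - ?g u\<bar>" using z(3) uv by (simp add: abs_mult)
    also have "\<dots> \<le> 2 * C" using u v by linarith
    finally have "\<bar>deriv ?g z\<bar> \<le> 6 * C / \<delta>" using \<open>0 < \<delta>\<close> by (simp add: field_simps)
    moreover have "z \<in> {a..a + \<delta>}" using z u v by auto
    ultimately show ?thesis unfolding funpow.simps comp_def by blast
  qed
  moreover have "0 \<le> 6 * C / \<delta>" using C(1) \<open>0 < \<delta>\<close> by simp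
  ultimately show ?case by blast
qed

section \<open>Uniform derivative bounds over the class and the bias they give\<close>

lemma Theta_classD:
  assumes "\<theta> \<in> Theta_class j L L' T"
  shows "t \<in> {0..T} \<Longrightarrow> \<bar>\<theta> t\<bar> \<le> L"
    and "i < j \<Longrightarrow> (deriv ^^ i) \<theta> differentiable (at x)"
    and "\<bar>(deriv ^^ j) \<theta> x - (deriv ^^ j) \<theta> y\<bar> \<le> L' * \<bar>x - y\<bar>"
  using assms unfolding Theta_class_def by blast+

text \<open>The induction descends from the top derivative, \<open>m\<close> counting steps down.
  Each derivative is small at some point of \<open>[0,T]\<close> by
  \<open>deriv_small_somewhere\<close>; the Lipschitz condition at the top, and the bound on the
  next derivative below it, spread this to the whole interval.\<close>

lemma Theta_class_bounded_derivs:
  assumes T: "0 < T" and L': "0 \<le> L'"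
  shows "\<exists>C\<ge>0. \<forall>\<theta>\<in>Theta_class j L L' T. bounded_derivs {0<..<T} j C \<theta>"
proof -
  have "\<exists>C\<ge>0. \<forall>\<theta>\<in>Theta_class j L L' T. (\<forall>t\<in>{0..T}. \<bar>(deriv ^^ (j - m)) \<theta> t\<bar> \<le> C) \<and>
      bounded_derivs {0<..<T} m C ((deriv ^^ (j - m)) \<theta>)" if "m \<le> j" for m
    using that
  proof (induction m)
    case 0
    obtain C where C: "0 \<le> C" "\<And>f a. (\<forall>t\<in>{a..a + T}. \<bar>f t\<bar> \<le> L) \<Longrightarrow> (\<forall>i<j. \<forall>x. (deriv ^^ i) f differentiable (at x)) \<Longrightarrow>
      (\<exists>\<xi>\<in>{a..a + T}. \<bar>(deriv ^^ j) f \<xi>\<bar> \<le> C)"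
      using deriv_small_somewhere[OF T, of L j] by blast
    have "\<bar>(deriv ^^ j) \<theta> t\<bar> \<le> C + L' * T" if \<theta>: "\<theta> \<in> Theta_class j L L' T" and t: "t \<in> {0..T}" for \<theta> t
    proof -
      obtain \<xi> where \<xi>: "\<xi> \<in> {0..T}" "\<bar>(deriv ^^ j) \<theta> \<xi>\<bar> \<le> C"
        using C(2)[of 0 \<theta>] Theta_classD(1,2)[OF \<theta>] by (simp only: add_0) blast
      have "\<bar>(deriv ^^ j) \<theta> t - (deriv ^^ j) \<theta> \<xi>\<bar> \<le> L' * \<bar>t - \<xi>\<bar>"
        by (rule Theta_classD(3)[OF \<theta>])
      also have "\<dots> \<le> L' * T" using t \<xi> L' by (intro mult_left_mono) auto
      finally show ?thesis using \<xi>(2) by linarith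
    qed
    moreover from this have "bounded_derivs {0<..<T} 0 (C + L' * T) ((deriv ^^ j) \<theta>)"
      if "\<theta> \<in> Theta_class j L L' T" for \<theta>
      using that by simp
    moreover have "0 \<le> C + L' * T" using C(1) L' T by simp
    ultimately show ?case by (simp only: diff_zero) blast
  next
    case (Suc m)
    define i where "i = j - Suc m"
    have ji: "j - m = Suc i" "i < j" using Suc.prems by (auto simp: i_def)
    obtain D where D: "0 \<le> D" "\<And>\<theta> t. \<theta> \<in> Theta_class j L L' T \<Longrightarrow> t \<in> {0..T} \<Longrightarrow> \<bar>deriv ((deriv ^^ i) \<theta>) t\<bar> \<le> D"
      "\<And>\<theta>. \<theta> \<in> Theta_class j L L' T \<Longrightarrow> bounded_derivs {0<..<T} m D (deriv ((deriv ^^ i) \<theta>))"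
      using Suc.IH[OF Suc_leD[OF Suc.prems]] unfolding ji(1) funpow.simps comp_def by blast
    obtain C where C: "0 \<le> C" "\<And>f a. (\<forall>t\<in>{a..a + T}. \<bar>f t\<bar> \<le> L) \<Longrightarrow> (\<forall>l<i. \<forall>x. (deriv ^^ l) f differentiable (at x)) \<Longrightarrow>
      (\<exists>\<xi>\<in>{a..a + T}. \<bar>(deriv ^^ i) f \<xi>\<bar> \<le> C)"
      using deriv_small_somewhere[OF T, of L i] by blast
    \<comment> \<open>\<open>C + D * T\<close> bounds this derivative; the further \<open>D\<close>
      lets the same constant dominate all higher ones.\<close>
    have "(\<forall>t\<in>{0..T}. \<bar>(deriv ^^ i) \<theta> t\<bar> \<le> C + D * T + D) \<and> bounded_derivs {0<..<T} (Suc m) (C + D * T + D) ((deriv ^^ i) \<theta>)"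
      if \<theta>: "\<theta> \<in> Theta_class j L L' T" for \<theta>
    proof -
      let ?g = "(deriv ^^ i) \<theta>"
      have diff: "(?g has_real_derivative deriv ?g x) (at x)" for x
        using Theta_classD(2)[OF \<theta> ji(2)] by (rule DERIV_deriv_iff_real_differentiable[THEN iffD2])
      obtain \<xi> where \<xi>: "\<xi> \<in> {0..T}" "\<bar>?g \<xi>\<bar> \<le> C"
        using C(2)[of 0 \<theta>] Theta_classD(1,2)[OF \<theta>] ji(2) by (simp only: add_0) (meson less_trans)
      have bd: "\<bar>?g t\<bar> \<le> C + D * T + D" if t: "t \<in> {0..T}" for t
      proof -
        have "norm (?g t - ?g \<xi>) \<le> D * norm (t - \<xi>)"
          by (rule field_differentiable_bound[of "{0..T}" ?g "deriv ?g"])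
            (use t \<xi> D(2)[OF \<theta>] diff in \<open>auto intro: has_field_derivative_at_within\<close>)
        also have "\<dots> \<le> D * T" using t \<xi> D(1) by (intro mult_left_mono) auto
        finally show ?thesis using \<xi>(2) D(1) by simp
      qed
      moreover have "bounded_derivs {0<..<T} m (C + D * T + D) (deriv ?g)"
        using C(1) D(1) T by (intro bounded_derivs_mono[OF _ D(3)[OF \<theta>]]) simp
      then have "bounded_derivs {0<..<T} (Suc m) (C + D * T + D) ?g"
        by (intro bounded_derivs_SucI[OF _ diff]) (use bd in simp)
      ultimately show ?thesis by blast
    qed
    moreover have "0 \<le> C + D * T + D" using C(1) D(1) T by simp
    ultimately show ?case unfolding i_def[symmetric] by blast
  qed
  from this[of j] show ?thesis by (simp only: diff_self_eq_0 funpow_0 order_refl) blast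
qed

lemma Theta_class_continuous_on:
  assumes "\<theta> \<in> Theta_class (Suc j) L L' T"
  shows "continuous_on S \<theta>"
proof -
  have "\<theta> differentiable (at x)" for x
    using Theta_classD(2)[OF assms, of 0] by simp
  then show ?thesis
    by (intro continuous_at_imp_continuous_on) (auto intro: differentiable_imp_continuous_within)
qed

text \<open>The equation \<open>x' = \<theta> x\<close> gains one order: bounds of order
  \<open>n\<close> on \<theta> and \<open>x\<close> give them for the product, which is the
  derivative of \<open>x\<close>.\<close>

lemma unperturbed_bounded_derivs:
  assumes L: "0 \<le> L" and K: "0 \<le> K"
  shows "\<exists>C\<ge>0. \<forall>\<theta>. continuous_on {0..T} \<theta> \<longrightarrow> (\<forall>t\<in>{0..T}. \<bar>\<theta> t\<bar> \<le> L) \<longrightarrow> bounded_derivs {0<..<T} n K \<theta> \<longrightarrow>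
    bounded_derivs {0<..<T} n C (unperturbed x0 \<theta>)"
proof (induction n)
  case 0
  have "bounded_derivs {0<..<T} 0 (\<bar>x0\<bar> * exp (L * T)) (unperturbed x0 \<theta>)"
    if "continuous_on {0..T} \<theta>" "\<forall>t\<in>{0..T}. \<bar>\<theta> t\<bar> \<le> L" for \<theta>
    using abs_unperturbed_le[OF that(1), of L] that(2) by auto
  then show ?case by (intro exI[of _ "\<bar>x0\<bar> * exp (L * T)"] conjI) (simp, blast)
next
  case (Suc n)
  then obtain C where C: "0 \<le> C" "\<And>\<theta>. continuous_on {0..T} \<theta> \<Longrightarrow> (\<forall>t\<in>{0..T}. \<bar>\<theta> t\<bar> \<le> L) \<Longrightarrow>
    bounded_derivs {0<..<T} n K \<theta> \<Longrightarrow> bounded_derivs {0<..<T} n C (unperturbed x0 \<theta>)" by blast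
  define C' where "C' = max C (2 ^ n * (K * C))"
  have "bounded_derivs {0<..<T} (Suc n) C' (unperturbed x0 \<theta>)"
    if \<theta>: "continuous_on {0..T} \<theta>" "\<forall>t\<in>{0..T}. \<bar>\<theta> t\<bar> \<le> L" "bounded_derivs {0<..<T} (Suc n) K \<theta>" for \<theta>
  proof -
    have n: "bounded_derivs {0<..<T} n K \<theta>" using \<theta>(3) by (rule bounded_derivs_SucD)
    note x = C(2)[OF \<theta>(1,2) n]
    have "bounded_derivs {0<..<T} n C' (\<lambda>t. \<theta> t * unperturbed x0 \<theta> t)"
      by (rule bounded_derivs_mono[OF _ bounded_derivs_mult[OF K C(1) n x]]) (simp add: C'_def)
    moreover have "(unperturbed x0 \<theta> has_real_derivative \<theta> t * unperturbed x0 \<theta> t) (at t)" if "t \<in> {0<..<T}" for t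
      using unperturbed_has_derivative[OF \<theta>(1), of t x0] that by (simp add: at_within_interior[of t "{0..T}"])
    moreover have "\<bar>unperturbed x0 \<theta> t\<bar> \<le> C'" if "t \<in> {0<..<T}" for t
      using bounded_derivs_bound[OF x that] by (simp add: C'_def)
    ultimately show ?thesis by (intro bounded_derivs_SucI)
  qed
  moreover have "0 \<le> C'" using C(1) by (simp add: C'_def)
  ultimately show ?case by blast
qed

lemma Theta_class_signal_bounded_derivs:
  assumes T: "0 < T" and L: "0 \<le> L" and L': "0 \<le> L'"
  shows "\<exists>C\<ge>0. \<forall>\<theta>\<in>Theta_class (Suc j) L L' T. bounded_derivs {0<..<T} (Suc j) C (\<lambda>t. \<theta> t * unperturbed x0 \<theta> t)"
proof -
  obtain K where K: "0 \<le> K" "\<And>\<theta>. \<theta> \<in> Theta_class (Suc j) L L' T \<Longrightarrow> bounded_derivs {0<..<T} (Suc j) K \<theta>"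
    using Theta_class_bounded_derivs[OF T L', of "Suc j" L] by blast
  obtain C where C: "0 \<le> C" "\<And>\<theta>. continuous_on {0..T} \<theta> \<Longrightarrow> (\<forall>t\<in>{0..T}. \<bar>\<theta> t\<bar> \<le> L) \<Longrightarrow>
      bounded_derivs {0<..<T} (Suc j) K \<theta> \<Longrightarrow> bounded_derivs {0<..<T} (Suc j) C (unperturbed x0 \<theta>)"
    using unperturbed_bounded_derivs[OF L K(1), of T "Suc j" x0] by blast
  have "bounded_derivs {0<..<T} (Suc j) (2 ^ Suc j * (K * C)) (\<lambda>t. \<theta> t * unperturbed x0 \<theta> t)"
    if \<theta>: "\<theta> \<in> Theta_class (Suc j) L L' T" for \<theta>
  proof (rule bounded_derivs_mult[OF K(1) C(1) K(2)[OF \<theta>]])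
    have "\<forall>t\<in>{0..T}. \<bar>\<theta> t\<bar> \<le> L" using Theta_classD(1)[OF \<theta>] by blast
    then show "bounded_derivs {0<..<T} (Suc j) C (unperturbed x0 \<theta>)"
      using Theta_class_continuous_on[OF \<theta>] K(2)[OF \<theta>] by (intro C(2)) auto
  qed
  moreover have "0 \<le> 2 ^ Suc j * (K * C)" using K C by simp
  ultimately show ?thesis by blast
qed

text \<open>After substituting \<open>\<tau> = t + \<phi> * u\<close> the whole support
  \<open>[A,B]\<close> is seen, because the hypotheses on \<phi> keep \<open>\<tau>\<close> inside
  \<open>(0,T)\<close>. Normalisation and vanishing moments reproduce \<open>g t\<close> from the
  Taylor polynomial, leaving a remainder of order
  \<open>\<bar>\<phi> * u\<bar> ^ (k + 1)\<close>.\<close>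

lemma kernel_bias_le:
  fixes G g :: "real \<Rightarrow> real"
  assumes G: "G \<in> borel_measurable borel" "\<And>u. \<bar>G u\<bar> \<le> B0"
    and AB: "A < 0" "0 < B" "\<And>u. u < A \<or> u > B \<Longrightarrow> G u = 0" "(LINT u:{A..B}|lborel. G u) = 1"
    and A3: "kernel_A3 k G"
    and \<phi>: "0 < \<phi>" "0 < t + \<phi> * A" "t + \<phi> * B < T"
    and g: "bounded_derivs {0<..<T} (Suc k) K g" and K: "0 \<le> K"
  shows "\<bar>(1 / \<phi>) * (LINT \<tau>:{0..T}|lborel. G ((\<tau> - t) / \<phi>) * g \<tau>) - g t\<bar>
    \<le> B0 * (K * max (- A) B ^ Suc k) * (B - A) * \<phi> ^ Suc k"
proof -
  note [measurable] = G(1)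
  let ?I = "{0<..<T}" and ?J = "{A..B}"
  have J: "t + \<phi> * u \<in> ?I" if "u \<in> ?J" for u
  proof -
    have "\<phi> * A \<le> \<phi> * u" "\<phi> * u \<le> \<phi> * B" using that \<phi> by auto
    then show ?thesis
      unfolding greaterThanLessThan_iff using \<phi>(2,3) by linarith
  qed
  have t: "t \<in> ?I" using J[of 0] AB by simp
  obtain c where c: "c 0 = g t" "\<And>y. y \<in> ?I \<Longrightarrow> \<bar>g y - (\<Sum>i<Suc k. c i * (y - t) ^ i)\<bar> \<le> K * \<bar>y - t\<bar> ^ Suc k"
    using bounded_derivs_Taylor[OF _ t g] by auto
  have B0: "0 \<le> B0" using G(2)[of 0] by linarith
  have cont: "continuous_on ?J (\<lambda>u. g (t + \<phi> * u))"
  proof -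
    from g obtain g' where g': "\<And>t. t \<in> ?I \<Longrightarrow> (g has_real_derivative g' t) (at t)"
      by (rule bounded_derivs_SucE) blast
    have "continuous_on ?I g"
      by (intro continuous_at_imp_continuous_on ballI DERIV_isCont[OF g'])
    then show ?thesis
      by (rule continuous_on_compose2) (use J in \<open>auto intro!: continuous_intros\<close>)
  qed
  have Gq_int: "set_integrable lborel ?J (\<lambda>u. G u * q u)" if q: "continuous_on ?J q" for q
  proof -
    have "bounded (q ` ?J)" by (intro compact_imp_bounded compact_continuous_image q compact_Icc)
    then obtain Q where Q: "\<And>u. u \<in> ?J \<Longrightarrow> norm (q u) \<le> Q" unfolding bounded_iff by blast
    show ?thesis
    proof (rule set_integrable_bounded_Icc)
      have "(\<lambda>u. indicator ?J u * q u) \<in> borel_measurable borel"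
        using borel_measurable_continuous_on_indicator[OF _ q] by simp
      then have "(\<lambda>u. G u * (indicator ?J u * q u)) \<in> borel_measurable borel" by measurable
      then show "(\<lambda>u. indicator ?J u * (G u * q u)) \<in> borel_measurable borel" by (simp add: mult_ac)
      show "\<bar>G u * q u\<bar> \<le> B0 * Q" if "u \<in> ?J" for u
        unfolding abs_mult using G(2) Q[OF that] B0 by (intro mult_mono) auto
    qed
  qed
  have "(LINT \<tau>:{0..T}|lborel. G ((\<tau> - t) / \<phi>) * g \<tau>)
      = \<bar>\<phi>\<bar> *\<^sub>R (LINT u|lborel. indicator {0..T} (t + \<phi> * u) *\<^sub>R (G ((t + \<phi> * u - t) / \<phi>) * g (t + \<phi> * u)))"
    unfolding set_lebesgue_integral_def using \<phi>(1) by (intro lborel_integral_real_affine) simp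
  also have "(LINT u|lborel. indicator {0..T} (t + \<phi> * u) *\<^sub>R (G ((t + \<phi> * u - t) / \<phi>) * g (t + \<phi> * u)))
      = (LINT u:?J|lborel. G u * g (t + \<phi> * u))"
    unfolding set_lebesgue_integral_def
  proof (intro Bochner_Integration.integral_cong refl)
    fix u :: real
    show "indicator {0..T} (t + \<phi> * u) *\<^sub>R (G ((t + \<phi> * u - t) / \<phi>) * g (t + \<phi> * u)) = indicator ?J u *\<^sub>R (G u * g (t + \<phi> * u))"
    proof (cases "u \<in> ?J")
      case True
      then show ?thesis using J[OF True] \<phi>(1) by simp
    next
      case False
      then have "G u = 0" by (intro AB(3)) auto
      then show ?thesis using \<phi>(1) by simp
    qed
  qed
  finally have cov: "(1 / \<phi>) * (LINT \<tau>:{0..T}|lborel. G ((\<tau> - t) / \<phi>) * g \<tau>) = (LINT u:?J|lborel. G u * g (t + \<phi> * u))"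
    using \<phi>(1) by simp
  define P where "P u = (\<Sum>i<Suc k. c i * \<phi> ^ i * u ^ i)" for u
  have P_cont: "continuous_on ?J P" unfolding P_def by (intro continuous_intros)
  have moment: "(LINT u:?J|lborel. G u * u ^ i) = (if i = 0 then 1 else 0)" if "i < Suc k" for i
  proof (cases "i = 0")
    case True
    then show ?thesis using AB(4) by simp
  next
    case False
    have "(LINT u:?J|lborel. G u * u ^ i) = (LINT u|lborel. u ^ i * G u)"
      unfolding set_lebesgue_integral_def
      by (intro Bochner_Integration.integral_cong refl) (use AB(3) in \<open>auto simp: indicator_def\<close>)
    then show ?thesis using A3 False that by (auto simp: kernel_A3_def)
  qed
  have "(LINT u:?J|lborel. G u * P u) = (LINT u:?J|lborel. (\<Sum>i<Suc k. c i * \<phi> ^ i * (G u * u ^ i)))"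
    unfolding P_def sum_distrib_left by (simp only: mult_ac)
  also have "\<dots> = (\<Sum>i<Suc k. LINT u:?J|lborel. c i * \<phi> ^ i * (G u * u ^ i))"
    unfolding set_lebesgue_integral_def scaleR_sum_right
    by (intro Bochner_Integration.integral_sum,
        fold set_integrable_def, intro set_integrable_mult_right Gq_int continuous_intros)
  also have "\<dots> = (\<Sum>i<Suc k. if i = 0 then c 0 else 0)"
    by (intro sum.cong refl) (auto simp: moment)
  also have "\<dots> = g t" by (simp add: c(1))
  finally have P_int: "(LINT u:?J|lborel. G u * P u) = g t" .
  have diff_int: "set_integrable lborel ?J (\<lambda>u. G u * (g (t + \<phi> * u) - P u))"
    by (intro Gq_int continuous_intros cont P_cont)
  have "(LINT u:?J|lborel. G u * g (t + \<phi> * u)) - g t = (LINT u:?J|lborel. G u * g (t + \<phi> * u)) - (LINT u:?J|lborel. G u * P u)"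
    by (simp add: P_int)
  also have "\<dots> = (LINT u:?J|lborel. G u * (g (t + \<phi> * u) - P u))"
    unfolding right_diff_distrib by (intro set_integral_diff(2)[symmetric] Gq_int cont P_cont)
  also have "\<bar>\<dots>\<bar> \<le> (LINT u:?J|lborel. \<bar>G u * (g (t + \<phi> * u) - P u)\<bar>)"
    using set_integral_norm_bound[OF diff_int] by simp
  also have "\<dots> \<le> (LINT u:?J|lborel. B0 * (K * max (- A) B ^ Suc k * \<phi> ^ Suc k))"
  proof (intro set_integral_mono set_integrable_abs diff_int)
    show "set_integrable lborel ?J (\<lambda>u. B0 * (K * max (- A) B ^ Suc k * \<phi> ^ Suc k))"
      by (intro borel_integrable_atLeastAtMost' continuous_intros)
    fix u assume u: "u \<in> ?J"
    have "\<bar>g (t + \<phi> * u) - P u\<bar> \<le> K * \<bar>\<phi> * u\<bar> ^ Suc k"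
      using c(2)[OF J[OF u]] by (simp add: P_def power_mult_distrib mult_ac)
    also have "\<dots> \<le> K * (\<phi> * max (- A) B) ^ Suc k"
      using u \<phi>(1) K by (intro mult_left_mono power_mono) (auto simp: abs_mult)
    finally have "\<bar>G u\<bar> * \<bar>g (t + \<phi> * u) - P u\<bar> \<le> B0 * (K * (\<phi> * max (- A) B) ^ Suc k)"
      using G(2) B0 by (intro mult_mono) auto
    then show "\<bar>G u * (g (t + \<phi> * u) - P u)\<bar> \<le> B0 * (K * max (- A) B ^ Suc k * \<phi> ^ Suc k)"
      unfolding power_mult_distrib abs_mult by (simp only: mult_ac)
  qed
  also have "\<dots> = B0 * (K * max (- A) B ^ Suc k) * (B - A) * \<phi> ^ Suc k"
    using AB by (simp add: set_lebesgue_integral_def mult_ac)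
  finally show ?thesis unfolding cov .
qed

section \<open>Rate of convergence\<close>

text \<open>The rescaled kernel lives on an interval of length \<open>\<phi> * (B - A)\<close>. The
  cases \<open>r = 1\<close> and \<open>r = \<alpha>\<close> supply the two norms in the error
  bound.\<close>

lemma nn_integral_kernel_powr_le:
  fixes G :: "real \<Rightarrow> real"
  assumes G: "\<And>u. \<bar>G u\<bar> \<le> B0" and AB: "A < B" "\<And>u. u < A \<or> u > B \<Longrightarrow> G u = 0"
    and \<phi>: "0 < \<phi>" and r: "0 < r"
  shows "(\<integral>\<^sup>+\<tau>\<in>S. ennreal (\<bar>G ((\<tau> - t) / \<phi>)\<bar> powr r) \<partial>lborel) \<le> ennreal (B0 powr r * (B - A) * \<phi>)"
proof -
  have "(\<integral>\<^sup>+\<tau>\<in>S. ennreal (\<bar>G ((\<tau> - t) / \<phi>)\<bar> powr r) \<partial>lborel)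
      \<le> (\<integral>\<^sup>+\<tau>. ennreal (B0 powr r) * indicator {t + \<phi> * A..t + \<phi> * B} \<tau> \<partial>lborel)"
  proof (intro nn_integral_mono)
    fix \<tau> :: real
    show "ennreal (\<bar>G ((\<tau> - t) / \<phi>)\<bar> powr r) * indicator S \<tau> \<le> ennreal (B0 powr r) * indicator {t + \<phi> * A..t + \<phi> * B} \<tau>"
    proof (cases "\<tau> \<in> {t + \<phi> * A..t + \<phi> * B}")
      case True
      have "\<bar>G ((\<tau> - t) / \<phi>)\<bar> powr r \<le> B0 powr r" using G r by (intro powr_mono2) auto
      then show ?thesis using True by (auto simp: indicator_def intro!: ennreal_leI)
    next
      case False
      then have "G ((\<tau> - t) / \<phi>) = 0"
        using \<phi> by (intro AB(2)) (auto simp: field_simps)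
      then show ?thesis by simp
    qed
  qed
  also have "\<dots> = ennreal (B0 powr r) * ennreal (\<phi> * B - \<phi> * A)"
    using \<phi> AB(1) by (subst nn_integral_cmult_indicator) auto
  also have "\<dots> = ennreal (B0 powr r * (B - A) * \<phi>)"
    using \<phi> AB(1) by (simp add: ennreal_mult[symmetric] algebra_simps)
  finally show ?thesis .
qed

text \<open>The error bound with \<open>\<eta> = \<phi> ^ (k + 2)\<close> and
  \<open>R = \<phi> powr (- (1 / \<alpha>))\<close>. This \<open>R\<close> equalises the two noise
  contributions, as \<open>\<phi> * R powr (\<alpha> - 1)\<close> and \<open>1 / R\<close> are both
  \<open>\<phi> powr (1 / \<alpha>)\<close>. Multiplied by \<epsilon> this is
  \<open>\<phi> ^ (k + 2)\<close>, and the prefactor \<open>1 / \<phi>\<close> lowers it to the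
  claimed power.\<close>

lemma bandwidth_balance:
  fixes \<phi> \<alpha> \<epsilon> :: real
  assumes \<phi>: "0 < \<phi>" "\<phi> \<le> 1" and \<alpha>: "1 < \<alpha>" and \<epsilon>: "\<epsilon> = \<phi> powr (real k - 1 / \<alpha> + 2)"
    and C: "0 \<le> C1" "0 \<le> C2" "0 \<le> c1" "0 \<le> C3" "0 \<le> p" "0 \<le> g1" "0 \<le> g2"
  shows "(1 / \<phi>) * (\<epsilon> * C1 * (g1 * \<phi> + \<phi> ^ (k + 2)) + C2 * \<phi> ^ (k + 2)
      + \<epsilon> * (c1 * (C3 * (p * (g2 * \<phi> + \<phi> ^ (k + 2))) * (\<phi> powr (- (1 / \<alpha>))) powr (\<alpha> - 1) / (\<alpha> - 1)
          + 2 / \<phi> powr (- (1 / \<alpha>)))))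
    \<le> (C1 * (g1 + 1) + C2 + c1 * (C3 * (p * (g2 + 1)) / (\<alpha> - 1) + 2)) * \<phi> ^ Suc k"
proof -
  have pow: "\<phi> powr real n = \<phi> ^ n" for n using \<phi> by (simp add: powr_realpow)
  have \<epsilon>0: "0 \<le> \<epsilon>" by (simp add: \<epsilon>)
  \<comment> \<open>The exponent exceeds \<open>k + 1\<close> because
    \<open>1 / \<alpha> < 1\<close>, so for \<open>\<phi> \<le> 1\<close> the drift part, of order
    \<epsilon>, is absorbed by the main rate.\<close>
  have "\<phi> powr (real k - 1 / \<alpha> + 2) \<le> \<phi> powr real (Suc k)"
    using \<phi> \<alpha> by (intro powr_mono') (auto simp: field_simps)
  then have \<epsilon>_le: "\<epsilon> \<le> \<phi> ^ Suc k" unfolding \<epsilon> pow .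
  have "\<phi> ^ (k + 2) = \<phi> * \<phi> ^ Suc k" by simp
  also have "\<dots> \<le> \<phi> * 1" using \<phi> by (intro mult_left_mono power_le_one) auto
  finally have \<eta>_le: "\<phi> ^ (k + 2) \<le> \<phi>" by simp
  have "\<epsilon> * \<phi> powr (1 / \<alpha>) = \<phi> powr real (k + 2)"
    unfolding \<epsilon> by (simp add: powr_add[symmetric] add.commute)
  then have \<epsilon>_eq: "\<epsilon> * \<phi> powr (1 / \<alpha>) = \<phi> * \<phi> ^ Suc k" unfolding pow by simp
  have R_eq: "\<phi> * (\<phi> powr (- (1 / \<alpha>))) powr (\<alpha> - 1) = \<phi> powr (1 / \<alpha>)"
  proof -
    have "\<phi> * (\<phi> powr (- (1 / \<alpha>))) powr (\<alpha> - 1) = \<phi> powr 1 * \<phi> powr (- (1 / \<alpha>) * (\<alpha> - 1))"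
      using \<phi> by (simp add: powr_powr)
    also have "\<dots> = \<phi> powr (1 + - (1 / \<alpha>) * (\<alpha> - 1))" by (rule powr_add[symmetric])
    also have "1 + - (1 / \<alpha>) * (\<alpha> - 1) = 1 / \<alpha>" using \<alpha> by (simp add: field_simps)
    finally show ?thesis .
  qed
  have inv_eq: "2 / \<phi> powr (- (1 / \<alpha>)) = 2 * \<phi> powr (1 / \<alpha>)"
    by (simp add: powr_minus divide_inverse)
  have 1: "\<epsilon> * C1 * (g1 * \<phi> + \<phi> ^ (k + 2)) \<le> \<phi> ^ Suc k * C1 * ((g1 + 1) * \<phi>)"
    using \<epsilon>_le \<eta>_le \<phi> C \<epsilon>0 by (intro mult_mono mult_right_mono) (auto simp: distrib_right)
  have "g2 * \<phi> + \<phi> ^ (k + 2) \<le> (g2 + 1) * \<phi>" using \<eta>_le by (simp add: distrib_right)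
  then have "\<epsilon> * (c1 * (C3 * (p * (g2 * \<phi> + \<phi> ^ (k + 2))) * (\<phi> powr (- (1 / \<alpha>))) powr (\<alpha> - 1) / (\<alpha> - 1)
      + 2 / \<phi> powr (- (1 / \<alpha>))))
    \<le> \<epsilon> * (c1 * (C3 * (p * ((g2 + 1) * \<phi>)) * (\<phi> powr (- (1 / \<alpha>))) powr (\<alpha> - 1) / (\<alpha> - 1) + 2 / \<phi> powr (- (1 / \<alpha>))))"
    using \<epsilon>0 C \<alpha> by (intro mult_left_mono mult_right_mono add_right_mono divide_right_mono) auto
  also have "\<dots> = \<epsilon> * (c1 * (C3 * (p * (g2 + 1)) * (\<phi> * (\<phi> powr (- (1 / \<alpha>))) powr (\<alpha> - 1)) / (\<alpha> - 1) + 2 / \<phi> powr (- (1 / \<alpha>))))"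
    by (simp only: mult_ac)
  also have "\<dots> = c1 * (C3 * (p * (g2 + 1)) / (\<alpha> - 1) + 2) * (\<epsilon> * \<phi> powr (1 / \<alpha>))"
    unfolding R_eq inv_eq by (simp add: algebra_simps)
  also have "\<dots> = c1 * (C3 * (p * (g2 + 1)) / (\<alpha> - 1) + 2) * (\<phi> * \<phi> ^ Suc k)" by (simp only: \<epsilon>_eq)
  finally have 3: "\<epsilon> * (c1 * (C3 * (p * (g2 * \<phi> + \<phi> ^ (k + 2))) * (\<phi> powr (- (1 / \<alpha>))) powr (\<alpha> - 1) / (\<alpha> - 1)
      + 2 / \<phi> powr (- (1 / \<alpha>)))) \<le> \<dots>" .
  have "(1 / \<phi>) * (\<epsilon> * C1 * (g1 * \<phi> + \<phi> ^ (k + 2)) + C2 * \<phi> ^ (k + 2)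
      + \<epsilon> * (c1 * (C3 * (p * (g2 * \<phi> + \<phi> ^ (k + 2))) * (\<phi> powr (- (1 / \<alpha>))) powr (\<alpha> - 1) / (\<alpha> - 1)
          + 2 / \<phi> powr (- (1 / \<alpha>)))))
    \<le> (1 / \<phi>) * (\<phi> ^ Suc k * C1 * ((g1 + 1) * \<phi>) + C2 * (\<phi> * \<phi> ^ Suc k)
      + c1 * (C3 * (p * (g2 + 1)) / (\<alpha> - 1) + 2) * (\<phi> * \<phi> ^ Suc k))"
    using 1 3 \<phi>(1) C(2) by (intro mult_left_mono add_mono) auto
  also have "\<dots> = (1 / \<phi>) * (\<phi> * ((C1 * (g1 + 1) + C2 + c1 * (C3 * (p * (g2 + 1)) / (\<alpha> - 1) + 2)) * \<phi> ^ Suc k))"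
    by (simp only: distrib_left distrib_right mult_ac)
  also have "\<dots> = (C1 * (g1 + 1) + C2 + c1 * (C3 * (p * (g2 + 1)) / (\<alpha> - 1) + 2)) * \<phi> ^ Suc k"
    using \<phi> by simp
  finally show ?thesis .
qed

theorem theorem4p2:
  fixes M :: "'a measure" and F :: "real \<Rightarrow> 'a measure"
    and Z :: "real \<Rightarrow> 'a \<Rightarrow> real"
    and X D :: "(real \<Rightarrow> real) \<Rightarrow> real \<Rightarrow> real \<Rightarrow> 'a \<Rightarrow> real"
    and G :: "real \<Rightarrow> real" and k :: nat
    and \<alpha> \<beta> T x0 L L' c d :: real
  assumes "prob_space M"
    and "right_continuous_filtration M F"
    and "1 < \<alpha>" and "\<alpha> < 2" and "-1 \<le> \<beta>" and "\<beta> \<le> 1"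
    and "stable_Levy_process M F \<alpha> \<beta> Z"
    and "0 < T" and "0 < L" and "0 < L'"
    and "kernel_A2 G" and "kernel_A3 k G"
    and X: "\<And>\<theta> \<epsilon>. \<theta> \<in> Theta_class (k + 1) L L' T \<Longrightarrow> 0 < \<epsilon> \<Longrightarrow>
              solves_linear_SDE M F Z T x0 \<theta> \<epsilon> (X \<theta> \<epsilon>)"
    and D: "\<And>\<theta> \<epsilon> t. \<theta> \<in> Theta_class (k + 1) L L' T \<Longrightarrow> 0 < \<epsilon> \<Longrightarrow> t \<in> {0..T} \<Longrightarrow>
              is_kernel_estimator M \<alpha> T G (bandwidth k \<alpha> \<epsilon>) (X \<theta> \<epsilon>) t (D \<theta> \<epsilon> t)"
    and "0 < c" and "c \<le> d" and "d < T"
  shows "Limsup (at_right 0) (\<lambda>\<epsilon>.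
           SUP \<theta> \<in> Theta_class (k + 1) L L' T. SUP t \<in> {c..d}.
             (\<integral>\<^sup>+\<omega>. ennreal \<bar>D \<theta> \<epsilon> t \<omega> - \<theta> t * unperturbed x0 \<theta> t\<bar> \<partial>M)
               * ennreal (\<epsilon> powr (- (real (k + 1) / (real k - 1 / \<alpha> + 2))))) < (\<infinity> :: ennreal)"
proof -
  interpret prob_space M by fact
  note \<alpha> = \<open>1 < \<alpha>\<close> and T = \<open>0 < T\<close> and L = \<open>0 < L\<close>
  define q where "q = real k - 1 / \<alpha> + 2"
  have q: "0 < q"
  proof -
    have "1 / \<alpha> < 1" using \<alpha> by simp
    then show ?thesis by (simp add: q_def)
  qed
  have G_meas: "G \<in> borel_measurable borel" using \<open>kernel_A2 G\<close> by (simp add: kernel_A2_def)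
  obtain A B where AB: "A < 0" "0 < B" "\<And>u. u < A \<or> u > B \<Longrightarrow> G u = 0" "(LINT u:{A..B}|lborel. G u) = 1"
    using \<open>kernel_A2 G\<close> unfolding kernel_A2_def by blast
  obtain B0 where B0: "\<And>u. \<bar>G u\<bar> \<le> B0"
    using \<open>kernel_A2 G\<close> unfolding kernel_A2_def bounded_iff by auto
  obtain K where K: "0 \<le> K" "\<And>t. t \<in> {0..T} \<Longrightarrow> (\<integral>\<^sup>+\<omega>. ennreal \<bar>Z t \<omega>\<bar> \<partial>M) \<le> ennreal K"
    using stable_Levy_first_moment_bound[OF \<open>stable_Levy_process M F \<alpha> \<beta> Z\<close> \<alpha>, of T] by blast
  obtain Cg where Cg: "0 \<le> Cg" "\<And>\<theta>. \<theta> \<in> Theta_class (Suc k) L L' T \<Longrightarrow>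
      bounded_derivs {0<..<T} (Suc k) Cg (\<lambda>t. \<theta> t * unperturbed x0 \<theta> t)"
    using Theta_class_signal_bounded_derivs[OF T, of L L' k x0] L \<open>0 < L'\<close> by (meson less_imp_le)
  define C1 where "C1 = L * K * (1 + L * exp (L * T) * T)"
  define C2 where "C2 = L * (\<bar>x0\<bar> * exp (L * T))"
  define c1 where "c1 = 4 / (1 - cos (1 :: real))"
  define C3 where "C3 = 1 + \<bar>tan (\<alpha> * pi / 2)\<bar>"
  define g1 where "g1 = B0 * (B - A)"
  define g2 where "g2 = B0 powr \<alpha> * (B - A)"
  define Cnoise where "Cnoise = C1 * (g1 + 1) + C2 + c1 * (C3 * (2 powr \<alpha> * (g2 + 1)) / (\<alpha> - 1) + 2)"
  define Cbias where "Cbias = B0 * (Cg * max (- A) B ^ Suc k) * (B - A)"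
  have B0_nonneg: "0 \<le> B0" using B0[of 0] by linarith
  have const_nonneg: "0 \<le> C1" "0 \<le> C2" "0 \<le> c1" "0 \<le> C3" "0 \<le> g1" "0 \<le> g2"
    using L K(1) T one_minus_cos_1_pos B0_nonneg AB(1,2)
    by (simp_all add: C1_def C2_def c1_def C3_def g1_def g2_def)
  have nonneg: "0 \<le> Cnoise" "0 \<le> Cbias"
    using const_nonneg \<alpha> AB(1,2) Cg(1) B0_nonneg by (simp_all add: Cnoise_def Cbias_def)
  \<comment> \<open>A bandwidth below \<open>m\<close> satisfies \<open>\<phi> \<le> 1\<close>, as
    the balance requires, and keeps the kernel window around any \<open>t\<close> in
    \<open>[c,d]\<close> inside \<open>(0,T)\<close>. In terms of \<epsilon> the threshold is
    \<open>m powr q\<close>.\<close>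
  define m where "m = min 1 (min (c / (- A)) ((T - d) / B))"
  have m: "0 < m" using AB(1,2) \<open>0 < c\<close> \<open>d < T\<close> by (simp add: m_def divide_pos_neg)

  have bound: "(\<integral>\<^sup>+\<omega>. ennreal \<bar>D \<theta> \<epsilon> t \<omega> - \<theta> t * unperturbed x0 \<theta> t\<bar> \<partial>M)
      * ennreal (\<epsilon> powr (- (real (k + 1) / q))) \<le> ennreal (Cnoise + Cbias)"
    if \<epsilon>: "0 < \<epsilon>" "\<epsilon> < m powr q" and \<theta>: "\<theta> \<in> Theta_class (Suc k) L L' T" and t: "t \<in> {c..d}" for \<epsilon> \<theta> t
  proof -
    define \<phi> where "\<phi> = bandwidth k \<alpha> \<epsilon>"
    have \<phi>_eq: "\<phi> = \<epsilon> powr (1 / q)" by (simp add: \<phi>_def bandwidth_def q_def)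
    have \<phi>0: "0 < \<phi>" using \<epsilon>(1) by (simp add: \<phi>_eq)
    have "\<phi> < (m powr q) powr (1 / q)"
      unfolding \<phi>_eq using \<epsilon> q by (intro powr_less_mono2) auto
    also have "\<dots> = m" using m q by (simp add: powr_powr)
    finally have "\<phi> < 1" "\<phi> < c / (- A)" "\<phi> < (T - d) / B" by (simp_all add: m_def)
    then have \<phi>: "\<phi> \<le> 1" "\<phi> * (- A) < c" "\<phi> * B < T - d"
      using AB(1,2) by (simp, simp_all only: pos_less_divide_eq neg_0_less_iff_less)
    have \<phi>t: "0 < t + \<phi> * A" "t + \<phi> * B < T" using \<phi> t by auto
    have t_mem: "t \<in> {0..T}" using t \<open>0 < c\<close> \<open>d < T\<close> by auto
    have \<epsilon>_eq: "\<epsilon> = \<phi> powr (real k - 1 / \<alpha> + 2)"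
      unfolding q_def[symmetric] \<phi>_eq using \<epsilon>(1) q by (simp add: powr_powr)
    define f where "f \<tau> = G ((\<tau> - t) / \<phi>)" for \<tau>
    have f_meas: "f \<in> borel_measurable borel" unfolding f_def using G_meas by measurable
    have f_le: "\<bar>f \<tau>\<bar> \<le> B0" for \<tau> unfolding f_def by (rule B0)
    have "is_kernel_estimator M \<alpha> T G \<phi> (X \<theta> \<epsilon>) t (D \<theta> \<epsilon> t)"
      unfolding \<phi>_def using D \<theta> \<epsilon>(1) t_mem by simp
    then obtain J where J: "has_stochastic_integral M \<alpha> T (X \<theta> \<epsilon>) f J" and D_eq: "D \<theta> \<epsilon> t = (\<lambda>\<omega>. (1 / \<phi>) * J \<omega>)"
      unfolding is_kernel_estimator_def f_def by blast
    have [measurable]: "J \<in> borel_measurable M" using J by (simp add: has_stochastic_integral_def)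
    define Q where "Q = (LINT \<tau>:{0..T}|lborel. f \<tau> * (\<theta> \<tau> * unperturbed x0 \<theta> \<tau>))"
    have F1: "(\<integral>\<^sup>+\<tau>\<in>{0..T}. ennreal \<bar>f \<tau>\<bar> \<partial>lborel) \<le> ennreal (g1 * \<phi>)"
      using nn_integral_kernel_powr_le[where G = G and A = A and B = B and r = 1 and S = "{0..T}" and t = t,
        OF B0 _ AB(3) \<phi>0 zero_less_one] AB(1,2) B0_nonneg
      by (simp add: f_def g1_def)
    have F2: "(\<integral>\<^sup>+\<tau>\<in>{0..T}. ennreal (\<bar>f \<tau>\<bar> powr \<alpha>) \<partial>lborel) \<le> ennreal (g2 * \<phi>)"
      unfolding f_def g2_def using \<alpha> AB(1,2) by (intro nn_integral_kernel_powr_le B0 AB(3) \<phi>0) auto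
    have "(\<integral>\<^sup>+\<omega>. ennreal \<bar>J \<omega> - Q\<bar> \<partial>M)
      \<le> ennreal (\<epsilon> * C1 * (g1 * \<phi> + \<phi> ^ (k + 2)) + C2 * \<phi> ^ (k + 2)
      + \<epsilon> * (c1 * (C3 * (2 powr \<alpha> * (g2 * \<phi> + \<phi> ^ (k + 2))) * (\<phi> powr (- (1 / \<alpha>))) powr (\<alpha> - 1) / (\<alpha> - 1)
          + 2 / \<phi> powr (- (1 / \<alpha>)))))" (is "_ \<le> ennreal ?N")
      unfolding Q_def C1_def C2_def c1_def C3_def
    proof (rule nn_integral_stochastic_integral_error_le[OF \<open>right_continuous_filtration M F\<close> \<alpha>
          \<open>stable_Levy_process M F \<alpha> \<beta> Z\<close> L T _ Theta_class_continuous_on[OF \<theta>] _ _ f_meas f_le K J F1 _ F2])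
      show "\<bar>\<theta> s\<bar> \<le> L" if "s \<in> {0..T}" for s by (rule Theta_classD(1)[OF \<theta> that])
      show "solves_linear_SDE M F Z T x0 \<theta> \<epsilon> (X \<theta> \<epsilon>)" using X \<theta> \<epsilon>(1) by simp
    qed (use \<epsilon>(1) \<phi>0 const_nonneg in auto)
    then have "ennreal (1 / \<phi>) * (\<integral>\<^sup>+\<omega>. ennreal \<bar>J \<omega> - Q\<bar> \<partial>M) \<le> ennreal (1 / \<phi>) * ennreal ?N"
      by (rule mult_left_mono) simp
    also have "\<dots> = ennreal ((1 / \<phi>) * ?N)"
      using \<phi>0 by (intro ennreal_mult'[symmetric]) simp
    also have "\<dots> \<le> ennreal (Cnoise * \<phi> ^ Suc k)"
      unfolding Cnoise_def using const_nonneg \<phi>0 \<phi>(1) \<alpha> \<epsilon>_eq by (intro ennreal_leI bandwidth_balance) auto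
    finally have noise: "ennreal (1 / \<phi>) * (\<integral>\<^sup>+\<omega>. ennreal \<bar>J \<omega> - Q\<bar> \<partial>M) \<le> ennreal (Cnoise * \<phi> ^ Suc k)" .
    have bias: "\<bar>(1 / \<phi>) * Q - \<theta> t * unperturbed x0 \<theta> t\<bar> \<le> Cbias * \<phi> ^ Suc k"
      unfolding Q_def f_def Cbias_def
      by (rule kernel_bias_le[OF G_meas B0 AB \<open>kernel_A3 k G\<close> \<phi>0 \<phi>t Cg(2)[OF \<theta>] Cg(1)])
    have "(\<integral>\<^sup>+\<omega>. ennreal \<bar>D \<theta> \<epsilon> t \<omega> - \<theta> t * unperturbed x0 \<theta> t\<bar> \<partial>M)
        \<le> (\<integral>\<^sup>+\<omega>. ennreal (1 / \<phi>) * ennreal \<bar>J \<omega> - Q\<bar> + ennreal (Cbias * \<phi> ^ Suc k) \<partial>M)"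
    proof (intro nn_integral_mono)
      fix \<omega>
      have "\<bar>D \<theta> \<epsilon> t \<omega> - \<theta> t * unperturbed x0 \<theta> t\<bar>
          = \<bar>(1 / \<phi>) * (J \<omega> - Q) + ((1 / \<phi>) * Q - \<theta> t * unperturbed x0 \<theta> t)\<bar>"
        by (simp add: D_eq right_diff_distrib)
      also have "\<dots> \<le> (1 / \<phi>) * \<bar>J \<omega> - Q\<bar> + Cbias * \<phi> ^ Suc k"
        using bias \<phi>0 by (intro order_trans[OF abs_triangle_ineq] add_mono) (auto simp: abs_mult)
      finally have "ennreal \<bar>D \<theta> \<epsilon> t \<omega> - \<theta> t * unperturbed x0 \<theta> t\<bar> \<le> ennreal \<dots>" by (rule ennreal_leI)
      also have "\<dots> = ennreal ((1 / \<phi>) * \<bar>J \<omega> - Q\<bar>) + ennreal (Cbias * \<phi> ^ Suc k)"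
        using \<phi>0 nonneg(2) by (intro ennreal_plus) simp_all
      also have "ennreal ((1 / \<phi>) * \<bar>J \<omega> - Q\<bar>) = ennreal (1 / \<phi>) * ennreal \<bar>J \<omega> - Q\<bar>"
        using \<phi>0 by (intro ennreal_mult) simp_all
      finally show "ennreal \<bar>D \<theta> \<epsilon> t \<omega> - \<theta> t * unperturbed x0 \<theta> t\<bar>
          \<le> ennreal (1 / \<phi>) * ennreal \<bar>J \<omega> - Q\<bar> + ennreal (Cbias * \<phi> ^ Suc k)" .
    qed
    also have "\<dots> = ennreal (1 / \<phi>) * (\<integral>\<^sup>+\<omega>. ennreal \<bar>J \<omega> - Q\<bar> \<partial>M) + ennreal (Cbias * \<phi> ^ Suc k)"
      by (subst nn_integral_add) (simp_all add: nn_integral_cmult emeasure_space_1)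
    also have "\<dots> \<le> ennreal (Cnoise * \<phi> ^ Suc k) + ennreal (Cbias * \<phi> ^ Suc k)"
      by (intro add_right_mono noise)
    also have "\<dots> = ennreal ((Cnoise + Cbias) * \<phi> ^ Suc k)"
      using nonneg \<phi>0 by (simp add: distrib_right)
    finally have "(\<integral>\<^sup>+\<omega>. ennreal \<bar>D \<theta> \<epsilon> t \<omega> - \<theta> t * unperturbed x0 \<theta> t\<bar> \<partial>M) * ennreal (\<epsilon> powr (- (real (k + 1) / q)))
        \<le> ennreal ((Cnoise + Cbias) * \<phi> ^ Suc k) * ennreal (\<epsilon> powr (- (real (k + 1) / q)))"
      by (rule mult_right_mono) simp
    also have "\<dots> = ennreal ((Cnoise + Cbias) * (\<phi> ^ Suc k * \<epsilon> powr (- (real (k + 1) / q))))"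
      using nonneg \<phi>0 by (simp add: ennreal_mult[symmetric] mult.assoc)
    \<comment> \<open>The normalising power of \<epsilon> is exactly the inverse of the rate
      \<open>\<phi> ^ (k + 1)\<close>.\<close>
    also have "\<phi> ^ Suc k * \<epsilon> powr (- (real (k + 1) / q)) = 1"
    proof -
      have "\<phi> ^ Suc k = \<phi> powr real (k + 1)" using \<phi>0 by (subst powr_realpow) auto
      also have "\<dots> = \<epsilon> powr (real (k + 1) / q)" unfolding \<phi>_eq by (simp add: powr_powr)
      finally have "\<phi> ^ Suc k = \<epsilon> powr (real (k + 1) / q)" .
      then show ?thesis using \<epsilon>(1) by (simp add: powr_add[symmetric])
    qed
    finally show ?thesis by simp
  qed
  \<comment> \<open>Neither the threshold \<open>m powr q\<close> nor the constant depends on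
    \<theta> or \<open>t\<close>, so both suprema can be taken for each fixed \<epsilon>.\<close>
  have "\<forall>\<^sub>F \<epsilon> in at_right 0. (SUP \<theta> \<in> Theta_class (k + 1) L L' T. SUP t \<in> {c..d}.
             (\<integral>\<^sup>+\<omega>. ennreal \<bar>D \<theta> \<epsilon> t \<omega> - \<theta> t * unperturbed x0 \<theta> t\<bar> \<partial>M)
               * ennreal (\<epsilon> powr (- (real (k + 1) / (real k - 1 / \<alpha> + 2))))) \<le> ennreal (Cnoise + Cbias)"
    unfolding eventually_at_right_field q_def[symmetric]
  proof (intro exI[of _ "m powr q"] conjI allI impI SUP_least)
    show "0 < m powr q" using m by simp
  qed (rule bound, auto)
  then have "Limsup (at_right 0) (\<lambda>\<epsilon>. SUP \<theta> \<in> Theta_class (k + 1) L L' T. SUP t \<in> {c..d}.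
             (\<integral>\<^sup>+\<omega>. ennreal \<bar>D \<theta> \<epsilon> t \<omega> - \<theta> t * unperturbed x0 \<theta> t\<bar> \<partial>M)
               * ennreal (\<epsilon> powr (- (real (k + 1) / (real k - 1 / \<alpha> + 2))))) \<le> ennreal (Cnoise + Cbias)"
    by (rule Limsup_bounded)
  also have "\<dots> < \<infinity>" by simp
  finally show ?thesis .
qed

end
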